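(* Let $p\ge 3$ be an integer and let $T=B(2k,s,t)$ be a double broom with $k,s,t\ge 2$. Then for all sufficiently large $n$, $$\mathrm{ex}(n,T^{p+1})=h(n,p,k+1).$$ Furthermore, for all sufficiently large $n$, $H(n,p,k+1)$ is the unique (up to isomorphism) extremal graph for $T^{p+1}$ on $n$ vertices.
   Context: All graphs are finite and simple. A graph is $H$-free if it contains no copy of $H$ as a (not necessarily induced) subgraph. $\mathrm{ex}(n,H)$ is the maximum number of edges of an $H$-free graph on $n$ vertices; an extremal graph for $H$ on $n$ vertices is an $H$-free graph on $n$ vertices with $\mathrm{ex}(n,H)$ edges. For $\ell,s,t\ge 2$, the double broom $B(\ell,s,t)$ is the tree obtained from a path $P_\ell$ on $\ell$ vertices by attaching $s$ pendant edges (to new leaves) to one end vertex of $P_\ell$ and $t$ pendant edges to the other end vertex of $P_\ell$. For a graph $H$ and an integer $p\ge 2$, the edge blow-up $H^{p+1}$ is the graph obtained from $H$ by replacing each edge of $H$ by a clique on $p+1$ vertices (containing the two ends of the edge), where the new vertices of the cliques are all distinct. The join $G+H$ of disjoint graphs is obtained from their disjoint union by adding all edges between $V(G)$ and $V(H)$. $T(n,p)$ is the $p$-partite Turán graph on $n$ vertices, i.e. the complete $p$-partite graph on $n$ vertices whose class sizes pairwise differ by at most $1$. $H(n,p,q)=K_{q-1}+T(n-q+1,p)$ and $h(n,p,q)=e(H(n,p,q))$ is its number of edges. *)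

theory Defs
  imports Main "HOL-Library.Ramsey"
begin

record 'a sgraph =
  verts :: "'a set"
  edges :: "'a set set"

definition simple_graph :: "'a sgraph \<Rightarrow> bool" where
  "simple_graph G \<longleftrightarrow> finite (verts G) \<and> edges G \<subseteq> nsets (verts G) 2"

definition graph_iso :: "'a sgraph \<Rightarrow> 'b sgraph \<Rightarrow> bool" where
  "graph_iso G H \<longleftrightarrow>
     (\<exists>f. bij_betw f (verts G) (verts H) \<and> edges H = (\<lambda>e. f ` e) ` edges G)"

definition contains_copy :: "'a sgraph \<Rightarrow> 'b sgraph \<Rightarrow> bool" where
  "contains_copy G H \<longleftrightarrow>
     (\<exists>f. inj_on f (verts H) \<and> f ` verts H \<subseteq> verts G \<and> (\<forall>e \<in> edges H. f ` e \<in> edges G))"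

definition free_graph_on :: "nat \<Rightarrow> 'b sgraph \<Rightarrow> 'a sgraph \<Rightarrow> bool" where
  "free_graph_on n H G \<longleftrightarrow>
     simple_graph G \<and> card (verts G) = n \<and> \<not> contains_copy G H"

(* Every finite graph is isomorphic to one whose vertices are natural numbers, so the maximum
   may be taken over those. Max is meaningful because the set is finite, and nonempty
   as soon as H has an edge. *)
definition ex_num :: "nat \<Rightarrow> 'b sgraph \<Rightarrow> nat" where
  "ex_num n H = Max {card (edges G) | G :: nat sgraph. free_graph_on n H G}"

definition extremal_graph :: "nat \<Rightarrow> 'b sgraph \<Rightarrow> 'a sgraph \<Rightarrow> bool" where
  "extremal_graph n H G \<longleftrightarrow> free_graph_on n H G \<and> card (edges G) = ex_num n H"

(* The path is 0, ..., l - 1; the leaves l, ..., l + s - 1 hang from 0 and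
   the leaves l + s, ..., l + s + t - 1 hang from l - 1. *)
definition double_broom :: "nat \<Rightarrow> nat \<Rightarrow> nat \<Rightarrow> nat sgraph" where
  "double_broom l s t =
     \<lparr> verts = {..<l + s + t},
       edges = {{i, i + 1} | i. i + 1 < l}
             \<union> {{0, l + j} | j. j < s}
             \<union> {{l - 1, l + s + j} | j. j < t} \<rparr>"

(* The vertices of the r-clique that replaces the edge e: the two ends of e and
   r - 2 new vertices, tagged with e so that different cliques get different ones. *)
definition blowup_clique :: "nat \<Rightarrow> 'a set \<Rightarrow> ('a + 'a set \<times> nat) set" where
  "blowup_clique r e = Inl ` e \<union> Inr ` ({e} \<times> {..<r - 2})"

(* edge_blowup H (p + 1) is the edge blow-up of H with exponent p + 1. *)
definition edge_blowup :: "'a sgraph \<Rightarrow> nat \<Rightarrow> ('a + 'a set \<times> nat) sgraph" where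
  "edge_blowup H r =
     \<lparr> verts = Inl ` verts H \<union> (\<Union>e \<in> edges H. blowup_clique r e),
       edges = (\<Union>e \<in> edges H. nsets (blowup_clique r e) 2) \<rparr>"

definition graph_join :: "'a sgraph \<Rightarrow> 'b sgraph \<Rightarrow> ('a + 'b) sgraph" where
  "graph_join G H =
     \<lparr> verts = Inl ` verts G \<union> Inr ` verts H,
       edges = (\<lambda>e. Inl ` e) ` edges G \<union> (\<lambda>e. Inr ` e) ` edges H
             \<union> {{Inl u, Inr v} | u v. u \<in> verts G \<and> v \<in> verts H} \<rparr>"

definition complete_graph :: "nat \<Rightarrow> nat sgraph" where
  "complete_graph n = \<lparr> verts = {..<n}, edges = nsets {..<n} 2 \<rparr>"

(* The classes are the fibres of c. *)
definition complete_multipartite :: "'a set \<Rightarrow> ('a \<Rightarrow> 'c) \<Rightarrow> 'a sgraph" where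
  "complete_multipartite V c =
     \<lparr> verts = V, edges = {{u, v} | u v. u \<in> V \<and> v \<in> V \<and> c u \<noteq> c v} \<rparr>"

(* The classes are the residue classes modulo p; turan_classes_balanced below shows that
   their sizes differ by at most 1. *)
definition turan_graph :: "nat \<Rightarrow> nat \<Rightarrow> nat sgraph" where
  "turan_graph n p = complete_multipartite {..<n} (\<lambda>v. v mod p)"

lemma turan_classes_balanced:
  fixes n p i j :: nat
  assumes "i < p" "j < p"
  shows "card {v \<in> {..<n}. v mod p = i} \<le> card {v \<in> {..<n}. v mod p = j} + 1"
proof -
  let ?A = "{v \<in> {..<n}. v mod p = i}" and ?B = "{v \<in> {..<n}. v mod p = j}"
  let ?g = "\<lambda>v. (v div p - 1) * p + j"
  have A: "v = v div p * p + i" if "v \<in> ?A" for v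
    using that div_mult_mod_eq[of v p] by simp
  have big: "v div p \<noteq> 0" if "v \<in> ?A - {i}" for v
    using that A[of v] by fastforce
  have "inj_on ?g (?A - {i})"
  proof (rule inj_onI)
    fix x y assume x: "x \<in> ?A - {i}" and y: "y \<in> ?A - {i}" and e: "?g x = ?g y"
    then have "x div p - 1 = y div p - 1" using assms by simp
    then have "x div p = y div p" using big[OF x] big[OF y] by linarith
    then show "x = y" using A[of x] A[of y] x y by (metis DiffD1)
  qed
  moreover have "?g ` (?A - {i}) \<subseteq> ?B"
  proof (rule image_subsetI)
    fix v assume v: "v \<in> ?A - {i}"
    obtain m where m: "v div p = Suc m" using big[OF v] not0_implies_Suc by blast
    have "v = p + m * p + i" using A[of v] v m by simp
    moreover have "v < n" using v by simp
    ultimately show "?g v \<in> ?B" using assms m by simp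
  qed
  ultimately have "card (?A - {i}) \<le> card ?B"
    by (rule card_inj_on_le) simp
  then show ?thesis
    using card_Diff_singleton_if[of ?A i] by (simp split: if_splits)
qed

(* For 1 \<le> q \<le> n, the subtraction n - (q - 1) on the naturals is n - q + 1. *)
definition H_graph :: "nat \<Rightarrow> nat \<Rightarrow> nat \<Rightarrow> (nat + nat) sgraph" where
  "H_graph n p q = graph_join (complete_graph (q - 1)) (turan_graph (n - (q - 1)) p)"

definition h_num :: "nat \<Rightarrow> nat \<Rightarrow> nat \<Rightarrow> nat" where
  "h_num n p q = card (edges (H_graph n p q))"

end

theory Submission
  imports Defs Complex_Main
begin

text \<open>Let \<open>F\<close> be the blow-up of the broom \<open>T\<close>, and let \<open>G\<close> be an \<open>F\<close>-free graph on \<open>n\<close> vertices with at least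
  as many edges as \<open>H(n, p, k + 1)\<close>. Deleting vertices of too small degree increases the excess over
  \<open>h\<close>, so we may assume that every vertex has at most \<open>n/p + 1\<close> non-neighbours.
  Then \<open>G\<close> contains a complete \<open>p\<close>-partite graph with large classes. Sorting the vertices by the class in
  which they have few neighbours gives a partition of almost all of \<open>G\<close>; no part contains a matching of
  size \<open>e(T)\<close>, since its edges could serve as new edges of the \<open>e(T)\<close> cliques of \<open>F\<close>, with the vertices of
  \<open>T\<close> in the other classes (this needs \<open>p \<ge> 3\<close>). So each part is independent up to boundedly many vertices.

  Call a vertex full if it has many neighbours in all \<open>p\<close> of these independent sets. There are at most
  \<open>k\<close> full vertices: \<open>k + 1\<close> of them could cover the cliques of \<open>F\<close>, taking the roles of
  the path vertices \<open>0, 3, 5, \<dots>, 2k - 1\<close> and of a new vertex of the clique on \<open>{1, 2}\<close>. Counting edges shows that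
  there are exactly \<open>k\<close> and that they are adjacent to almost everything. One further edge inside a part
  would serve in the clique on \<open>{1, 2}\<close> and again give \<open>F\<close>, so \<open>G\<close> is the join of a
  \<open>k\<close>-clique and a complete \<open>p\<close>-partite graph, necessarily balanced.

  Conversely, \<open>T\<close> has \<open>k + 1\<close> disjoint edges, so \<open>F\<close> has \<open>k + 1\<close> disjoint cliques on \<open>p + 1\<close> vertices,
  each of which would need its own vertex of the \<open>k\<close>-clique.\<close>

text \<open>The count \<open>k\<close> comes from one edge: the \<open>k\<close> path vertices
  \<open>0, 3, 5, ..., 2k - 1\<close> meet every edge of \<open>T\<close> except
  \<open>{1, 2}\<close>. So \<open>k\<close> full vertices are one step short of \<open>F\<close>,
  and one more full vertex, or one edge inside a part, completes it.

  The obstacle is that a full vertex may be joined to only a small fraction of each class, so two of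
  them need not have common neighbours in a class chosen beforehand. Only the degree bound helps:
  two vertices together miss about \<open>2n/p < n\<close> vertices, so some class serves both. At
  \<open>{1, 2}\<close> this is not enough: the vertices 1 and 2 are adjacent and need different
  classes. Hence three full vertices must first be put in a suitable order; here
  \<open>p >= 3\<close> enters again.

  The estimates run on separated scales: the bound \<open>E\<close> on the number of vertices
  outside the independent sets, the threshold \<open>Y\<close> for being full, and \<open>n\<close>.
  Losses of order \<open>E\<close> vanish against \<open>Y\<close>, and the at most
  \<open>4 b^2 Y\<close> edges inside parts, with \<open>b\<close> the number of vertices of
  \<open>F\<close>, vanish against the roughly \<open>n/p\<close> edges lost if a full vertex is
  missing.\<close>

definition adj :: "'a sgraph \<Rightarrow> 'a \<Rightarrow> 'a \<Rightarrow> bool" where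
  "adj G u v \<longleftrightarrow> {u, v} \<in> edges G"

lemma adj_commute: "adj G u v \<longleftrightarrow> adj G v u"
  by (simp add: adj_def insert_commute)

lemma nsets_2_iff: "e \<in> nsets A 2 \<longleftrightarrow> (\<exists>u v. u \<in> A \<and> v \<in> A \<and> u \<noteq> v \<and> e = {u, v})"
  by (auto simp: nsets_def card_2_iff)

lemma simple_graph_adjD:
  assumes "simple_graph G" "adj G u v"
  shows "u \<in> verts G" "v \<in> verts G" "u \<noteq> v"
proof -
  have e: "{u, v} \<in> nsets (verts G) 2"
    using assms unfolding simple_graph_def adj_def by blast
  then show "u \<in> verts G" "v \<in> verts G"
    by (auto simp: nsets_def)
  have "card {u, v} = 2" using e by (simp add: nsets_def)
  then show "u \<noteq> v" by auto
qed

lemma simple_graph_edgeE: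
  assumes "simple_graph G" "e \<in> edges G"
  obtains u v where "e = {u, v}" "u \<in> verts G" "v \<in> verts G" "u \<noteq> v" "adj G u v"
proof -
  have "e \<in> nsets (verts G) 2"
    using assms by (auto simp: simple_graph_def)
  then obtain u v where "e = {u, v}" "u \<in> verts G" "v \<in> verts G" "u \<noteq> v"
    by (auto simp: nsets_2_iff)
  then show thesis using that assms(2) by (simp add: adj_def)
qed

lemma finite_edges: "simple_graph G \<Longrightarrow> finite (edges G)"
  by (auto simp: simple_graph_def intro: finite_subset finite_imp_finite_nsets)

section \<open>Embedding edge blow-ups\<close>

text \<open>The vertices outside \<open>S\<close> are placed one at a time. Each vertex placed
  before \<open>v\<close> rules out its own image and at most \<open>d\<close> further candidates,
  and fewer than \<open>card X\<close> vertices have been placed, so \<open>card X * (d + 1)\<close>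
  candidates always leave one.\<close>

lemma greedy_embedding:
  fixes R :: "'b \<Rightarrow> 'b \<Rightarrow> bool" and Q :: "'a \<Rightarrow> 'a \<Rightarrow> bool"
  assumes fin: "finite X" and SX: "S \<subseteq> X" and inj: "inj_on \<phi> S"
    and symR: "\<And>u v. R u v \<longleftrightarrow> R v u" and irR: "\<And>u. \<not> R u u"
    and symQ: "\<And>u v. Q u v \<longleftrightarrow> Q v u"
    and S: "\<And>u v. u \<in> S \<Longrightarrow> v \<in> S \<Longrightarrow> R u v \<Longrightarrow> Q (\<phi> u) (\<phi> v)"
    and large: "\<And>v. v \<in> X - S \<Longrightarrow> card X * (d + 1) \<le> card (C v)"
    and SC: "\<And>u v y. u \<in> S \<Longrightarrow> v \<in> X - S \<Longrightarrow> R u v \<Longrightarrow> y \<in> C v \<Longrightarrow> Q (\<phi> u) y"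
    and CC: "\<And>u v y. u \<in> X - S \<Longrightarrow> v \<in> X - S \<Longrightarrow> R u v \<Longrightarrow> y \<in> C u \<Longrightarrow>
               card {z \<in> C v. \<not> Q y z} \<le> d"
  obtains f where "inj_on f X" "\<And>u. u \<in> S \<Longrightarrow> f u = \<phi> u" "\<And>v. v \<in> X - S \<Longrightarrow> f v \<in> C v"
    "\<And>u v. u \<in> X \<Longrightarrow> v \<in> X \<Longrightarrow> R u v \<Longrightarrow> Q (f u) (f v)"
proof -
  define ok where "ok Y f \<longleftrightarrow> inj_on f (S \<union> Y) \<and> (\<forall>u\<in>S. f u = \<phi> u) \<and> (\<forall>v\<in>Y. f v \<in> C v)
      \<and> (\<forall>u\<in>S \<union> Y. \<forall>v\<in>S \<union> Y. R u v \<longrightarrow> Q (f u) (f v))" for Y f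
  have "\<exists>f. ok Y f" if "finite Y" "Y \<subseteq> X - S" for Y
    using that
  proof (induction Y rule: finite_induct)
    case empty
    then have "ok {} \<phi>" using inj S by (auto simp: ok_def)
    then show ?case by blast
  next
    case (insert v Y)
    then obtain f where f: "ok Y f" by auto
    define bad where "bad = f ` (S \<union> Y) \<union> (\<Union>u\<in>{u\<in>Y. R u v}. {z \<in> C v. \<not> Q (f u) z})"
    have v: "v \<in> X - S" "v \<notin> Y" and Y: "Y \<subseteq> X - S" using insert by auto
    have finS: "finite S" using SX fin finite_subset by blast
    have lt: "card (S \<union> Y) < card X"
      by (rule psubset_card_mono[OF fin]) (use v Y SX in auto)
    have "card bad \<le> card (f ` (S \<union> Y)) + card (\<Union>u\<in>{u\<in>Y. R u v}. {z \<in> C v. \<not> Q (f u) z})"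
      unfolding bad_def by (rule card_Un_le)
    also have "card (f ` (S \<union> Y)) \<le> card (S \<union> Y)"
      using finS insert.hyps by (intro card_image_le) auto
    also have "card (\<Union>u\<in>{u\<in>Y. R u v}. {z \<in> C v. \<not> Q (f u) z})
        \<le> (\<Sum>u\<in>{u\<in>Y. R u v}. card {z \<in> C v. \<not> Q (f u) z})"
      using insert.hyps by (intro card_UN_le) auto
    also have "\<dots> \<le> (\<Sum>u\<in>{u\<in>Y. R u v}. d)"
    proof (rule sum_mono)
      fix u assume "u \<in> {u \<in> Y. R u v}"
      then show "card {z \<in> C v. \<not> Q (f u) z} \<le> d"
        using CC[of u v "f u"] f Y v by (auto simp: ok_def)
    qed
    also have "\<dots> \<le> card (S \<union> Y) * d"
      using insert.hyps finS by (auto intro!: card_mono)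
    finally have "card bad \<le> card (S \<union> Y) * (d + 1)" by simp
    also have "\<dots> < card X * (d + 1)" using lt by (intro mult_strict_right_mono) auto
    also have "\<dots> \<le> card (C v)" using large v by auto
    finally have lt: "card bad < card (C v)" .
    have "finite (C v)" using lt by (metis card.infinite not_less_zero)
    then have "finite bad" unfolding bad_def using finS insert.hyps by auto
    then have "\<not> C v \<subseteq> bad" using lt card_mono leD by blast
    then obtain y where y: "y \<in> C v" "y \<notin> bad" by blast
    have yQ: "Q (f u) y" if "u \<in> S \<union> Y" "R u v" for u
      using that f y SC[of u v y] v by (auto simp: ok_def bad_def)
    have "ok (insert v Y) (f(v := y))"
      unfolding ok_def
    proof (intro conjI ballI impI)
      show "inj_on (f(v := y)) (S \<union> insert v Y)"
        using f v y by (auto simp: ok_def bad_def inj_on_def)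
      show "(f(v := y)) u = \<phi> u" if "u \<in> S" for u using that f v by (auto simp: ok_def)
      show "(f(v := y)) u \<in> C u" if "u \<in> insert v Y" for u using that f y by (auto simp: ok_def)
      fix a b assume ab: "a \<in> S \<union> insert v Y" "b \<in> S \<union> insert v Y" "R a b"
      consider "a = v" "b = v" | "a = v" "b \<in> S \<union> Y" "b \<noteq> v" | "b = v" "a \<in> S \<union> Y" "a \<noteq> v"
        | "a \<noteq> v" "b \<noteq> v" "a \<in> S \<union> Y" "b \<in> S \<union> Y" using ab by blast
      then show "Q ((f(v := y)) a) ((f(v := y)) b)"
      proof cases
        case 1 then show ?thesis using ab irR by auto
      next
        case 2 then show ?thesis using ab yQ[of b] symR symQ by auto
      next
        case 3 then show ?thesis using ab yQ[of a] by auto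
      next
        case 4 then show ?thesis using f ab by (auto simp: ok_def)
      qed
    qed
    then show ?case by blast
  qed
  from this[of "X - S"] fin obtain f where "ok (X - S) f" by auto
  moreover have "S \<union> (X - S) = X" using SX by blast
  ultimately show thesis by (intro that[of f]) (auto simp: ok_def)
qed

text \<open>For \<open>E = edges T\<close> this is adjacency in \<open>edge_blowup T r\<close>, as
  the symmetric irreflexive relation that the greedy embedding takes.\<close>

definition clique_adj :: "'b set set \<Rightarrow> nat \<Rightarrow> ('b + 'b set \<times> nat) \<Rightarrow> ('b + 'b set \<times> nat) \<Rightarrow> bool" where
  "clique_adj E r u v \<longleftrightarrow> u \<noteq> v \<and> (\<exists>e\<in>E. u \<in> blowup_clique r e \<and> v \<in> blowup_clique r e)"

lemma finite_verts_edge_blowup: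
  assumes "simple_graph T" shows "finite (verts (edge_blowup T r))"
proof -
  have "finite e" if "e \<in> edges T" for e
    using that assms by (auto simp: simple_graph_def nsets_def)
  then show ?thesis
    using assms finite_edges[OF assms]
    by (auto simp: edge_blowup_def blowup_clique_def simple_graph_def)
qed

text \<open>The preassigned vertices are \<open>SV\<close> and the first \<open>r e\<close> new
  vertices of each clique. All others go greedily into the classes \<open>I\<close>:
  \<open>col\<close> gives the class of a free vertex of \<open>T\<close>, and \<open>K e\<close>
  lists the classes open to the clique on \<open>e\<close>. The cardinality condition on
  \<open>K e\<close> says that the free vertices of each clique can be spread over different
  classes, where a vertex misses at most \<open>d\<close> vertices of another class.\<close>

lemma blowup_embedding:
  fixes T :: "'b sgraph" and G :: "'a sgraph" and I :: "'c \<Rightarrow> 'a set" and p :: nat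
    and SV :: "'b set" and r :: "'b set \<Rightarrow> nat" and \<phi> :: "'b + 'b set \<times> nat \<Rightarrow> 'a"
  defines "F \<equiv> edge_blowup T (p + 1)"
  defines "R \<equiv> clique_adj (edges T) (p + 1)"
  defines "b \<equiv> card (verts F)"
  assumes T: "simple_graph T" and G: "simple_graph G"
    and SV: "SV \<subseteq> verts T" and r: "\<And>e. e \<in> edges T \<Longrightarrow> r e \<le> p - 1"
  defines "S \<equiv> Inl ` SV \<union> Inr ` (SIGMA e : edges T. {..<r e})"
  assumes inj: "inj_on \<phi> S" and img: "\<phi> ` S \<subseteq> verts G"
    and SS: "\<And>u v. u \<in> S \<Longrightarrow> v \<in> S \<Longrightarrow> R u v \<Longrightarrow> adj G (\<phi> u) (\<phi> v)"
    and K: "\<And>e. e \<in> edges T \<Longrightarrow> finite (K e) \<and> card (e - SV) + (p - 1 - r e) \<le> card (K e)"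
    and col: "\<And>e v. e \<in> edges T \<Longrightarrow> v \<in> e - SV \<Longrightarrow> col v \<in> K e"
    and proper: "\<And>u v. {u, v} \<in> edges T \<Longrightarrow> u \<notin> SV \<Longrightarrow> v \<notin> SV \<Longrightarrow> col u \<noteq> col v"
    and I: "\<And>c. I c \<subseteq> verts G"
    and miss: "\<And>c c' y. c \<noteq> c' \<Longrightarrow> y \<in> I c \<Longrightarrow> card {z \<in> I c'. \<not> adj G y z} \<le> d"
    and large: "\<And>v. v \<in> verts T - SV \<Longrightarrow>
        b * (d + 1) \<le> card {y \<in> I (col v). \<forall>u\<in>S. R u (Inl v) \<longrightarrow> adj G (\<phi> u) y}"
    and large': "\<And>e c. e \<in> edges T \<Longrightarrow> c \<in> K e \<Longrightarrow>
        b * (d + 1) \<le> card {y \<in> I c. \<forall>u\<in>S. u \<in> blowup_clique (p + 1) e \<longrightarrow> adj G (\<phi> u) y}"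
  shows "contains_copy G F"
proof -
  \<comment> \<open>The remaining new vertices of the clique on \<open>e\<close> get distinct
    classes from \<open>K e\<close> that the free ends of \<open>e\<close> do not occupy.\<close>
  have "\<exists>g. inj_on g {r e..<p - 1} \<and> g ` {r e..<p - 1} \<subseteq> K e - col ` (e - SV)"
    if e: "e \<in> edges T" for e
  proof -
    have fe: "finite e" using e T by (auto simp: simple_graph_def nsets_def)
    have "card {r e..<p - 1} \<le> card (K e) - card (e - SV)" using K[OF e] by (simp add: le_diff_conv2 add.commute)
    also have "\<dots> \<le> card (K e) - card (col ` (e - SV))"
      using card_image_le[of "e - SV" col] fe by auto
    also have "\<dots> \<le> card (K e - col ` (e - SV))"
      using fe by (intro diff_card_le_card_Diff) auto
    finally show ?thesis
      using card_le_inj[of "{r e..<p - 1}" "K e - col ` (e - SV)"] K[OF e] by blast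
  qed
  then obtain g where g: "\<And>e. e \<in> edges T \<Longrightarrow> inj_on (g e) {r e..<p - 1}"
      "\<And>e. e \<in> edges T \<Longrightarrow> g e ` {r e..<p - 1} \<subseteq> K e - col ` (e - SV)"
    by metis
  define colF where "colF x = (case x of Inl v \<Rightarrow> col v | Inr (e, j) \<Rightarrow> g e j)" for x
  define C where "C x = {y \<in> I (colF x). \<forall>u\<in>S. R u x \<longrightarrow> adj G (\<phi> u) y}" for x
  define X where "X = verts F"
  have finX: "finite X" unfolding X_def F_def by (rule finite_verts_edge_blowup[OF T])
  have eT: "e \<subseteq> verts T" if "e \<in> edges T" for e
    using that T by (auto simp: simple_graph_def nsets_def)
  have X: "X = Inl ` verts T \<union> Inr ` (SIGMA e : edges T. {..<p - 1})"
    using eT by (auto simp: X_def F_def edge_blowup_def blowup_clique_def)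
  have SX: "S \<subseteq> X" using SV r unfolding X S_def by fastforce
  have RX: "u \<in> X \<and> v \<in> X" if "R u v" for u v
    using that eT unfolding R_def clique_adj_def X blowup_clique_def by fastforce
  have finI: "finite (I c)" for c
    using finite_subset[OF I] G by (auto simp: simple_graph_def)
  \<comment> \<open>Adjacent free vertices lie in different classes, so the bound \<open>d\<close>
    on missing edges applies to them.\<close>
  have diff: "colF u \<noteq> colF v" if "u \<in> X - S" "v \<in> X - S" and Ruv: "R u v" for u v
  proof -
    obtain e where e: "e \<in> edges T" "u \<in> blowup_clique (p + 1) e" "v \<in> blowup_clique (p + 1) e" "u \<noteq> v"
      using Ruv unfolding R_def clique_adj_def by blast
    have key: "g e j \<noteq> col x" if "j \<in> {r e..<p - 1}" "x \<in> e - SV" for j x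
      using g(2)[OF e(1)] that by blast
    show ?thesis
    proof (cases u; cases v)
      fix x y assume [simp]: "u = Inl x" "v = Inl y"
      have xy: "x \<in> e" "y \<in> e" "x \<noteq> y" "x \<notin> SV" "y \<notin> SV"
        using e that by (auto simp: blowup_clique_def S_def)
      have "card e = 2" using e T by (auto simp: simple_graph_def nsets_def)
      then have "e = {x, y}" using xy by (auto simp: card_2_iff)
      then show ?thesis using proper[of x y] e xy by (auto simp: colF_def)
    next
      fix x z assume [simp]: "u = Inl x" "v = Inr z"
      have "x \<in> e - SV" "fst z = e" "snd z \<in> {r e..<p - 1}"
        using e that by (auto simp: blowup_clique_def S_def)
      then show ?thesis using key[of "snd z" x] by (auto simp: colF_def split: prod.splits)
    next
      fix x z assume [simp]: "v = Inl x" "u = Inr z"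
      have "x \<in> e - SV" "fst z = e" "snd z \<in> {r e..<p - 1}"
        using e that by (auto simp: blowup_clique_def S_def)
      then show ?thesis using key[of "snd z" x] by (auto simp: colF_def split: prod.splits)
    next
      fix x z assume [simp]: "u = Inr x" "v = Inr z"
      have "fst x = e" "snd x \<in> {r e..<p - 1}" "fst z = e" "snd z \<in> {r e..<p - 1}" "x \<noteq> z"
        using e that by (auto simp: blowup_clique_def S_def)
      then show ?thesis using inj_onD[OF g(1)[OF e(1)], of "snd x" "snd z"]
        by (auto simp: colF_def prod_eq_iff split: prod.splits)
    qed
  qed
  have big: "card X * (d + 1) \<le> card (C v)" if v: "v \<in> X - S" for v
  proof (cases v)
    case (Inl x)
    then have "x \<in> verts T - SV" using v by (auto simp: X S_def)
    from large[OF this] show ?thesis unfolding b_def X_def C_def Inl colF_def by simp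
  next
    case (Inr z)
    then obtain e j where z: "z = (e, j)" "e \<in> edges T" "j \<in> {r e..<p - 1}"
      using v unfolding X S_def by fastforce
    have "g e j \<in> K e" using g(2)[OF z(2)] z(3) by blast
    from large'[OF z(2) this] have "card X * (d + 1) \<le>
       card {y \<in> I (g e j). \<forall>u\<in>S. u \<in> blowup_clique (p + 1) e \<longrightarrow> adj G (\<phi> u) y}"
      unfolding b_def X_def .
    also have "\<dots> \<le> card (C v)"
      using finI unfolding C_def Inr colF_def z R_def clique_adj_def
      by (intro card_mono) (auto simp: blowup_clique_def)
    finally show ?thesis .
  qed
  obtain f where f: "inj_on f X" "\<And>u. u \<in> S \<Longrightarrow> f u = \<phi> u" "\<And>v. v \<in> X - S \<Longrightarrow> f v \<in> C v"
    "\<And>u v. u \<in> X \<Longrightarrow> v \<in> X \<Longrightarrow> R u v \<Longrightarrow> adj G (f u) (f v)"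
  proof (rule greedy_embedding[of X S \<phi> R "adj G" d C, OF finX SX inj])
    show "R u v \<longleftrightarrow> R v u" for u v by (auto simp: R_def clique_adj_def)
    show "\<not> R u u" for u by (auto simp: R_def clique_adj_def)
    show "adj G u v \<longleftrightarrow> adj G v u" for u v by (rule adj_commute)
    show "card {z \<in> C v. \<not> adj G y z} \<le> d" if "u \<in> X - S" "v \<in> X - S" "R u v" "y \<in> C u" for u v y
    proof -
      have "card {z \<in> C v. \<not> adj G y z} \<le> card {z \<in> I (colF v). \<not> adj G y z}"
        using finI by (intro card_mono) (auto simp: C_def)
      also have "\<dots> \<le> d"
        using miss[OF diff[OF that(1-3)], of y] that(4) by (auto simp: C_def)
      finally show ?thesis .
    qed
  qed (use SS big in \<open>auto simp: C_def\<close>)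
  have "f v \<in> verts G" if "v \<in> X" for v
    using f(2)[of v] f(3)[of v] img I that by (cases "v \<in> S") (auto simp: C_def)
  then have img': "f ` X \<subseteq> verts G" by blast
  have "f ` e \<in> edges G" if e: "e \<in> edges F" for e
  proof -
    obtain e' where "e' \<in> edges T" "e \<in> nsets (blowup_clique (p + 1) e') 2"
      using e unfolding F_def edge_blowup_def by auto
    then obtain u v where "e = {u, v}" "R u v"
      unfolding nsets_2_iff R_def clique_adj_def by blast
    then show ?thesis using f(4)[of u v] RX[of u v] by (auto simp: adj_def)
  qed
  then show ?thesis using f(1) img' unfolding contains_copy_def X_def by blast
qed

text \<open>Nothing is preassigned: \<open>\<chi>\<close> puts the vertices of \<open>T\<close> into
  the classes 0 and 1, and in every clique the \<open>p - 1\<close> new vertices take the other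
  classes. With all edges between classes present, \<open>d = 0\<close> suffices.\<close>

lemma contains_blowup_if_multipartite:
  fixes T :: "'b sgraph" and A :: "nat \<Rightarrow> 'a set"
  assumes T: "simple_graph T" and G: "simple_graph G" and p: "p \<ge> 1"
    and \<chi>: "\<And>u v. {u, v} \<in> edges T \<Longrightarrow> \<chi> u \<noteq> (\<chi> v :: bool)"
    and A: "\<And>c. c \<le> p \<Longrightarrow> A c \<subseteq> verts G"
      "\<And>c. c \<le> p \<Longrightarrow> card (verts (edge_blowup T (p + 1))) \<le> card (A c)"
      "\<And>c c' x y. c \<le> p \<Longrightarrow> c' \<le> p \<Longrightarrow> c \<noteq> c' \<Longrightarrow> x \<in> A c \<Longrightarrow> y \<in> A c' \<Longrightarrow> adj G x y"
  shows "contains_copy G (edge_blowup T (p + 1))"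
proof -
  define I where "I c = (if c \<le> p then A c else {})" for c
  have c2: "card e = 2" if "e \<in> edges T" for e
    using that T by (auto simp: simple_graph_def nsets_def)
  have e0: "card {z \<in> I c'. \<not> adj G y z} \<le> 0" if "c \<noteq> c'" "y \<in> I c" for c c' y
  proof -
    have "{z \<in> I c'. \<not> adj G y z} = {}" using A(3)[of c c' y] that by (auto simp: I_def split: if_splits)
    then show ?thesis by (simp only: card.empty)
  qed
  have eq: "{y \<in> I c. \<forall>u\<in>Inl ` {} \<union> Inr ` (SIGMA e:edges T. {..<0}). P u y} = I c"
    for c and P :: "'b + 'b set \<times> nat \<Rightarrow> 'a \<Rightarrow> bool" by auto
  show ?thesis
  proof (rule blowup_embedding[where T = T and G = G and I = I and SV = "{}" and r = "\<lambda>_. 0" and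
        K = "\<lambda>_. {..p}" and col = "\<lambda>v. if \<chi> v then 0 else 1" and d = 0 and p = p, OF T G,
        unfolded eq])
    show "finite {..p} \<and> card (e - {}) + (p - 1 - 0) \<le> card {..p}" if "e \<in> edges T" for e
      using p c2[OF that] by simp
    show "card {z \<in> I c'. \<not> adj G y z} \<le> 0" if "c \<noteq> c'" "y \<in> I c" for c c' y
      using e0 that .
    show "(if \<chi> u then 0 else 1) \<noteq> (if \<chi> v then 0 else 1 :: nat)" if "{u, v} \<in> edges T" for u v
      using \<chi>[OF that] by auto
  qed (use p A in \<open>auto simp: I_def\<close>)
qed

text \<open>Greedy extension: if the at most \<open>2 * M\<close> ends of a matching do not meet
  every edge inside \<open>X\<close>, a missed edge enlarges the matching.\<close>

lemma matching_or_cover: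
  assumes G: "simple_graph G"
  shows "(\<exists>N \<subseteq> edges G. card N = M \<and> (\<forall>e\<in>N. e \<subseteq> X) \<and> (\<forall>e\<in>N. \<forall>e'\<in>N. e \<noteq> e' \<longrightarrow> e \<inter> e' = {}))
    \<or> (\<exists>C \<subseteq> X. finite C \<and> card C \<le> 2 * M \<and> (\<forall>x\<in>X - C. \<forall>y\<in>X - C. \<not> adj G x y))"
proof (induction M)
  case 0
  show ?case by (intro disjI1 exI[of _ "{}"]) auto
next
  case (Suc M)
  show ?case
  proof (cases "\<exists>C \<subseteq> X. finite C \<and> card C \<le> 2 * M \<and> (\<forall>x\<in>X - C. \<forall>y\<in>X - C. \<not> adj G x y)")
    case True
    then show ?thesis by (meson le_trans mult_le_mono2 le_SucI le_refl)
  next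
    case False
    then obtain N where N: "N \<subseteq> edges G" "card N = M" "\<forall>e\<in>N. e \<subseteq> X"
      "\<forall>e\<in>N. \<forall>e'\<in>N. e \<noteq> e' \<longrightarrow> e \<inter> e' = {}" using Suc.IH by blast
    have finN: "finite N" using N finite_edges[OF G] finite_subset by blast
    have c2: "card e = 2" "finite e" if "e \<in> N" for e
      using that N G by (auto simp: simple_graph_def nsets_def)
    have "card (\<Union> N) \<le> (\<Sum>e\<in>N. card e)" by (rule card_Union_le_sum_card)
    also have "\<dots> = 2 * M" using c2 N by simp
    finally have "card (\<Union> N) \<le> 2 * M" .
    moreover have "\<Union> N \<subseteq> X" "finite (\<Union> N)" using N finN c2 by auto
    ultimately obtain x y where xy: "x \<in> X - \<Union> N" "y \<in> X - \<Union> N" "adj G x y" using False by blast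
    have "{x, y} \<notin> N" using xy by auto
    then have "card (insert {x, y} N) = Suc M" using N finN by simp
    then show ?thesis using N xy
      by (intro disjI1 exI[of _ "insert {x, y} N"]) (auto simp: adj_def)
  qed
qed

text \<open>The count is \<open>p + 1 = 2 + (p - 1)\<close>: a clique of the blow-up takes two new
  vertices from a matching edge in \<open>X\<close> and one vertex from each class in
  \<open>K\<close>, two of these classes carrying the bipartition of \<open>T\<close>. In the
  applications \<open>X\<close> is the part of one class and \<open>K\<close> consists of the other
  classes.\<close>

lemma blowup_free_cover:
  fixes T :: "'b sgraph" and I :: "nat \<Rightarrow> 'a set" and p :: nat
  defines "F \<equiv> edge_blowup T (p + 1)"
  assumes T: "simple_graph T" and G: "simple_graph G" and p: "p \<ge> 3"
    and free: "\<not> contains_copy G F"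
    and \<chi>: "\<And>u v. {u, v} \<in> edges T \<Longrightarrow> \<chi> u \<noteq> (\<chi> v :: bool)"
    and K: "card K = p - 1"
    and I: "\<And>c. c \<in> K \<Longrightarrow> I c \<subseteq> verts G"
    and miss: "\<And>c c' y. c \<in> K \<Longrightarrow> c' \<in> K \<Longrightarrow> c \<noteq> c' \<Longrightarrow> y \<in> I c \<Longrightarrow>
       card {z \<in> I c'. \<not> adj G y z} \<le> d"
    and common: "\<And>c B. c \<in> K \<Longrightarrow> B \<subseteq> X \<Longrightarrow> card B \<le> card (verts F) \<Longrightarrow>
       card (verts F) * (d + 1) \<le> card {y \<in> I c. \<forall>x\<in>B. adj G x y}"
  obtains C where "C \<subseteq> X" "finite C" "card C \<le> 2 * card (edges T)"
    "\<And>x y. x \<in> X - C \<Longrightarrow> y \<in> X - C \<Longrightarrow> \<not> adj G x y"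
proof -
  have "\<not> (\<exists>N \<subseteq> edges G. card N = card (edges T) \<and> (\<forall>e\<in>N. e \<subseteq> X) \<and>
      (\<forall>e\<in>N. \<forall>e'\<in>N. e \<noteq> e' \<longrightarrow> e \<inter> e' = {}))"
  proof
    assume "\<exists>N \<subseteq> edges G. card N = card (edges T) \<and> (\<forall>e\<in>N. e \<subseteq> X) \<and>
      (\<forall>e\<in>N. \<forall>e'\<in>N. e \<noteq> e' \<longrightarrow> e \<inter> e' = {})"
    then obtain N where N: "N \<subseteq> edges G" "card N = card (edges T)" "\<And>e. e \<in> N \<Longrightarrow> e \<subseteq> X"
      "\<And>e e'. e \<in> N \<Longrightarrow> e' \<in> N \<Longrightarrow> e \<noteq> e' \<Longrightarrow> e \<inter> e' = {}" by metis
    have finN: "finite N" using N finite_edges[OF G] finite_subset by blast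
    obtain \<beta> where \<beta>: "bij_betw \<beta> (edges T) N"
      using finite_same_card_bij[OF finite_edges[OF T] finN] N by auto
    have "\<forall>e\<in>N. \<exists>u v. e = {u, v} \<and> u \<noteq> v"
      using N G by (meson simple_graph_edgeE subsetD)
    then obtain a a' where a: "\<And>e. e \<in> N \<Longrightarrow> e = {a e, a' e}" "\<And>e. e \<in> N \<Longrightarrow> a e \<noteq> a' e" by metis
    have ain: "a e \<in> e" "a' e \<in> e" if "e \<in> N" for e using a(1)[OF that] by blast+
    \<comment> \<open>The new vertices with tags 0 and 1 of the clique on \<open>e\<close> go to the
      ends of the matching edge \<open>\<beta> e\<close>. No vertex of \<open>T\<close> is
      preassigned, hence \<open>undefined\<close>.\<close>
    define \<phi> where "\<phi> x = (case x of Inl v \<Rightarrow> undefined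
        | Inr (e, j) \<Rightarrow> if j = (0::nat) then a (\<beta> e) else a' (\<beta> e))" for x :: "'b + 'b set \<times> nat"
    define S where "S = Inl ` ({}::'b set) \<union> Inr ` (SIGMA e : edges T. {..<2::nat})"
    have \<beta>N: "\<beta> e \<in> N" if "e \<in> edges T" for e using \<beta> that bij_betwE by blast
    have \<phi>\<beta>: "\<phi> (Inr (e, j)) \<in> \<beta> e" if "e \<in> edges T" for e j
      using ain[OF \<beta>N[OF that]] by (simp add: \<phi>_def)
    have inj: "inj_on \<phi> S"
    proof (rule inj_onI)
      fix x y assume xy: "x \<in> S" "y \<in> S" "\<phi> x = \<phi> y"
      obtain e j e' j' where e: "x = Inr (e, j)" "y = Inr (e', j')" "e \<in> edges T" "e' \<in> edges T" "j < 2" "j' < 2"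
        using xy unfolding S_def by auto
      have "\<beta> e = \<beta> e'" using N(4)[of "\<beta> e" "\<beta> e'"] \<beta>N e \<phi>\<beta>[of e j] \<phi>\<beta>[of e' j'] xy by auto
      then have ee: "e = e'" using \<beta> e by (metis bij_betw_def inj_onD)
      then show "x = y" using xy e a(2)[OF \<beta>N[OF e(3)]]
        by (auto simp: \<phi>_def less_2_cases_iff split: if_splits)
    qed
    have imgX: "\<phi> ` S \<subseteq> X" using \<phi>\<beta> N(3) \<beta>N unfolding S_def by fastforce
    have img: "\<phi> ` S \<subseteq> verts G"
    proof
      fix z assume "z \<in> \<phi> ` S"
      then obtain e j where e: "e \<in> edges T" "z = \<phi> (Inr (e, j))" unfolding S_def by auto
      then have "z \<in> \<beta> e" "\<beta> e \<in> edges G" using \<phi>\<beta> \<beta>N N by auto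
      then show "z \<in> verts G" using G by (auto simp: simple_graph_def nsets_def)
    qed
    have SF: "S \<subseteq> verts F" using p by (auto simp: S_def F_def edge_blowup_def blowup_clique_def)
    have finF: "finite (verts F)" unfolding F_def by (rule finite_verts_edge_blowup[OF T])
    have SS: "adj G (\<phi> u) (\<phi> v)" if uv: "u \<in> S" "v \<in> S" "clique_adj (edges T) (p + 1) u v" for u v
    proof -
      obtain e j j' where e: "e \<in> edges T" "u = Inr (e, j)" "v = Inr (e, j')" "j < 2" "j' < 2" "j \<noteq> j'"
        using uv unfolding S_def clique_adj_def blowup_clique_def by auto
      have "{\<phi> u, \<phi> v} = {a (\<beta> e), a' (\<beta> e)}"
        using e by (auto simp: \<phi>_def less_2_cases_iff)
      also have "\<dots> = \<beta> e" using a(1)[OF \<beta>N[OF e(1)]] by (rule sym)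
      finally have "{\<phi> u, \<phi> v} = \<beta> e" .
      then show ?thesis using \<beta>N[OF e(1)] N(1) by (auto simp: adj_def)
    qed
    obtain c0 c1 where c: "c0 \<in> K" "c1 \<in> K" "c0 \<noteq> c1"
    proof -
      have "2 \<le> card K" using K p by simp
      then obtain L where "L \<subseteq> K" "card L = 2" by (meson obtain_subset_with_card_n)
      then show thesis using that by (auto simp: card_2_iff)
    qed
    have finK: "finite K" by (rule card_ge_0_finite) (use K p in simp)
    \<comment> \<open>The embedding lemma quantifies over all classes, so the classes outside
      \<open>K\<close> are made empty.\<close>
    define J where "J c = (if c \<in> K then I c else {})" for c
    have large: "card (verts F) * (d + 1) \<le> card {y \<in> J c. \<forall>u\<in>S. P u \<longrightarrow> adj G (\<phi> u) y}"
      if "c \<in> K" for c P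
    proof -
      have "card (\<phi> ` {u\<in>S. P u}) \<le> card {u\<in>S. P u}"
        using SF finF by (intro card_image_le) (auto intro: finite_subset)
      also have "\<dots> \<le> card (verts F)" using SF finF by (intro card_mono) auto
      finally have "card (\<phi> ` {u\<in>S. P u}) \<le> card (verts F)" .
      with common[OF that, of "\<phi> ` {u\<in>S. P u}"] imgX
      have "card (verts F) * (d + 1) \<le> card {y \<in> I c. \<forall>x\<in>\<phi> ` {u\<in>S. P u}. adj G x y}" by blast
      also have "{y \<in> I c. \<forall>x\<in>\<phi> ` {u\<in>S. P u}. adj G x y} = {y \<in> J c. \<forall>u\<in>S. P u \<longrightarrow> adj G (\<phi> u) y}"
        using that by (auto simp: J_def)
      finally show ?thesis .
    qed
    have c2: "card e = 2" if "e \<in> edges T" for e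
      using that T by (auto simp: simple_graph_def nsets_def)
    have "contains_copy G F"
    proof (rule blowup_embedding[where T = T and G = G and I = J and SV = "{}" and r = "\<lambda>_. 2" and
          K = "\<lambda>_. K" and col = "\<lambda>v. if \<chi> v then c0 else c1" and d = d and p = p and \<phi> = \<phi>,
          OF T G, folded S_def F_def])
      show "inj_on \<phi> S" by (rule inj)
      show "\<phi> ` S \<subseteq> verts G" by (rule img)
      show "adj G (\<phi> u) (\<phi> v)" if "u \<in> S" "v \<in> S" "clique_adj (edges T) (p + 1) u v" for u v
        using SS that .
      show "finite K \<and> card (e - {}) + (p - 1 - 2) \<le> card K" if "e \<in> edges T" for e
        using finK c2[OF that] K p by simp
      show "card {z \<in> J c'. \<not> adj G y z} \<le> d" if "c \<noteq> c'" "y \<in> J c" for c c' y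
        using miss[of c c' y] that by (cases "c' \<in> K") (auto simp: J_def split: if_splits)
      show "J c \<subseteq> verts G" for c using I by (simp add: J_def)
      show "(if \<chi> u then c0 else c1) \<noteq> (if \<chi> v then c0 else c1)" if "{u, v} \<in> edges T" for u v
        using \<chi>[OF that] c by auto
      show "2 \<le> p - 1" using p by simp
      show "card (verts F) * (d + 1) \<le> card {y \<in> J (if \<chi> v then c0 else c1).
          \<forall>u\<in>S. clique_adj (edges T) (p + 1) u (Inl v) \<longrightarrow> adj G (\<phi> u) y}" for v
        by (rule large) (use c in auto)
      show "card (verts F) * (d + 1) \<le> card {y \<in> J c.
          \<forall>u\<in>S. u \<in> blowup_clique (p + 1) e \<longrightarrow> adj G (\<phi> u) y}" if "c \<in> K" for e c
        by (rule large) (rule that)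
    qed (use c in auto)
    then show False using free by blast
  qed
  then show thesis using matching_or_cover[OF G, of "card (edges T)" X] that by blast
qed

section \<open>Double brooms\<close>

lemma simple_graph_double_broom:
  assumes "l \<ge> 1" shows "simple_graph (double_broom l s t)"
proof -
  have "e \<in> nsets (verts (double_broom l s t)) 2" if "e \<in> edges (double_broom l s t)" for e
  proof -
    from that consider i where "i + 1 < l" "e = {i, i + 1}" | j where "j < s" "e = {0, l + j}"
      | j where "j < t" "e = {l - 1, l + s + j}" by (auto simp: double_broom_def)
    then obtain u v where "e = {u, v}" "u < l + s + t" "v < l + s + t" "u \<noteq> v"
      using assms by cases (fastforce simp: numeral_eq_Suc)+
    then show ?thesis unfolding nsets_2_iff by (auto simp: double_broom_def)
  qed
  then show ?thesis by (auto simp: simple_graph_def double_broom_def)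
qed

text \<open>The bipartition of the tree: parity on the path, while the leaves at the even end 0 join
  the odd side and the leaves at the odd end \<open>2 * k - 1\<close> the even side.\<close>

definition broom_side :: "nat \<Rightarrow> nat \<Rightarrow> nat \<Rightarrow> bool" where
  "broom_side k s v \<longleftrightarrow> (if v < 2 * k then even v else 2 * k + s \<le> v)"

lemma broom_side_proper:
  assumes "k \<ge> 1" "{u, v} \<in> edges (double_broom (2 * k) s t)"
  shows "broom_side k s u \<noteq> broom_side k s v"
proof -
  have *: "odd (2 * k - 1)" using assms(1) by simp
  from assms show ?thesis
    using * by (auto simp: double_broom_def broom_side_def doubleton_eq_iff)
qed

lemma clique_adj_Inl_Inl:
  assumes "\<And>e. e \<in> E \<Longrightarrow> card e = 2"
  shows "clique_adj E r (Inl u) (Inl v) \<longleftrightarrow> u \<noteq> v \<and> {u, v} \<in> E"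
proof
  assume "clique_adj E r (Inl u) (Inl v)"
  then obtain e where e: "u \<noteq> v" "e \<in> E" "u \<in> e" "v \<in> e"
    by (auto simp: clique_adj_def blowup_clique_def)
  then have "e = {u, v}" using assms[OF e(2)] by (auto simp: card_2_iff)
  with e show "u \<noteq> v \<and> {u, v} \<in> E" by simp
next
  assume "u \<noteq> v \<and> {u, v} \<in> E"
  then show "clique_adj E r (Inl u) (Inl v)"
    unfolding clique_adj_def blowup_clique_def by (intro conjI bexI[of _ "{u, v}"]) auto
qed

lemma broom_edge_iff:
  assumes "u < v"
  shows "{u, v} \<in> edges (double_broom l s t) \<longleftrightarrow>
    u + 1 = v \<and> v < l \<or> u = 0 \<and> l \<le> v \<and> v < l + s \<or> u = l - 1 \<and> l + s \<le> v \<and> v < l + s + t"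
proof
  assume "{u, v} \<in> edges (double_broom l s t)"
  then show "u + 1 = v \<and> v < l \<or> u = 0 \<and> l \<le> v \<and> v < l + s \<or> u = l - 1 \<and> l + s \<le> v \<and> v < l + s + t"
    using assms by (auto simp: double_broom_def doubleton_eq_iff)
next
  assume R: "u + 1 = v \<and> v < l \<or> u = 0 \<and> l \<le> v \<and> v < l + s \<or> u = l - 1 \<and> l + s \<le> v \<and> v < l + s + t"
  then consider "u + 1 = v" "v < l" | "u = 0" "v = l + (v - l)" "v - l < s"
    | "u = l - 1" "v = l + s + (v - l - s)" "v - l - s < t" by linarith
  then show "{u, v} \<in> edges (double_broom l s t)"
    by cases (auto simp: double_broom_def)
qed

lemma broom_edgeE:
  assumes "e \<in> edges (double_broom l s t)" "l \<ge> 1"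
  obtains u v where "u < v" "e = {u, v}"
    "u + 1 = v \<and> v < l \<or> u = 0 \<and> l \<le> v \<and> v < l + s \<or> u = l - 1 \<and> l + s \<le> v \<and> v < l + s + t"
proof -
  obtain u v where "e = {u, v}" "u \<noteq> v"
    using simple_graph_edgeE[OF simple_graph_double_broom[OF assms(2)] assms(1)] by blast
  then have "\<exists>u v. u < v \<and> e = {u, v}" by (metis insert_commute linorder_neqE_nat)
  then show thesis using that assms broom_edge_iff by metis
qed

text \<open>The preassigned vertices are the path vertices \<open>0, 3, 5, \<dots>, 2k - 1\<close> together with one or two
  new vertices of the clique on the edge \<open>{1, 2}\<close>, the only edge that those path vertices leave
  uncovered.\<close>

lemma broom_blowup_embedding:
  fixes G :: "'a sgraph" and w :: "nat \<Rightarrow> 'a" and I :: "nat \<Rightarrow> 'a set" and k p s t :: nat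
  defines "b \<equiv> card (verts (edge_blowup (double_broom (2 * k) s t) (p + 1)))"
  assumes k: "k \<ge> 2" and p: "p \<ge> 3" and G: "simple_graph G"
    and w: "inj_on w {..k}" "w ` {..k} \<subseteq> verts G"
    and q: "q = 1 \<or> q = 2 \<and> y \<in> verts G \<and> y \<notin> w ` {..k} \<and> adj G (w 1) y"
    and L: "L \<subseteq> {..<p}" "p + 1 - q \<le> card L"
    and I: "\<And>c. c < p \<Longrightarrow> I c \<subseteq> verts G"
    and miss: "\<And>c c' x. c < p \<Longrightarrow> c' < p \<Longrightarrow> c \<noteq> c' \<Longrightarrow> x \<in> I c \<Longrightarrow> card {z \<in> I c'. \<not> adj G x z} \<le> d"
    and one: "\<And>j c. j \<le> k \<Longrightarrow> j \<noteq> 1 \<Longrightarrow> c < p \<Longrightarrow> b * (d + 1) \<le> card {z \<in> I c. adj G (w j) z}"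
    and mid: "\<And>c. c \<in> L \<Longrightarrow> b * (d + 1) \<le> card {z \<in> I c. adj G (w 1) z \<and> (q = 2 \<longrightarrow> adj G y z)}"
    and c12: "c1 \<in> L" "c2 \<in> L" "c1 \<noteq> c2"
    and left: "b * (d + 1) \<le> card {z \<in> I c1. adj G (w 0) z \<and> adj G (w 1) z \<and> (q = 2 \<longrightarrow> adj G y z)}"
    and right: "b * (d + 1) \<le> card {z \<in> I c2. adj G (w 1) z \<and> adj G (w 2) z \<and> (q = 2 \<longrightarrow> adj G y z)}"
    and pairs: "\<And>j. 2 \<le> j \<Longrightarrow> j < k \<Longrightarrow>
        \<exists>c<p. b * (d + 1) \<le> card {z \<in> I c. adj G (w j) z \<and> adj G (w (j + 1)) z}"
  shows "contains_copy G (edge_blowup (double_broom (2 * k) s t) (p + 1))"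
proof -
  define T where "T = double_broom (2 * k) s t"
  have T: "simple_graph T" using k by (simp add: T_def simple_graph_double_broom)
  have c2e: "card e = 2" if "e \<in> edges T" for e
    using that T by (auto simp: simple_graph_def nsets_def)
  define SV where "SV = {v. v < 2 * k \<and> (v = 0 \<or> odd v \<and> v \<noteq> 1)}"
  define r where "r e = (if e = {1, 2} then q else 0)" for e :: "nat set"
  define S where "S = Inl ` SV \<union> Inr ` (SIGMA e : edges T. {..<r e})"
  \<comment> \<open>\<open>(v + 1) div 2\<close> sends \<open>0, 3, 5, ..., 2k - 1\<close> to
    \<open>0, 2, 3, ..., k\<close>. The index 1 is left for the new vertex with tag 0 in the clique
    on \<open>{1, 2}\<close>; if \<open>q = 2\<close>, tag 1 goes to \<open>y\<close>.\<close>
  define \<phi> where "\<phi> x = (case x of Inl v \<Rightarrow> w ((v + 1) div 2)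
      | Inr (e, j) \<Rightarrow> if j = (0::nat) then w 1 else y)" for x :: "nat + nat set \<times> nat"
  obtain cc where cc: "\<And>j. 2 \<le> j \<Longrightarrow> j < k \<Longrightarrow> cc j < p"
    "\<And>j. 2 \<le> j \<Longrightarrow> j < k \<Longrightarrow> b * (d + 1) \<le> card {z \<in> I (cc j). adj G (w j) z \<and> adj G (w (j + 1)) z}"
    using pairs by metis
  \<comment> \<open>An even path vertex \<open>2 * j\<close> with \<open>j \<ge> 2\<close> lies
    between the preassigned \<open>2 * j - 1\<close> and \<open>2 * j + 1\<close>, whose images are
    \<open>w j\<close> and \<open>w (j + 1)\<close>; \<open>cc j\<close> is a class where these have
    common neighbours. Leaves have one preassigned neighbour and go to class 0.\<close>
  define col where "col v = (if v = 1 then c1 else if v = 2 then c2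
      else if v < 2 * k then cc (v div 2) else 0)" for v
  \<comment> \<open>The clique on \<open>{1, 2}\<close> has two free ends and
    \<open>p - 1 - q\<close> free new vertices, so it needs \<open>p + 1 - q\<close> classes, all
    taken from \<open>L\<close>. Every other clique has one free end and \<open>p - 1\<close> free
    new vertices and uses all \<open>p\<close> classes.\<close>
  define K where "K e = (if e = {1, 2} then L else {..<p})" for e :: "nat set"
  define J where "J c = (if c < p then I c else {})" for c
  have bT: "b = card (verts (edge_blowup T (p + 1)))" by (simp add: b_def T_def)
  have e12: "{1, 2} \<in> edges T" using k by (simp add: T_def broom_edge_iff)
  have q12: "q = 1 \<or> q = 2" using q by blast
  have S: "S = Inl ` SV \<union> (\<lambda>j. Inr ({1, 2}, j)) ` {..<q}"
    unfolding S_def r_def using e12 by (auto split: if_splits)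
  have idx: "(x + 1) div 2 \<le> k \<and> (x + 1) div 2 \<noteq> 1" if "x \<in> SV" for x
    using that k by (auto simp: SV_def elim!: oddE)
  have idx_inj: "x = x'" if "x \<in> SV" "x' \<in> SV" "(x + 1) div 2 = (x' + 1) div 2" for x x'
    using that by (auto simp: SV_def elim!: oddE)
  \<comment> \<open>\<open>SV\<close> is an independent set, and it covers all edges but
    \<open>{1, 2}\<close>; so 1 and 2 are the only adjacent pair of free vertices.\<close>
  have cover: "\<exists>x x'. e = {x, x'} \<and> x \<in> SV \<and> x' \<notin> SV"
    if e: "e \<in> edges T" "e \<noteq> {1, 2}" for e
  proof -
    obtain u v where uv: "u < v" "e = {u, v}" "u + 1 = v \<and> v < 2 * k \<or> u = 0 \<and> 2 * k \<le> v \<and> v < 2 * k + s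
      \<or> u = 2 * k - 1 \<and> 2 * k + s \<le> v \<and> v < 2 * k + s + t"
      by (rule broom_edgeE[of e "2 * k" s t]) (use e k in \<open>auto simp: T_def\<close>)
    have odd1: "odd (2 * k - 1)" using k by simp
    have "u \<in> SV \<and> v \<notin> SV \<or> v \<in> SV \<and> u \<notin> SV"
    proof (cases "u = 0 \<or> v \<ge> 2 * k")
      case True
      then show ?thesis using uv k odd1 by (auto simp: SV_def)
    next
      case False
      then have "v = u + 1" "v < 2 * k" "u \<noteq> 0" "u \<noteq> 1" using uv e(2) by auto
      then show ?thesis by (auto simp: SV_def)
    qed
    then show ?thesis using uv(2) by (metis insert_commute)
  qed
  have notSV: "1 \<notin> SV" "2 \<notin> SV" by (auto simp: SV_def)
  have RLL: "clique_adj (edges T) (p + 1) (Inl u) (Inl v) \<longleftrightarrow> u \<noteq> v \<and> {u, v} \<in> edges T" for u v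
    by (rule clique_adj_Inl_Inl) (rule c2e)
  have RRL: "v = 1 \<or> v = 2" if "clique_adj (edges T) (p + 1) (Inr ({1, 2}, j)) (Inl v)" for j v
    using that by (auto simp: clique_adj_def blowup_clique_def)
  \<comment> \<open>The preassigned neighbours of a vertex \<open>v\<close> of \<open>T\<close> are
    its neighbours in \<open>SV\<close> and, for \<open>v\<close> equal to 1 or 2, the preassigned
    new vertices of the clique on \<open>{1, 2}\<close>.\<close>
  have Sreq: "P (\<phi> u)" if u: "u \<in> S" "clique_adj (edges T) (p + 1) u (Inl v)"
    and P1: "v = 1 \<or> v = 2 \<Longrightarrow> P (w 1) \<and> (q = 2 \<longrightarrow> P y)"
    and P2: "\<And>x. x \<in> SV \<Longrightarrow> {x, v} \<in> edges T \<Longrightarrow> P (w ((x + 1) div 2))" for u v and P :: "'a \<Rightarrow> bool"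
  proof -
    from u(1) consider x where "x \<in> SV" "u = Inl x" | j where "j < q" "u = Inr ({1, 2}, j)"
      unfolding S by auto
    then show ?thesis
    proof cases
      case 1
      then show ?thesis using P2[of x] u(2) RLL[of x v] by (simp add: \<phi>_def)
    next
      case 2
      then have "v = 1 \<or> v = 2" using RRL[of j v] u(2) by simp
      then show ?thesis using P1 2 q12 by (auto simp: \<phi>_def)
    qed
  qed
  have finJ: "finite (J c)" for c
    using finite_subset[OF I] G by (auto simp: J_def simple_graph_def)
  have mono: "b * (d + 1) \<le> card {z \<in> J c. Q z}"
    if "b * (d + 1) \<le> card {z \<in> I c. Q' z}" "c < p" "\<And>z. Q' z \<Longrightarrow> Q z" for c Q Q'
  proof -
    have "card {z \<in> I c. Q' z} \<le> card {z \<in> J c. Q z}"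
      using finJ[of c] that by (intro card_mono) (auto simp: J_def)
    then show ?thesis using that(1) by linarith
  qed
  show ?thesis
    unfolding T_def[symmetric]
  proof (rule blowup_embedding[where T = T and G = G and I = J and SV = SV and r = r and
        K = K and col = col and d = d and p = p and \<phi> = \<phi>, OF T G, folded S_def bT])
    show "SV \<subseteq> verts T" by (auto simp: SV_def T_def double_broom_def)
    show "r e \<le> p - 1" for e using p q12 by (auto simp: r_def)
    show "inj_on \<phi> S"
    proof (rule inj_onI)
      fix x x' assume xx: "x \<in> S" "x' \<in> S" "\<phi> x = \<phi> x'"
      have wI: "a = a'" if "w a = w a'" "a \<le> k" "a' \<le> k" for a a'
        using that w(1) by (auto dest: inj_onD)
      have k1: "1 \<le> k" using k by simp
      have yw: "w a \<noteq> y" if "q = 2" "a \<le> k" for a using that q by auto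
      show "x = x'"
        using xx q12 unfolding S
        by (auto simp: \<phi>_def less_2_cases_iff split: if_splits
            dest: idx idx_inj wI[OF _ _ k1] wI[OF _ k1] yw yw[OF _ k1] intro: idx_inj)
          (metis idx idx_inj wI k1 yw Suc_eq_plus1 One_nat_def)+
    qed
    show "\<phi> ` S \<subseteq> verts G"
      using w(2) idx q k unfolding S by (fastforce simp: \<phi>_def less_2_cases_iff)
    show "adj G (\<phi> u) (\<phi> v)" if "u \<in> S" "v \<in> S" "clique_adj (edges T) (p + 1) u v" for u v
    proof (cases v)
      case (Inl x)
      then have x: "x \<in> SV" using that(2) by (auto simp: S)
      show ?thesis
      proof (rule Sreq[OF that(1) that(3)[unfolded Inl]])
        show "adj G (w 1) (\<phi> v) \<and> (q = 2 \<longrightarrow> adj G y (\<phi> v))" if "x = 1 \<or> x = 2"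
          using that x notSV by auto
        show "adj G (w ((x' + 1) div 2)) (\<phi> v)" if "x' \<in> SV" "{x', x} \<in> edges T" for x'
          using cover[OF that(2)] that(1) x notSV by (auto simp: doubleton_eq_iff)
      qed
    next
      case (Inr z)
      then obtain j where v: "v = Inr ({1, 2}, j)" "j < q" using \<open>v \<in> S\<close> by (auto simp: S)
      have "u \<noteq> v" using that(3) by (simp add: clique_adj_def)
      moreover have "u = Inr ({1, 2}, j')" if "u = Inl x'" for x' j'
        using \<open>clique_adj (edges T) (p + 1) u v\<close> \<open>u \<in> S\<close> v notSV that
        by (auto simp: clique_adj_def blowup_clique_def S)
      ultimately obtain j' where "u = Inr ({1, 2}, j')" "j' < q" "j \<noteq> j'"
        using \<open>u \<in> S\<close> v unfolding S by blast
      then show ?thesis using v q adj_commute[of G "w 1" y] by (auto simp: \<phi>_def less_2_cases_iff)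
    qed
    show "finite (K e) \<and> card (e - SV) + (p - 1 - r e) \<le> card (K e)" if "e \<in> edges T" for e
    proof (cases "e = {1, 2}")
      case True
      then have "e - SV = {1, 2}" using notSV by auto
      then show ?thesis using True L q12 p finite_subset[OF L(1)] by (auto simp: K_def r_def)
    next
      case False
      then obtain x x' where "e = {x, x'}" "x \<in> SV" "x' \<notin> SV" using cover[OF \<open>e \<in> edges T\<close>] by blast
      then have "e - SV = {x'}" by auto
      then show ?thesis using False p by (simp add: K_def r_def)
    qed
    show "col v \<in> K e" if "e \<in> edges T" "v \<in> e - SV" for e v
    proof (cases "e = {1, 2}")
      case True
      then show ?thesis using that c12 by (auto simp: K_def col_def)
    next
      case False
      have "cc (v div 2) < p" if "v < 2 * k" "v \<noteq> 1" "v \<noteq> 2"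
      proof -
        have "even v" "v \<noteq> 0" using that \<open>v \<in> e - SV\<close> by (auto simp: SV_def)
        then show ?thesis using that by (intro cc(1)) (auto elim!: evenE)
      qed
      then show ?thesis using False c12 L p by (auto simp: K_def col_def)
    qed
    show "col u \<noteq> col v" if "{u, v} \<in> edges T" "u \<notin> SV" "v \<notin> SV" for u v
    proof -
      have "{u, v} = {1, 2}" using cover[OF that(1)] that(2,3) by (auto simp: doubleton_eq_iff)
      then show ?thesis using c12(3) by (auto simp: col_def doubleton_eq_iff)
    qed
    show "J c \<subseteq> verts G" for c using I by (auto simp: J_def)
    show "card {z \<in> J c'. \<not> adj G x z} \<le> d" if "c \<noteq> c'" "x \<in> J c" for c c' x
      using miss[of c c' x] that by (cases "c' < p") (auto simp: J_def split: if_splits)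
    show "b * (d + 1) \<le> card {z \<in> J c. \<forall>u\<in>S. u \<in> blowup_clique (p + 1) e \<longrightarrow> adj G (\<phi> u) z}"
      if e: "e \<in> edges T" "c \<in> K e" for e c
    proof (cases "e = {1, 2}")
      case True
      show ?thesis
      proof (rule mono[OF mid])
        show "c \<in> L" using True e by (simp add: K_def)
        then show "c < p" using L by auto
        show "\<forall>u\<in>S. u \<in> blowup_clique (p + 1) e \<longrightarrow> adj G (\<phi> u) z"
          if "adj G (w 1) z \<and> (q = 2 \<longrightarrow> adj G y z)" for z
          using that True notSV q12 by (auto simp: S \<phi>_def blowup_clique_def less_2_cases_iff)
      qed
    next
      case False
      then obtain x x' where x: "e = {x, x'}" "x \<in> SV" "x' \<notin> SV" using cover[OF e(1)] by blast
      show ?thesis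
      proof (rule mono[OF one[of "(x + 1) div 2"]])
        show "(x + 1) div 2 \<le> k" "(x + 1) div 2 \<noteq> 1" using idx[OF x(2)] by auto
        show "c < p" using False e by (simp add: K_def)
        then show "c < p" .
        show "\<forall>u\<in>S. u \<in> blowup_clique (p + 1) e \<longrightarrow> adj G (\<phi> u) z"
          if "adj G (w ((x + 1) div 2)) z" for z
          using that False x by (auto simp: S \<phi>_def blowup_clique_def)
      qed
    qed
    show "b * (d + 1) \<le> card {z \<in> J (col v). \<forall>u\<in>S. clique_adj (edges T) (p + 1) u (Inl v) \<longrightarrow> adj G (\<phi> u) z}"
      if v: "v \<in> verts T - SV" for v
    proof -
      have v': "v < 2 * k + s + t" "v \<notin> SV" using v by (auto simp: T_def double_broom_def)
      have odd1: "odd (2 * k - 1)" using k by simp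
      have nb: "x + 1 = v \<and> v < 2 * k \<or> v + 1 = x \<or> x = 0 \<and> 2 * k \<le> v \<and> v < 2 * k + s
        \<or> x = 2 * k - 1 \<and> 2 * k + s \<le> v" if "x \<in> SV" "{x, v} \<in> edges T" for x
      proof -
        have "x < v \<or> v < x" using that v' by (metis linorder_neqE_nat)
        then show ?thesis
          using broom_edge_iff[of x v "2 * k" s t] broom_edge_iff[of v x "2 * k" s t] that v'
          by (auto simp: T_def SV_def insert_commute)
      qed
      consider "v = 1" | "v = 2" | "4 \<le> v" "even v" "v < 2 * k" | "2 * k \<le> v" "v < 2 * k + s"
        | "2 * k + s \<le> v"
      proof -
        have "v \<noteq> 0" "even v \<or> v = 1 \<or> v \<ge> 2 * k" using v'(2) k by (auto simp: SV_def)
        then have "v = 1 \<or> v = 2 \<or> 4 \<le> v \<and> even v \<and> v < 2 * k \<or> 2 * k \<le> v" by (auto elim!: evenE)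
        then show thesis using that by linarith
      qed
      then show ?thesis
      proof cases
        case 1
        have "b * (d + 1) \<le> card {z \<in> J c1. \<forall>u\<in>S. clique_adj (edges T) (p + 1) u (Inl v) \<longrightarrow> adj G (\<phi> u) z}"
        proof (rule mono[OF left])
          show "c1 < p" using c12 L by auto
          show "\<forall>u\<in>S. clique_adj (edges T) (p + 1) u (Inl v) \<longrightarrow> adj G (\<phi> u) z"
            if z: "adj G (w 0) z \<and> adj G (w 1) z \<and> (q = 2 \<longrightarrow> adj G y z)" for z
          proof (intro ballI impI)
            fix u assume u: "u \<in> S" "clique_adj (edges T) (p + 1) u (Inl v)"
            show "adj G (\<phi> u) z"
            proof (rule Sreq[OF u])
              show "adj G (w ((x + 1) div 2)) z" if "x \<in> SV" "{x, v} \<in> edges T" for x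
                using nb[OF that] that(1) 1 z k by (auto simp: SV_def)
            qed (use z in auto)
          qed
        qed
        then show ?thesis by (simp add: 1 col_def)
      next
        case 2
        have "b * (d + 1) \<le> card {z \<in> J c2. \<forall>u\<in>S. clique_adj (edges T) (p + 1) u (Inl v) \<longrightarrow> adj G (\<phi> u) z}"
        proof (rule mono[OF right])
          show "c2 < p" using c12 L by auto
          show "\<forall>u\<in>S. clique_adj (edges T) (p + 1) u (Inl v) \<longrightarrow> adj G (\<phi> u) z"
            if z: "adj G (w 1) z \<and> adj G (w 2) z \<and> (q = 2 \<longrightarrow> adj G y z)" for z
          proof (intro ballI impI)
            fix u assume u: "u \<in> S" "clique_adj (edges T) (p + 1) u (Inl v)"
            show "adj G (\<phi> u) z"
            proof (rule Sreq[OF u])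
              show "adj G (w ((x + 1) div 2)) z" if "x \<in> SV" "{x, v} \<in> edges T" for x
              proof -
                have "x = 3" using nb[OF that] that(1) 2 k by (auto simp: SV_def)
                then show ?thesis using z by simp
              qed
            qed (use z in auto)
          qed
        qed
        then show ?thesis by (simp add: 2 col_def)
      next
        case 3
        then obtain j where j: "v = 2 * j" "2 \<le> j" "j < k" by (auto elim!: evenE)
        have "b * (d + 1) \<le> card {z \<in> J (cc j). \<forall>u\<in>S. clique_adj (edges T) (p + 1) u (Inl v) \<longrightarrow> adj G (\<phi> u) z}"
        proof (rule mono[OF cc(2)[OF j(2,3)]])
          show "cc j < p" using cc j by auto
          show "\<forall>u\<in>S. clique_adj (edges T) (p + 1) u (Inl v) \<longrightarrow> adj G (\<phi> u) z"
            if z: "adj G (w j) z \<and> adj G (w (j + 1)) z" for z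
          proof (intro ballI impI)
            fix u assume u: "u \<in> S" "clique_adj (edges T) (p + 1) u (Inl v)"
            show "adj G (\<phi> u) z"
            proof (rule Sreq[OF u])
              show "adj G (w ((x + 1) div 2)) z" if "x \<in> SV" "{x, v} \<in> edges T" for x
              proof -
                have "x + 1 = v \<or> x = v + 1" using nb[OF that] 3 by auto
                then have "(x + 1) div 2 = j \<or> (x + 1) div 2 = j + 1" using j by auto
                then show ?thesis using z by auto
              qed
            qed (use 3 in auto)
          qed
        qed
        moreover have "col v = cc j" using 3 j by (simp add: col_def)
        ultimately show ?thesis by simp
      next
        case 4
        have c0: "0 < p" using p by simp
        have "b * (d + 1) \<le> card {z \<in> J 0. \<forall>u\<in>S. clique_adj (edges T) (p + 1) u (Inl v) \<longrightarrow> adj G (\<phi> u) z}"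
        proof (rule mono[OF one[of 0 0]])
          show "\<forall>u\<in>S. clique_adj (edges T) (p + 1) u (Inl v) \<longrightarrow> adj G (\<phi> u) z"
            if z: "adj G (w 0) z" for z
          proof (intro ballI impI)
            fix u assume u: "u \<in> S" "clique_adj (edges T) (p + 1) u (Inl v)"
            show "adj G (\<phi> u) z"
            proof (rule Sreq[OF u])
              show "adj G (w ((x + 1) div 2)) z" if "x \<in> SV" "{x, v} \<in> edges T" for x
              proof -
                have "x = 0" using nb[OF that] that(1) 4 by (auto simp: SV_def)
                then show ?thesis using z by simp
              qed
            qed (use 4 k in auto)
          qed
        qed (use c0 in auto)
        then show ?thesis using 4 k by (simp add: col_def)
      next
        case 5
        have c0: "0 < p" using p by simp
        have "b * (d + 1) \<le> card {z \<in> J 0. \<forall>u\<in>S. clique_adj (edges T) (p + 1) u (Inl v) \<longrightarrow> adj G (\<phi> u) z}"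
        proof (rule mono[OF one[of k 0]])
          show "\<forall>u\<in>S. clique_adj (edges T) (p + 1) u (Inl v) \<longrightarrow> adj G (\<phi> u) z"
            if z: "adj G (w k) z" for z
          proof (intro ballI impI)
            fix u assume u: "u \<in> S" "clique_adj (edges T) (p + 1) u (Inl v)"
            show "adj G (\<phi> u) z"
            proof (rule Sreq[OF u])
              show "adj G (w ((x + 1) div 2)) z" if "x \<in> SV" "{x, v} \<in> edges T" for x
              proof -
                have "x = 2 * k - 1" using nb[OF that] that(1) 5 by (auto simp: SV_def)
                then have "(x + 1) div 2 = k" using k by simp
                then show ?thesis using z by simp
              qed
            qed (use 5 k in auto)
          qed
        qed (use c0 k in auto)
        then show ?thesis using 5 k by (simp add: col_def)
      qed
    qed
  qed
qed

section \<open>Joins of a clique and a complete multipartite graph\<close>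

text \<open>The edges of the join of a clique on \<open>W\<close> with the complete multipartite
  graph on \<open>V - W\<close>. Keeping both in one vertex set, without the tags of
  \<open>graph_join\<close>, allows removing and recolouring vertices freely.\<close>

definition join_edges :: "'a set \<Rightarrow> 'a set \<Rightarrow> ('a \<Rightarrow> 'c) \<Rightarrow> 'a set set" where
  "join_edges V W c = {{u, v} | u v. u \<in> V \<and> v \<in> V \<and> u \<noteq> v \<and> (u \<in> W \<or> v \<in> W \<or> c u \<noteq> c v)}"

lemma join_graph_broom_blowup_free:
  assumes "k \<ge> 2" "s \<ge> 1" "t \<ge> 1" "p \<ge> 1"
    and W: "finite W" "card W \<le> k" and c: "\<And>v. v \<in> verts G - W \<Longrightarrow> c v < (p::nat)"
    and G: "edges G \<subseteq> join_edges (verts G) W c"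
  shows "\<not> contains_copy G (edge_blowup (double_broom (2 * k) s t) (p + 1))"
proof
  define T where "T = double_broom (2 * k) s t"
  have T: "simple_graph T" using assms by (simp add: T_def simple_graph_double_broom)
  assume "contains_copy G (edge_blowup (double_broom (2 * k) s t) (p + 1))"
  then obtain f where f: "inj_on f (verts (edge_blowup T (p + 1)))"
    "f ` verts (edge_blowup T (p + 1)) \<subseteq> verts G"
    "\<And>e. e \<in> edges (edge_blowup T (p + 1)) \<Longrightarrow> f ` e \<in> edges G"
    unfolding contains_copy_def T_def by blast
  \<comment> \<open>A matching of \<open>k + 1\<close> edges in the broom: one leaf edge at each end
    of the path and the \<open>k - 1\<close> alternate edges \<open>{2j - 1, 2j}\<close> between
    them.\<close>
  define m where "m j = (if j = 0 then {0, 2 * k} else if j = k then {2 * k - 1, 2 * k + s}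
     else {2 * j - 1, 2 * j})" for j
  have m: "m j \<in> edges T" if "j \<le> k" for j
    using that assms by (auto simp: m_def T_def broom_edge_iff)
  have disj: "m i \<inter> m j = {}" if "i \<le> k" "j \<le> k" "i \<noteq> j" for i j
  proof -
    have "2 * a - 1 \<noteq> 2 * b" if "a \<ge> 1" for a b :: nat using that by presburger
    then show ?thesis using that assms by (auto simp: m_def)
  qed
  have "\<exists>x \<in> blowup_clique (p + 1) e. f x \<in> W" if e: "e \<in> edges T" for e
  proof (rule ccontr)
    assume "\<not> ?thesis"
    then have nW: "f x \<notin> W" if "x \<in> blowup_clique (p + 1) e" for x using that by blast
    have sub: "blowup_clique (p + 1) e \<subseteq> verts (edge_blowup T (p + 1))"
      using e by (auto simp: edge_blowup_def)
    have e2: "card e = 2" "finite e" using e T by (auto simp: simple_graph_def nsets_def)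
    \<comment> \<open>A clique avoiding \<open>W\<close> would show \<open>p + 1\<close> different
      colours out of \<open>p\<close>.\<close>
    have "inj_on (\<lambda>x. c (f x)) (blowup_clique (p + 1) e)"
    proof (rule inj_onI, rule ccontr)
      fix x y assume xy: "x \<in> blowup_clique (p + 1) e" "y \<in> blowup_clique (p + 1) e"
        "c (f x) = c (f y)" "x \<noteq> y"
      then have "{x, y} \<in> edges (edge_blowup T (p + 1))"
        using e by (auto simp: edge_blowup_def nsets_2_iff intro!: bexI[of _ e])
      then have "{f x, f y} \<in> join_edges (verts G) W c" using f(3)[of "{x, y}"] G by auto
      then show False using nW xy by (auto simp: join_edges_def doubleton_eq_iff)
    qed
    moreover have "(\<lambda>x. c (f x)) ` blowup_clique (p + 1) e \<subseteq> {..<p}"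
      using c nW sub f(2) by blast
    ultimately have "card (blowup_clique (p + 1) e) \<le> p"
      using card_inj_on_le[of _ _ "{..<p}"] by fastforce
    moreover have "card (blowup_clique (p + 1) e) = p + 1"
      unfolding blowup_clique_def using e2 assms
      by (subst card_Un_disjoint) (auto simp: card_image inj_on_def)
    ultimately show False by simp
  qed
  then obtain x where x: "\<And>e. e \<in> edges T \<Longrightarrow> x e \<in> blowup_clique (p + 1) e"
    "\<And>e. e \<in> edges T \<Longrightarrow> f (x e) \<in> W" by metis
  have "inj_on (\<lambda>j. f (x (m j))) {..k}"
  proof (rule inj_onI, rule ccontr)
    fix i j assume ij: "i \<in> {..k}" "j \<in> {..k}" "f (x (m i)) = f (x (m j))" "i \<noteq> j"
    have "x (m j) \<in> verts (edge_blowup T (p + 1))" if "j \<le> k" for j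
      using x(1)[OF m[OF that]] m[OF that] by (auto simp: edge_blowup_def)
    then have "x (m i) = x (m j)" using f(1) ij by (auto dest: inj_onD)
    then have "x (m i) \<in> blowup_clique (p + 1) (m i) \<inter> blowup_clique (p + 1) (m j)"
      using x(1) m ij by (metis IntI atMost_iff)
    moreover have "m i \<inter> m j = {}" "m i \<noteq> {}" using disj ij by (auto simp: m_def)
    ultimately show False by (auto simp: blowup_clique_def)
  qed
  moreover have "(\<lambda>j. f (x (m j))) ` {..k} \<subseteq> W" using x(2) m by auto
  ultimately have "card {..k} \<le> card W" using W card_inj_on_le by blast
  then show False using W by simp
qed

lemma join_edges_iff: "{u, v} \<in> join_edges V W c \<longleftrightarrow>
    u \<in> V \<and> v \<in> V \<and> u \<noteq> v \<and> (u \<in> W \<or> v \<in> W \<or> c u \<noteq> c v)"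
  by (auto simp: join_edges_def doubleton_eq_iff)

lemma join_edges_subset: "join_edges V W c \<subseteq> nsets V 2"
  unfolding join_edges_def nsets_2_iff by (auto simp: nsets_def card_2_iff)

lemma finite_join_edges: "finite V \<Longrightarrow> finite (join_edges V W c)"
  by (rule finite_subset[OF join_edges_subset]) (rule finite_imp_finite_nsets)

text \<open>A vertex outside \<open>W\<close> is joined to everything except its class, which
  contains the vertex itself. The additive form avoids subtraction on the naturals.\<close>

lemma card_join_edges_remove:
  assumes V: "finite V" and v: "v \<in> V - W"
  shows "card (join_edges V W c) + card {u \<in> V - W. c u = c v} = card (join_edges (V - {v}) W c) + card V"
proof -
  let ?C = "{u \<in> V - W. c u = c v}" and ?N = "(\<lambda>u. {u, v}) ` (V - {u \<in> V - W. c u = c v})"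
  have eq: "join_edges V W c = join_edges (V - {v}) W c \<union> ?N"
  proof (intro equalityI subsetI)
    fix e assume "e \<in> join_edges V W c"
    then obtain a b where e: "e = {a, b}" "a \<in> V" "b \<in> V" "a \<noteq> b" "a \<in> W \<or> b \<in> W \<or> c a \<noteq> c b"
      by (auto simp: join_edges_def)
    consider "a = v" | "b = v" | "a \<noteq> v" "b \<noteq> v" by blast
    then show "e \<in> join_edges (V - {v}) W c \<union> ?N"
    proof cases
      case 1
      then have "e = {b, v}" "b \<in> V - ?C" using e v by auto
      then show ?thesis by blast
    next
      case 2
      then have "e = {a, v}" "a \<in> V - ?C" using e v by auto
      then show ?thesis by blast
    next
      case 3
      then show ?thesis using e by (auto simp: join_edges_def)
    qed
  next
    fix e assume "e \<in> join_edges (V - {v}) W c \<union> ?N"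
    then show "e \<in> join_edges V W c" using v by (auto simp: join_edges_def)
  qed
  have disj: "join_edges (V - {v}) W c \<inter> ?N = {}" by (auto simp: join_edges_def doubleton_eq_iff)
  have "inj_on (\<lambda>u. {u, v}) (V - ?C)" by (auto simp: inj_on_def doubleton_eq_iff)
  then have "card ?N = card (V - ?C)" by (rule card_image)
  also have "\<dots> = card V - card ?C" using V by (intro card_Diff_subset) auto
  finally have "card ?N + card ?C = card V" using V card_mono[of V ?C] by auto
  moreover have "card (join_edges V W c) = card (join_edges (V - {v}) W c) + card ?N"
    unfolding eq using V disj by (intro card_Un_disjoint) (auto intro: finite_join_edges)
  ultimately show ?thesis by simp
qed

lemma join_edges_image:
  assumes f: "bij_betw f V V'" "W \<subseteq> V" "f ` W = W'"
    and c: "\<And>u v. u \<in> V - W \<Longrightarrow> v \<in> V - W \<Longrightarrow> c u = c v \<longleftrightarrow> c' (f u) = c' (f v)"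
  shows "join_edges V' W' c' = (\<lambda>e. f ` e) ` join_edges V W c"
proof (intro equalityI subsetI)
  have inj: "f u = f v \<longleftrightarrow> u = v" if "u \<in> V" "v \<in> V" for u v
    using f(1) that by (auto simp: bij_betw_def inj_on_def)
  have fW: "f u \<in> W' \<longleftrightarrow> u \<in> W" if "u \<in> V" for u
    using f inj that by (auto simp: image_iff subset_iff)
  have key: "f u \<in> W' \<or> f v \<in> W' \<or> c' (f u) \<noteq> c' (f v) \<longleftrightarrow> u \<in> W \<or> v \<in> W \<or> c u \<noteq> c v"
    if "u \<in> V" "v \<in> V" for u v using fW c that by blast
  have V': "V' = f ` V" using f by (simp add: bij_betw_def)
  {
    fix e assume "e \<in> join_edges V' W' c'"
    then obtain u v where "e = {f u, f v}" "u \<in> V" "v \<in> V" "f u \<noteq> f v"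
      "f u \<in> W' \<or> f v \<in> W' \<or> c' (f u) \<noteq> c' (f v)"
      unfolding join_edges_def V' by auto
    then have "{u, v} \<in> join_edges V W c" "e = f ` {u, v}" using key by (auto simp: join_edges_iff)
    then show "e \<in> (\<lambda>e. f ` e) ` join_edges V W c" by blast
  next
    fix e assume "e \<in> (\<lambda>e. f ` e) ` join_edges V W c"
    then obtain u v where "e = {f u, f v}" "{u, v} \<in> join_edges V W c" "u \<in> V" "v \<in> V"
      unfolding join_edges_def by auto
    then show "e \<in> join_edges V' W' c'"
      using key inj by (auto simp: join_edges_iff V')
  }
qed

section \<open>The number of edges of \<open>H(n, p, k + 1)\<close>\<close>

lemma H_graph_eq:
  shows "verts (H_graph n p (k + 1)) = Inl ` {..<k} \<union> Inr ` {..<n - k}"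
    and "edges (H_graph n p (k + 1)) = join_edges (Inl ` {..<k} \<union> Inr ` {..<n - k}) (Inl ` {..<k})
      (\<lambda>x. case x of Inl _ \<Rightarrow> 0 | Inr v \<Rightarrow> v mod p)"
proof -
  show "verts (H_graph n p (k + 1)) = Inl ` {..<k} \<union> Inr ` {..<n - k}"
    by (simp add: H_graph_def graph_join_def complete_graph_def turan_graph_def complete_multipartite_def)
  let ?J = "join_edges (Inl ` {..<k} \<union> Inr ` {..<n - k}) (Inl ` {..<k})
      (\<lambda>x. case x of Inl _ \<Rightarrow> 0 | Inr v \<Rightarrow> v mod p)"
  have "edges (H_graph n p (k + 1)) = {{Inl u, Inl v} | u v. u < k \<and> v < k \<and> u \<noteq> v}
      \<union> {{Inr u, Inr v} | u v. u < n - k \<and> v < n - k \<and> u mod p \<noteq> v mod p}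
      \<union> {{Inl u, Inr v} | u v. u < k \<and> v < n - k}"
  proof -
    have img: "(\<lambda>e. f ` e) ` {{u, v} | u v. P u v} = {{f u, f v} | u v. P u v}"
      for f :: "nat \<Rightarrow> nat + nat" and P
    proof (intro equalityI subsetI)
      fix e assume "e \<in> {{f u, f v} | u v. P u v}"
      then obtain u v where uv: "e = f ` {u, v}" "P u v" by auto
      show "e \<in> (\<lambda>e. f ` e) ` {{u, v} | u v. P u v}"
        unfolding uv(1) using uv(2) by blast
    qed auto
    have "(\<lambda>e. Inl ` e) ` nsets {..<k} 2 = {{Inl u, Inl v :: nat + nat} | u v. u < k \<and> v < k \<and> u \<noteq> v}"
    proof -
      have "nsets {..<k} 2 = {{u, v} | u v. u < k \<and> v < k \<and> u \<noteq> v}"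
        unfolding set_eq_iff nsets_2_iff by auto
      then show ?thesis by (simp only: img)
    qed
    moreover have "(\<lambda>e. Inr ` e) ` edges (turan_graph (n - k) p)
        = {{Inr u, Inr v :: nat + nat} | u v. u < n - k \<and> v < n - k \<and> u mod p \<noteq> v mod p}"
    proof -
      have "edges (turan_graph (n - k) p) = {{u, v} | u v. u < n - k \<and> v < n - k \<and> u mod p \<noteq> v mod p}"
        by (simp add: turan_graph_def complete_multipartite_def)
      then show ?thesis by (simp only: img)
    qed
    ultimately show ?thesis
      by (simp add: H_graph_def graph_join_def complete_graph_def)
        (simp add: turan_graph_def complete_multipartite_def)
  qed
  also have "\<dots> = ?J"
  proof (intro equalityI subsetI)
    fix e assume "e \<in> ?J"
    then obtain x y where "e = {x, y}" by (auto simp only: join_edges_def)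
    with \<open>e \<in> ?J\<close> have e: "e = {x, y}" "{x, y} \<in> ?J" by simp_all
    show "e \<in> {{Inl u, Inl v} | u v. u < k \<and> v < k \<and> u \<noteq> v}
      \<union> {{Inr u, Inr v} | u v. u < n - k \<and> v < n - k \<and> u mod p \<noteq> v mod p}
      \<union> {{Inl u, Inr v} | u v. u < k \<and> v < n - k}"
    proof (cases x; cases y)
      fix a b assume "x = Inl a" "y = Inl b"
      with e show ?thesis by (auto simp: join_edges_iff)
    next
      fix a b assume "x = Inl a" "y = Inr b"
      with e show ?thesis by (auto simp: join_edges_iff)
    next
      fix a b assume "x = Inr a" "y = Inl b"
      with e have "e = {Inl b, Inr a}" "b < k" "a < n - k" by (auto simp: join_edges_iff)
      then show ?thesis by blast
    next
      fix a b assume "x = Inr a" "y = Inr b"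
      with e show ?thesis by (auto simp: join_edges_iff)
    qed
  qed (auto simp: join_edges_iff)
  finally show "edges (H_graph n p (k + 1)) = ?J" .
qed

lemma simple_graph_H_graph: "simple_graph (H_graph n p (k + 1))"
  unfolding simple_graph_def H_graph_eq using join_edges_subset by auto

lemma card_verts_H_graph:
  assumes "k \<le> n" shows "card (verts (H_graph n p (k + 1))) = n"
  unfolding H_graph_eq using assms
  by (subst card_Un_disjoint) (auto simp: card_image)

lemma join_edges_complete:
  assumes "W \<subseteq> V" "\<And>u v. u \<in> V - W \<Longrightarrow> v \<in> V - W \<Longrightarrow> u = v"
  shows "join_edges V W c = nsets V 2"
proof (rule equalityI[OF join_edges_subset], rule subsetI)
  fix e assume "e \<in> nsets V 2"
  then show "e \<in> join_edges V W c"
    using assms unfolding nsets_2_iff join_edges_def by blast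
qed

text \<open>With at most one vertex outside the clique the graph is complete; these values start the
  inductions on the number of vertices.\<close>

lemma h_num_complete:
  assumes "n = k \<or> n = k + 1" shows "h_num n p (k + 1) = n choose 2"
proof -
  have "edges (H_graph n p (k + 1)) = nsets (verts (H_graph n p (k + 1))) 2"
    unfolding H_graph_eq using assms by (intro join_edges_complete) auto
  then show ?thesis using assms card_verts_H_graph[of k n p]
    by (auto simp: h_num_def card_nsets simple_graph_H_graph)
qed

lemma card_residue_class:
  assumes "p \<ge> 1"
  shows "card {u. u < Suc N \<and> u mod p = N mod p} = N div p + 1"
proof -
  have "bij_betw (\<lambda>i. i * p + N mod p) {..N div p} {u. u < Suc N \<and> u mod p = N mod p}"
  proof (rule bij_betwI[where g = "\<lambda>u. u div p"])
    show "(\<lambda>i. i * p + N mod p) \<in> {..N div p} \<rightarrow> {u. u < Suc N \<and> u mod p = N mod p}"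
    proof
      fix i assume "i \<in> {..N div p}"
      then have "i * p + N mod p \<le> N div p * p + N mod p" by (intro add_right_mono mult_right_mono) auto
      then have "i * p + N mod p \<le> N" by (simp only: div_mult_mod_eq)
      then show "i * p + N mod p \<in> {u. u < Suc N \<and> u mod p = N mod p}" by simp
    qed
    show "(\<lambda>u. u div p) \<in> {u. u < Suc N \<and> u mod p = N mod p} \<rightarrow> {..N div p}"
      by (auto intro: div_le_mono)
    show "u div p * p + N mod p = u" if "u \<in> {u. u < Suc N \<and> u mod p = N mod p}" for u
      using that div_mult_mod_eq[of u p] by auto
  qed (use assms in auto)
  from bij_betw_same_card[OF this] show ?thesis by simp
qed

text \<open>The added vertex \<open>Inr (m - k)\<close> misses exactly the
  \<open>(m - k) div p\<close> earlier vertices of its residue class.\<close>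

lemma h_num_Suc:
  assumes "k \<le> m" "p \<ge> 1"
  shows "h_num (Suc m) p (k + 1) + (m - k) div p = h_num m p (k + 1) + m"
proof -
  let ?V = "Inl ` {..<k} \<union> Inr ` {..<Suc m - k} :: (nat + nat) set" and ?W = "Inl ` {..<k} :: (nat + nat) set"
  let ?c = "\<lambda>x. case x of Inl _ \<Rightarrow> 0 | Inr v \<Rightarrow> v mod p"
  have "{u \<in> ?V - ?W. ?c u = ?c (Inr (m - k))} = Inr ` {u. u < Suc (m - k) \<and> u mod p = (m - k) mod p}"
    using assms by auto
  then have "card {u \<in> ?V - ?W. ?c u = ?c (Inr (m - k))} = (m - k) div p + 1"
    using card_residue_class[OF assms(2), of "m - k"] by (simp add: card_image)
  moreover have "?V - {Inr (m - k)} = Inl ` {..<k} \<union> Inr ` {..<m - k}"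
    using assms by auto
  moreover have "card ?V = Suc m" using card_verts_H_graph[of k "Suc m" p, unfolded H_graph_eq] assms by simp
  ultimately show ?thesis
    using card_join_edges_remove[of ?V "Inr (m - k)" ?W ?c] assms
    unfolding h_num_def H_graph_eq by auto
qed

text \<open>Both sides grow with \<open>m\<close> according to \<open>h_num_Suc\<close>, and they
  agree at \<open>m = k + 1\<close>, where both graphs are complete.\<close>

lemma h_num_mono_clique:
  assumes "k + 1 \<le> m" "p \<ge> 1"
  shows "h_num m p (k + 2) = h_num m p (k + 1) + (m - k - 1) div p"
  using assms(1)
proof (induction m rule: dec_induct)
  case base
  show ?case using h_num_complete[of "k + 1" "k + 1" p] h_num_complete[of "k + 1" k p] by simp
next
  case (step m)
  have "h_num (Suc m) p (k + 2) + (m - (k + 1)) div p = h_num m p (k + 2) + m"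
    using h_num_Suc[of "k + 1" m p] step assms by simp
  moreover have "h_num (Suc m) p (k + 1) + (m - k) div p = h_num m p (k + 1) + m"
    using h_num_Suc[of k m p] step assms by simp
  ultimately show ?case using step.IH by simp
qed

text \<open>A clique smaller than \<open>k\<close> costs about \<open>m / p\<close> edges. This loss
  is what later forces the number of full vertices up to \<open>k\<close>.\<close>

lemma h_num_mono:
  assumes "j < k" "k \<le> m" "p \<ge> 1"
  shows "h_num m p (j + 1) + (m - k) div p \<le> h_num m p (k + 1)"
proof -
  have "Suc j \<le> k" using assms by simp
  then have "k \<le> m \<longrightarrow> h_num m p (j + 2) \<le> h_num m p (k + 1)"
  proof (induction k rule: dec_induct)
    case (step i)
    then show ?case using h_num_mono_clique[of i m p] assms by simp
  qed simp
  then have "h_num m p (j + 2) \<le> h_num m p (k + 1)" using assms by simp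
  moreover have "(m - k) div p \<le> (m - j - 1) div p" using assms by (intro div_le_mono) auto
  ultimately show ?thesis using h_num_mono_clique[of j m p] assms by simp
qed

section \<open>Balanced colourings\<close>

lemma sum_card_classes:
  assumes "finite A" "\<And>v. v \<in> A \<Longrightarrow> c v < (p::nat)"
  shows "(\<Sum>i<p. card {v \<in> A. c v = i}) = card A"
proof -
  have "A = (\<Union>i<p. {v \<in> A. c v = i})" using assms by auto
  then have "card A = card (\<Union>i<p. {v \<in> A. c v = i})" by simp
  also have "\<dots> = (\<Sum>i<p. card {v \<in> A. c v = i})"
    using assms by (intro card_UN_disjoint) auto
  finally show ?thesis by simp
qed

text \<open>Among \<open>N + 1\<close> vertices outside \<open>W\<close> some class has at least
  \<open>N div p + 1\<close>; a vertex of this class has at most the degree of the last vertex of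
  the balanced graph, so removing it and induction give the bound.\<close>

lemma card_join_edges_le:
  assumes "finite V" "W \<subseteq> V" "\<And>v. v \<in> V - W \<Longrightarrow> c v < p"
  shows "card (join_edges V W c) \<le> h_num (card V) p (card W + 1)"
  using assms
proof (induction "card (V - W)" arbitrary: V)
  case 0
  then have "V = W" by auto
  then show ?case using 0 join_edges_complete[of W V c] h_num_complete[of "card V" "card W" p]
    by (simp add: card_nsets)
next
  case (Suc N)
  have "V - W \<noteq> {}" using Suc.hyps(2) by (metis card.empty nat.distinct(1))
  then have p: "p \<ge> 1" using Suc.prems(3) by (metis all_not_in_conv less_one linorder_not_less not_less_zero)
  have "\<exists>i<p. N div p + 1 \<le> card {u \<in> V - W. c u = i}"
  proof (rule ccontr)
    assume "\<not> ?thesis"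
    then have "card {u \<in> V - W. c u = i} \<le> N div p" if "i < p" for i
      using that by (simp add: not_less_eq_eq)
    then have "(\<Sum>i<p. card {u \<in> V - W. c u = i}) \<le> (\<Sum>i<p. N div p)" by (intro sum_mono) auto
    also have "\<dots> = p * (N div p)" by simp
    also have "\<dots> \<le> N" by simp
    finally show False using sum_card_classes[of "V - W" c p] Suc by simp
  qed
  then obtain i where i: "i < p" "N div p + 1 \<le> card {u \<in> V - W. c u = i}" by blast
  then have "{u \<in> V - W. c u = i} \<noteq> {}" by (metis One_nat_def add_is_0 card.empty le_zero_eq nat.distinct(1))
  then obtain v where v: "v \<in> V - W" "c v = i" by blast
  have VW: "V - {v} - W = (V - W) - {v}" by auto
  have "N = card (V - {v} - W)" unfolding VW using Suc.hyps(2) Suc.prems v by simp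
  from Suc.hyps(1)[OF this] have IH: "card (join_edges (V - {v}) W c) \<le> h_num (card V - 1) p (card W + 1)"
    using Suc.prems v by (auto simp: card_Diff_singleton)
  have "card (V - W) = card V - card W" using Suc.prems finite_subset by (intro card_Diff_subset) auto
  then have N: "card V = Suc (card W + N)" using Suc.hyps(2) by simp
  have "h_num (card V) p (card W + 1) + N div p = h_num (card V - 1) p (card W + 1) + (card V - 1)"
    using h_num_Suc[of "card W" "card W + N" p] p N by simp
  moreover have "card (join_edges V W c) + card {u \<in> V - W. c u = i} = card (join_edges (V - {v}) W c) + card V"
    using card_join_edges_remove[of V v W c] v Suc.prems by auto
  ultimately show ?case using IH i(2) N by linarith
qed

text \<open>Moving a vertex from class \<open>i\<close> to a class that is smaller by at least two
  would gain edges, against \<open>card_join_edges_le\<close>.\<close>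

lemma join_edges_balanced:
  assumes V: "finite V" "W \<subseteq> V" "\<And>v. v \<in> V - W \<Longrightarrow> c v < p"
    and eq: "card (join_edges V W c) = h_num (card V) p (card W + 1)" and ij: "i < p" "j < p"
  shows "card {v \<in> V - W. c v = i} \<le> card {v \<in> V - W. c v = j} + 1"
proof (rule ccontr)
  assume "\<not> ?thesis"
  then have gt: "card {v \<in> V - W. c v = i} > card {v \<in> V - W. c v = j} + 1" by simp
  then have "i \<noteq> j" "{v \<in> V - W. c v = i} \<noteq> {}" by (metis less_irrefl add_lessD1, metis card.empty not_less_zero)
  then obtain v where v: "v \<in> V - W" "c v = i" by blast
  let ?c = "c(v := j)"
  have "{u \<in> V - W. ?c u = ?c v} = insert v {u \<in> V - W. c u = j}" using v \<open>i \<noteq> j\<close> by auto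
  then have cl: "card {u \<in> V - W. ?c u = ?c v} = card {u \<in> V - W. c u = j} + 1"
    using v V \<open>i \<noteq> j\<close> by simp
  have "join_edges (V - {v}) W ?c = join_edges (V - {v}) W c" by (auto simp: join_edges_def)
  then have "card (join_edges V W c) < card (join_edges V W ?c)"
    using card_join_edges_remove[of V v W c] card_join_edges_remove[of V v W ?c] v V gt cl by auto
  moreover have "card (join_edges V W ?c) \<le> h_num (card V) p (card W + 1)"
    using V ij by (intro card_join_edges_le) auto
  ultimately show False using eq by simp
qed

text \<open>If \<open>a\<close> is a smallest class and \<open>A\<close> the set of classes with one
  element more, then \<open>N = n a * p + card A\<close>, and \<open>card A < p\<close> because
  \<open>a\<close> is not in \<open>A\<close>: this is division with remainder.\<close>

lemma balanced_sizes:
  fixes n :: "nat \<Rightarrow> nat"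
  assumes p: "p \<ge> 1" and bal: "\<And>i j. i < p \<Longrightarrow> j < p \<Longrightarrow> n i \<le> n j + 1" and N: "(\<Sum>i<p. n i) = N"
  shows "\<And>i. i < p \<Longrightarrow> n i = N div p \<or> n i = N div p + 1" "card {i. i < p \<and> n i = N div p + 1} = N mod p"
proof -
  obtain a where a: "a < p" "\<And>i. i < p \<Longrightarrow> n a \<le> n i"
  proof -
    have "Min (n ` {..<p}) \<in> n ` {..<p}" using p by (intro Min_in) (auto simp: lessThan_empty_iff)
    then obtain a where "a < p" "n a = Min (n ` {..<p})" by auto
    then show thesis by (intro that[of a]) auto
  qed
  define A where "A = {i. i < p \<and> n i = n a + 1}"
  have n: "n i = n a + (if i \<in> A then 1 else 0)" if "i < p" for i
    using a(2)[OF that] bal[OF that a(1)] that by (auto simp: A_def)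
  have "N = (\<Sum>i<p. n a + (if i \<in> A then 1 else 0))" using N n by simp
  also have "\<dots> = n a * p + card ({..<p} \<inter> A)" by (simp add: sum.distrib sum.If_cases)
  also have "{..<p} \<inter> A = A" by (auto simp: A_def)
  finally have NA: "N = n a * p + card A" .
  have "A \<subseteq> {..<p}" "a \<notin> A" "a \<in> {..<p}" using a(1) by (auto simp: A_def)
  then have "A \<subset> {..<p}" by blast
  then have "card A < p" using psubset_card_mono[of "{..<p}" A] by simp
  with NA have dm: "N div p = n a" "N mod p = card A" by auto
  show "n i = N div p \<or> n i = N div p + 1" if "i < p" for i using n[OF that] dm by auto
  show "card {i. i < p \<and> n i = N div p + 1} = N mod p" using dm by (simp add: A_def)
qed

text \<open>By \<open>balanced_sizes\<close> both colourings have equally many classes of each size.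
  So the classes can be matched by a size-preserving bijection \<open>\<sigma>\<close> of the
  colours, and then the vertices within matched classes.\<close>

lemma balanced_colouring_bij:
  fixes c :: "'a \<Rightarrow> nat" and c' :: "'b \<Rightarrow> nat"
  assumes p: "p \<ge> 1" and fin: "finite A" "finite B" and card: "card A = card B"
    and c: "\<And>v. v \<in> A \<Longrightarrow> c v < p" "\<And>v. v \<in> B \<Longrightarrow> c' v < p"
    and bal: "\<And>i j. i < p \<Longrightarrow> j < p \<Longrightarrow> card {v \<in> A. c v = i} \<le> card {v \<in> A. c v = j} + 1"
      "\<And>i j. i < p \<Longrightarrow> j < p \<Longrightarrow> card {v \<in> B. c' v = i} \<le> card {v \<in> B. c' v = j} + 1"
  obtains f where "bij_betw f A B" "\<And>u v. u \<in> A \<Longrightarrow> v \<in> A \<Longrightarrow> c u = c v \<longleftrightarrow> c' (f u) = c' (f v)"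
proof -
  define a b where "a i = card {v \<in> A. c v = i}" and "b i = card {v \<in> B. c' v = i}" for i
  define M where "M = card A div p + 1"
  note sa = balanced_sizes[of p a "card A", OF p]
  note sb = balanced_sizes[of p b "card A", OF p]
  have A1: "\<And>i. i < p \<Longrightarrow> a i = M - 1 \<or> a i = M" "card {i. i < p \<and> a i = M} = card A mod p"
    using sa bal(1) sum_card_classes[OF fin(1) c(1)] by (auto simp: a_def M_def)
  have B1: "\<And>i. i < p \<Longrightarrow> b i = M - 1 \<or> b i = M" "card {i. i < p \<and> b i = M} = card A mod p"
    using sb bal(2) sum_card_classes[OF fin(2) c(2)] card by (auto simp: b_def M_def)
  have "card {i. i < p \<and> a i \<noteq> M} = card ({..<p} - {i. i < p \<and> a i = M})" by (rule arg_cong[of _ _ card]) auto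
  also have "\<dots> = p - card A mod p" using A1(2) by (subst card_Diff_subset) auto
  finally have A2: "card {i. i < p \<and> a i \<noteq> M} = p - card A mod p" .
  have "card {i. i < p \<and> b i \<noteq> M} = card ({..<p} - {i. i < p \<and> b i = M})" by (rule arg_cong[of _ _ card]) auto
  also have "\<dots> = p - card A mod p" using B1(2) by (subst card_Diff_subset) auto
  finally have B2: "card {i. i < p \<and> b i \<noteq> M} = p - card A mod p" .
  obtain \<sigma>1 where s1: "bij_betw \<sigma>1 {i. i < p \<and> a i = M} {i. i < p \<and> b i = M}"
    using finite_same_card_bij[of "{i. i < p \<and> a i = M}" "{i. i < p \<and> b i = M}"] A1(2) B1(2) by auto
  obtain \<sigma>2 where s2: "bij_betw \<sigma>2 {i. i < p \<and> a i \<noteq> M} {i. i < p \<and> b i \<noteq> M}"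
    using finite_same_card_bij[of "{i. i < p \<and> a i \<noteq> M}" "{i. i < p \<and> b i \<noteq> M}"] A2 B2 by auto
  define \<sigma> where "\<sigma> i = (if a i = M then \<sigma>1 i else \<sigma>2 i)" for i
  have s: "\<sigma> i < p \<and> b (\<sigma> i) = a i" if "i < p" for i
    using bij_betwE[OF s1] bij_betwE[OF s2] A1(1)[OF that] B1(1)[of "\<sigma> i"] that
    by (auto simp: \<sigma>_def)
  have sinj: "inj_on \<sigma> {..<p}"
  proof (rule inj_onI)
    fix i j assume ij: "i \<in> {..<p}" "j \<in> {..<p}" "\<sigma> i = \<sigma> j"
    have "a i = a j" using ij s[of i] s[of j] by simp
    show "i = j"
    proof (cases "a i = M")
      case True
      then have "\<sigma>1 i = \<sigma>1 j" using ij(3) \<open>a i = a j\<close> by (simp add: \<sigma>_def)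
      then show ?thesis
        using inj_onD[OF bij_betw_imp_inj_on[OF s1], of i j] ij True \<open>a i = a j\<close> by simp
    next
      case False
      then have "\<sigma>2 i = \<sigma>2 j" using ij(3) \<open>a i = a j\<close> by (simp add: \<sigma>_def)
      then show ?thesis
        using inj_onD[OF bij_betw_imp_inj_on[OF s2], of i j] ij False \<open>a i = a j\<close> by simp
    qed
  qed
  have "\<exists>g. bij_betw g {v \<in> A. c v = i} {v \<in> B. c' v = \<sigma> i}" if "i < p" for i
    using s[OF that] fin by (intro finite_same_card_bij) (auto simp: a_def b_def)
  then obtain g where g: "\<And>i. i < p \<Longrightarrow> bij_betw (g i) {v \<in> A. c v = i} {v \<in> B. c' v = \<sigma> i}" by metis
  define f where "f v = g (c v) v" for v
  have f: "f v \<in> B \<and> c' (f v) = \<sigma> (c v)" if "v \<in> A" for v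
    using bij_betwE[OF g[OF c(1)[OF that]]] that by (auto simp: f_def)
  have same: "c u = c v \<longleftrightarrow> c' (f u) = c' (f v)" if "u \<in> A" "v \<in> A" for u v
    using f that sinj c(1) by (auto dest: inj_onD)
  have "inj_on f A"
  proof (rule inj_onI)
    fix u v assume uv: "u \<in> A" "v \<in> A" "f u = f v"
    then have "c u = c v" using same by auto
    then show "u = v" using g[OF c(1)[OF uv(1)]] uv by (auto simp: f_def bij_betw_def inj_on_def)
  qed
  then have "bij_betw f A B"
    using f fin card by (simp add: bij_betw_def card_image card_subset_eq image_subset_iff)
  then show thesis using that same by blast
qed

lemma graph_iso_H_graph:
  assumes fin: "finite (verts G)" and G: "edges G = join_edges (verts G) W c"
    and W: "W \<subseteq> verts G" "card W = k" and p: "p \<ge> 1"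
    and c: "\<And>v. v \<in> verts G - W \<Longrightarrow> c v < p"
    and bal: "\<And>i j. i < p \<Longrightarrow> j < p \<Longrightarrow>
      card {v \<in> verts G - W. c v = i} \<le> card {v \<in> verts G - W. c v = j} + 1"
  shows "graph_iso G (H_graph (card (verts G)) p (k + 1))"
proof -
  define n where "n = card (verts G)"
  define V' W' :: "(nat + nat) set" where "V' = Inl ` {..<k} \<union> Inr ` {..<n - k}" and "W' = Inl ` {..<k}"
  define c' where "c' x = (case x of Inl _ \<Rightarrow> 0 | Inr v \<Rightarrow> v mod p)" for x :: "nat + nat"
  have VW': "V' - W' = Inr ` {..<n - k}" by (auto simp: V'_def W'_def)
  have finW: "finite W" using W fin finite_subset by blast
  have cl: "card {v \<in> V' - W'. c' v = i} = card {v \<in> {..<n - k}. v mod p = i}" for i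
  proof -
    have "{v \<in> V' - W'. c' v = i} = Inr ` {v \<in> {..<n - k}. v mod p = i}" unfolding VW' by (auto simp: c'_def)
    then show ?thesis by (simp add: card_image)
  qed
  obtain f where f: "bij_betw f (verts G - W) (V' - W')"
    "\<And>u v. u \<in> verts G - W \<Longrightarrow> v \<in> verts G - W \<Longrightarrow> c u = c v \<longleftrightarrow> c' (f u) = c' (f v)"
  proof (rule balanced_colouring_bij[OF p, of "verts G - W" "V' - W'" c c'])
    show "card (verts G - W) = card (V' - W')" unfolding VW'
      using W finW by (simp add: card_Diff_subset card_image n_def)
    show "card {v \<in> V' - W'. c' v = i} \<le> card {v \<in> V' - W'. c' v = j} + 1" if "i < p" "j < p" for i j
      unfolding cl by (rule turan_classes_balanced[OF that])
  qed (use fin c bal p in \<open>auto simp: VW' c'_def\<close>)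
  obtain g where g: "bij_betw g W W'"
    using finite_same_card_bij[of W W'] finW W by (auto simp: W'_def card_image)
  define h where "h v = (if v \<in> W then g v else f v)" for v
  have hW: "bij_betw h W W'" using g by (simp add: h_def cong: bij_betw_cong)
  moreover have "bij_betw h (verts G - W) (V' - W')" using f(1) bij_betw_cong[of "verts G - W" h f "V' - W'"] by (simp add: h_def)
  ultimately have "bij_betw h (W \<union> (verts G - W)) (W' \<union> (V' - W'))"
    by (rule bij_betw_combine) auto
  moreover have "W \<union> (verts G - W) = verts G" "W' \<union> (V' - W') = V'" using W by (auto simp: V'_def W'_def)
  ultimately have h: "bij_betw h (verts G) V'" by simp
  have "join_edges V' W' c' = (\<lambda>e. h ` e) ` join_edges (verts G) W c"
    by (rule join_edges_image[OF h W(1)]) (use hW f(2) in \<open>auto simp: bij_betw_def h_def\<close>)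
  then show ?thesis
    unfolding graph_iso_def H_graph_eq n_def[symmetric] G
    using h unfolding V'_def W'_def c'_def by blast
qed

section \<open>Complete multipartite subgraphs\<close>

lemma large_fibre:
  assumes "finite A" "finite B" "f ` A \<subseteq> B" "card B * m < card A"
  obtains b where "b \<in> B" "m < card {a \<in> A. f a = b}"
proof -
  have "card A = card (\<Union>b\<in>B. {a \<in> A. f a = b})" using assms(3) by (intro arg_cong[of _ _ card]) auto
  also have "\<dots> \<le> (\<Sum>b\<in>B. card {a \<in> A. f a = b})" using assms by (intro card_UN_le)
  finally have *: "card A \<le> (\<Sum>b\<in>B. card {a \<in> A. f a = b})" .
  show thesis
  proof (rule ccontr)
    assume "\<not> thesis"
    then have "card {a \<in> A. f a = b} \<le> m" if "b \<in> B" for b using that \<open>_ \<Longrightarrow> _ \<Longrightarrow> thesis\<close> by (meson not_le)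
    then have "(\<Sum>b\<in>B. card {a \<in> A. f a = b}) \<le> (\<Sum>b\<in>B. m)" by (intro sum_mono)
    then show False using * assms(4) by simp
  qed
qed

lemma sum_nonadjacent_swap:
  assumes "finite A" "finite B"
  shows "(\<Sum>v\<in>A. card {u \<in> B. \<not> adj G v u}) = (\<Sum>u\<in>B. card {v \<in> A. \<not> adj G u v})"
proof -
  have "(\<Sum>v\<in>A. card {u \<in> B. \<not> adj G v u}) = (\<Sum>v\<in>A. \<Sum>u\<in>B. if adj G v u then 0 else 1)"
    using assms by (intro sum.cong) (auto simp: sum.If_cases Int_def conj_commute)
  also have "\<dots> = (\<Sum>u\<in>B. \<Sum>v\<in>A. if adj G u v then 0 else 1)"
    by (subst sum.swap) (simp add: adj_commute)
  also have "\<dots> = (\<Sum>u\<in>B. card {v \<in> A. \<not> adj G u v})"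
    using assms by (intro sum.cong) (auto simp: sum.If_cases Int_def conj_commute)
  finally show ?thesis .
qed

lemma card_le_common_neighbours:
  assumes "finite A" "finite B" "card B \<le> b" "\<And>x. x \<in> B \<Longrightarrow> card {y \<in> A. \<not> adj G x y} \<le> D"
  shows "card A \<le> card {y \<in> A. \<forall>x\<in>B. adj G x y} + b * D"
proof -
  have "card A \<le> card ({y \<in> A. \<forall>x\<in>B. adj G x y} \<union> (\<Union>x\<in>B. {y \<in> A. \<not> adj G x y}))"
    using assms by (intro card_mono) auto
  also have "\<dots> \<le> card {y \<in> A. \<forall>x\<in>B. adj G x y} + card (\<Union>x\<in>B. {y \<in> A. \<not> adj G x y})"
    by (rule card_Un_le)
  also have "card (\<Union>x\<in>B. {y \<in> A. \<not> adj G x y}) \<le> (\<Sum>x\<in>B. card {y \<in> A. \<not> adj G x y})"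
    using assms by (intro card_UN_le)
  also have "\<dots> \<le> (\<Sum>x\<in>B. D)" using assms(4) by (intro sum_mono)
  also have "\<dots> \<le> b * D" using assms(3) by simp
  finally show ?thesis by simp
qed

text \<open>The non-neighbours of \<open>v\<close> counted here include \<open>v\<close> itself.\<close>

definition turan_degrees :: "nat \<Rightarrow> 'a sgraph \<Rightarrow> bool" where
  "turan_degrees p G \<longleftrightarrow> (\<forall>v\<in>verts G. real (card {u \<in> verts G. \<not> adj G v u}) \<le> card (verts G) / p + 1)"

lemma sum_nonadjacent_le:
  assumes "finite (verts G)" "turan_degrees p G" "U \<subseteq> verts G" "card U \<le> m"
  shows "(\<Sum>v\<in>verts G. real (card {u \<in> U. \<not> adj G v u})) \<le> m * (card (verts G) / p + 1)"
proof -
  have "finite U" using assms finite_subset by blast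
  then have "(\<Sum>v\<in>verts G. real (card {u \<in> U. \<not> adj G v u})) = (\<Sum>u\<in>U. real (card {v \<in> verts G. \<not> adj G u v}))"
    using sum_nonadjacent_swap[of "verts G" U G] assms(1) by (simp flip: of_nat_sum)
  also have "\<dots> \<le> (\<Sum>u\<in>U. card (verts G) / p + 1)"
    using assms by (intro sum_mono) (auto simp: turan_degrees_def)
  also have "\<dots> = card U * (card (verts G) / p + 1)" by simp
  also have "\<dots> \<le> m * (card (verts G) / p + 1)" using assms(4) by (intro mult_right_mono) auto
  finally show ?thesis .
qed

text \<open>Classes are added one by one. A positive proportion of the vertices has at least
  \<open>L\<close> neighbours in each of the \<open>r\<close> larger classes of size
  \<open>L'\<close>; among them many have the same neighbourhood \<open>B\<close> in these classes.
  They form the new class, and the old ones shrink to their traces on \<open>B\<close>.\<close>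

lemma obtain_complete_multipartite:
  assumes "p \<ge> 1" "r \<le> p"
  shows "\<exists>N. \<forall>G :: 'a sgraph. simple_graph G \<longrightarrow> N \<le> card (verts G) \<longrightarrow> turan_degrees p G \<longrightarrow>
    (\<exists>A. (\<forall>i<r. A i \<subseteq> verts G \<and> card (A i) = L) \<and>
      (\<forall>i<r. \<forall>j<r. i \<noteq> j \<longrightarrow> (\<forall>x\<in>A i. \<forall>y\<in>A j. adj G x y)))"
  using assms(2)
proof (induction r arbitrary: L)
  case 0
  then show ?case by simp
next
  case (Suc r)
  show ?case
  proof (cases "L = 0")
    case True
    then show ?thesis by (intro exI[of _ 0] allI impI exI[of _ "\<lambda>_. {}"]) simp
  next
    case False
    \<comment> \<open>The non-adjacent pairs between the vertices and the old classes number at most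
      \<open>(p - 1) * L' * (n / p + 1)\<close>. With \<open>L' = 2 * p * L\<close>, the vertices
      missing more than \<open>L' - L\<close> of the old classes are, up to a constant, at most a
      proportion \<open>(2 * p - 2) / (2 * p - 1)\<close>.\<close>
    define L' where "L' = 2 * p * L"
    obtain N where N: "\<And>G :: 'a sgraph. simple_graph G \<Longrightarrow> N \<le> card (verts G) \<Longrightarrow> turan_degrees p G \<Longrightarrow>
      (\<exists>A. (\<forall>i<r. A i \<subseteq> verts G \<and> card (A i) = L') \<and>
      (\<forall>i<r. \<forall>j<r. i \<noteq> j \<longrightarrow> (\<forall>x\<in>A i. \<forall>y\<in>A j. adj G x y)))"
      using Suc.IH[of L'] Suc.prems by auto
    define N' where "N' = N + 2 * p * p + 2 * p * (2 ^ (r * L') * L)"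
    have "\<exists>A. (\<forall>i<Suc r. A i \<subseteq> verts G \<and> card (A i) = L) \<and>
      (\<forall>i<Suc r. \<forall>j<Suc r. i \<noteq> j \<longrightarrow> (\<forall>x\<in>A i. \<forall>y\<in>A j. adj G x y))"
      if G: "simple_graph G" "N' \<le> card (verts G)" "turan_degrees p G" for G :: "'a sgraph"
    proof -
      define n where "n = card (verts G)"
      obtain A where A: "\<And>i. i < r \<Longrightarrow> A i \<subseteq> verts G" "\<And>i. i < r \<Longrightarrow> card (A i) = L'"
        "\<And>i j x y. i < r \<Longrightarrow> j < r \<Longrightarrow> i \<noteq> j \<Longrightarrow> x \<in> A i \<Longrightarrow> y \<in> A j \<Longrightarrow> adj G x y"
        using N[of G] G unfolding N'_def by (metis add_leE)
      have fin: "finite (verts G)" using G by (simp add: simple_graph_def)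
      define U where "U = (\<Union>i<r. A i)"
      have U: "U \<subseteq> verts G" using A by (auto simp: U_def)
      have finU: "finite U" using U fin finite_subset by blast
      have cU: "card U \<le> r * L'" unfolding U_def using card_UN_le[of "{..<r}" A] A(2) by simp
      \<comment> \<open>Missing at most \<open>L' - L\<close> vertices of the whole union leaves
        \<open>L\<close> neighbours in every single class.\<close>
      define good where "good = {v \<in> verts G. card {u \<in> U. \<not> adj G v u} \<le> L' - L}"
      have L'L: "real L' - real L = (2 * real p - 1) * L" by (simp add: L'_def algebra_simps)
      have LL: "L \<le> L'" using assms(1) by (simp add: L'_def)
      have "card (verts G - good) * (real L' - L) = (\<Sum>v\<in>verts G - good. real L' - L)" by simp
      also have "\<dots> \<le> (\<Sum>v\<in>verts G - good. real (card {u \<in> U. \<not> adj G v u}))"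
        using LL by (intro sum_mono) (auto simp: good_def)
      also have "\<dots> \<le> (\<Sum>v\<in>verts G. real (card {u \<in> U. \<not> adj G v u}))"
        using fin by (intro sum_mono2) auto
      also have "\<dots> \<le> (r * L') * (n / p + 1)"
        using sum_nonadjacent_le[OF fin G(3) U cU] by (simp add: n_def)
      also have "\<dots> \<le> ((p - 1) * L') * (n / p + 1)"
        using Suc.prems by (intro mult_right_mono) (auto simp flip: of_nat_mult intro!: mult_right_mono)
      also have "\<dots> = ((real p - 1) * 2 * (n + p)) * L"
        using assms(1) by (simp add: L'_def field_simps of_nat_diff)
      finally have "card (verts G - good) * (2 * real p - 1) * L \<le> (real p - 1) * 2 * (n + p) * L"
        unfolding L'L by (simp add: mult.assoc)
      then have *: "card (verts G - good) * (2 * real p - 1) \<le> (real p - 1) * 2 * (n + p)"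
        using False by simp
      have "real (card (verts G - good)) = n - real (card good)"
        using fin card_mono[of "verts G" good] by (subst card_Diff_subset) (auto simp: good_def n_def of_nat_diff)
      with * have "n - 2 * real p * (real p - 1) \<le> card good * (2 * real p - 1)" by (simp add: algebra_simps)
      also have "\<dots> \<le> card good * (2 * real p)" by (intro mult_left_mono) auto
      finally have **: "n - 2 * real p * (real p - 1) \<le> card good * (2 * real p)" .
      have nN: "real n \<ge> 2 * real p * p + 2 * p * (2 ^ (r * L') * L)"
      proof -
        have "n \<ge> 2 * p * p + 2 * p * (2 ^ (r * L') * L)" using G(2) by (simp add: N'_def n_def)
        then have "real n \<ge> real (2 * p * p + 2 * p * (2 ^ (r * L') * L))" by (rule of_nat_mono)
        then show ?thesis by simp
      qed
      have p1: "real p \<ge> 1" using assms(1) by simp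
      have "2 ^ (r * L') * real L < card good"
      proof -
        have "2 * real p * p - 2 * real p * (real p - 1) = 2 * p" by (simp add: algebra_simps)
        then have "n - 2 * real p * (real p - 1) \<ge> 2 * p + 2 * p * (2 ^ (r * L') * L)" using nN by simp
        with ** have "2 * real p + 2 * real p * (2 ^ (r * L') * L) \<le> card good * (2 * real p)"
          by simp
        then have "2 * real p * (1 + 2 ^ (r * L') * real L) \<le> 2 * real p * card good"
          by (simp add: algebra_simps)
        then have "1 + 2 ^ (r * L') * real L \<le> card good"
          by (rule mult_left_le_imp_le) (use p1 in simp)
        then show ?thesis by simp
      qed
      then have "real (2 ^ (r * L') * L) < real (card good)" by simp
      then have "2 ^ (r * L') * L < card good" by (simp only: of_nat_less_iff)
      moreover have "card (Pow U) \<le> 2 ^ (r * L')" using finU cU by (simp add: card_Pow)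
      ultimately have "card (Pow U) * L < card good" by (meson le_less_trans mult_le_mono1)
      moreover have "finite good" using fin by (simp add: good_def)
      ultimately obtain B where B: "B \<in> Pow U" "L < card {v \<in> good. {u \<in> U. adj G v u} = B}"
        using large_fibre[of good "Pow U" "\<lambda>v. {u \<in> U. adj G v u}" L] finU by auto
      define H where "H = {v \<in> good. {u \<in> U. adj G v u} = B}"
      obtain C where C: "C \<subseteq> H" "card C = L"
        using B(2) obtain_subset_with_card_n[of L H] by (auto simp: H_def)
      have "H \<noteq> {}" using B(2) by (auto simp: H_def[symmetric])
      then obtain v where v: "v \<in> H" by blast
      have "\<exists>A'. A' \<subseteq> A i \<inter> B \<and> card A' = L" if i: "i < r" for i
      proof -
        have fA: "finite (A i)" using A(1)[OF i] fin finite_subset by blast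
        have AB: "A i \<inter> B = A i - {u \<in> A i. \<not> adj G v u}" using v i by (auto simp: H_def U_def)
        have "card {u \<in> A i. \<not> adj G v u} \<le> card {u \<in> U. \<not> adj G v u}"
          using finU i by (intro card_mono) (auto simp: U_def)
        also have "\<dots> \<le> L' - L" using v by (auto simp: H_def good_def)
        finally have "card (A i \<inter> B) \<ge> L"
          unfolding AB using fA A(2)[OF i] LL by (subst card_Diff_subset) auto
        then show ?thesis by (meson obtain_subset_with_card_n)
      qed
      then obtain A' where A': "\<And>i. i < r \<Longrightarrow> A' i \<subseteq> A i \<inter> B" "\<And>i. i < r \<Longrightarrow> card (A' i) = L" by metis
      define A'' where "A'' i = (if i < r then A' i else C)" for i
      have CA: "adj G x y" if "x \<in> C" "y \<in> B" for x y
        using that C(1) B(1) by (auto simp: H_def)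
      have "A'' i \<subseteq> verts G \<and> card (A'' i) = L" if "i < Suc r" for i
      proof (cases "i < r")
        case True
        then show ?thesis using A'[OF True] A(1)[OF True] by (auto simp: A''_def)
      next
        case False
        have "H \<subseteq> verts G" by (auto simp: H_def good_def)
        then show ?thesis using False C by (auto simp: A''_def)
      qed
      moreover have "adj G x y" if ij: "i < Suc r" "j < Suc r" "i \<noteq> j" "x \<in> A'' i" "y \<in> A'' j" for i j x y
      proof -
        consider "i < r" "j < r" | "i = r" "j < r" | "i < r" "j = r" using ij by linarith
        then show ?thesis
        proof cases
          case 1
          then have "x \<in> A i" "y \<in> A j" using ij A'(1)[of i] A'(1)[of j] by (auto simp: A''_def)
          then show ?thesis using A(3) 1 ij by blast
        next
          case 2
          then have "x \<in> C" "y \<in> B" using ij A'(1)[of j] by (auto simp: A''_def)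
          then show ?thesis by (rule CA)
        next
          case 3
          then have "y \<in> C" "x \<in> B" using ij A'(1)[of i] by (auto simp: A''_def)
          then show ?thesis using CA adj_commute by metis
        qed
      qed
      ultimately show ?thesis by (intro exI[of _ A'']) blast
    qed
    then show ?thesis by blast
  qed
qed

text \<open>Neighbourhoods in a small complete \<open>p\<close>-partite graph classify the vertices.
  On average a vertex misses at most slightly more than \<open>L\<close> of its vertices, the size
  of one class; all but boundedly many vertices already miss \<open>L - b\<close> within one class,
  so only few can miss many vertices elsewhere. The rest splits into \<open>p\<close> parts, and
  \<open>blowup_free_cover\<close> makes each independent at bounded cost.\<close>

lemma blowup_free_independent_sets:
  fixes T :: "'b sgraph" and \<epsilon> :: real
  assumes T: "simple_graph T" and p: "p \<ge> 3" and \<epsilon>: "\<epsilon> > 0"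
    and \<chi>: "\<And>u v. {u, v} \<in> edges T \<Longrightarrow> \<chi> u \<noteq> (\<chi> v :: bool)"
  shows "\<exists>N. \<forall>G :: 'a sgraph. simple_graph G \<longrightarrow> N \<le> card (verts G) \<longrightarrow> turan_degrees p G \<longrightarrow>
    \<not> contains_copy G (edge_blowup T (p + 1)) \<longrightarrow>
    (\<exists>I. (\<forall>i<p. I i \<subseteq> verts G \<and> (\<forall>x\<in>I i. \<forall>y\<in>I i. \<not> adj G x y)) \<and>
      (\<forall>i<p. \<forall>j<p. i \<noteq> j \<longrightarrow> I i \<inter> I j = {}) \<and>
      real (card (verts G - (\<Union>i<p. I i))) \<le> \<epsilon> * card (verts G))"
proof -
  define b M where "b = card (verts (edge_blowup T (p + 1)))" and "M = card (edges T)"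
  \<comment> \<open>\<open>D\<close> is the tolerance for non-neighbours beyond the own class. By
    averaging, at most about \<open>b * n / D\<close> vertices exceed it, and this is at most half
    of \<open>\<epsilon> * n\<close>.\<close>
  obtain D :: nat where D: "D \<ge> 1" "2 * b \<le> D * \<epsilon>"
  proof -
    obtain D :: nat where "2 * b / \<epsilon> \<le> D" using real_arch_simple by blast
    then have "2 * b / \<epsilon> \<le> Suc D" by simp
    then have "2 * b \<le> Suc D * \<epsilon>" using \<epsilon> by (simp add: field_simps)
    then show thesis using that[of "Suc D"] by simp
  qed
  \<comment> \<open>After \<open>b\<close> vertices have each excluded at most \<open>D\<close>
    vertices of a class, \<open>b\<close> common neighbours must remain.\<close>
  define L where "L = b * D + b"
  obtain N where N: "\<And>G :: 'a sgraph. simple_graph G \<Longrightarrow> N \<le> card (verts G) \<Longrightarrow> turan_degrees p G \<Longrightarrow>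
      (\<exists>A. (\<forall>i<p. A i \<subseteq> verts G \<and> card (A i) = L) \<and>
      (\<forall>i<p. \<forall>j<p. i \<noteq> j \<longrightarrow> (\<forall>x\<in>A i. \<forall>y\<in>A j. adj G x y)))"
    using obtain_complete_multipartite[of p p L, where 'a = 'a] p by auto
  define K1 where "K1 = 2 ^ (p * L) * b"
  \<comment> \<open>Collects all losses that do not grow with \<open>n\<close>; the other half of
    \<open>\<epsilon> * n\<close> pays for them.\<close>
  define K2 where "K2 = K1 + p * L + K1 * L + p * (2 * M)"
  obtain N' :: nat where N': "2 * K2 / \<epsilon> \<le> N'" using real_arch_simple by blast
  have "\<exists>I. (\<forall>i<p. I i \<subseteq> verts G \<and> (\<forall>x\<in>I i. \<forall>y\<in>I i. \<not> adj G x y)) \<and>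
      (\<forall>i<p. \<forall>j<p. i \<noteq> j \<longrightarrow> I i \<inter> I j = {}) \<and>
      real (card (verts G - (\<Union>i<p. I i))) \<le> \<epsilon> * card (verts G)"
    if G: "simple_graph G" and large: "max N N' \<le> card (verts G)" and deg: "turan_degrees p G"
      and free: "\<not> contains_copy G (edge_blowup T (p + 1))" for G :: "'a sgraph"
  proof -
    define n where "n = card (verts G)"
    have fin: "finite (verts G)" using G by (simp add: simple_graph_def)
    obtain A where A: "\<And>i. i < p \<Longrightarrow> A i \<subseteq> verts G" "\<And>i. i < p \<Longrightarrow> card (A i) = L"
        "\<And>i j x y. i < p \<Longrightarrow> j < p \<Longrightarrow> i \<noteq> j \<Longrightarrow> x \<in> A i \<Longrightarrow> y \<in> A j \<Longrightarrow> adj G x y"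
      using N[OF G _ deg] large by (metis max.boundedE)
    have finA: "finite (A i)" if "i < p" for i using A(1)[OF that] fin finite_subset by blast
    define U where "U = (\<Union>i<p. A i)"
    have U: "U \<subseteq> verts G" using A by (auto simp: U_def)
    have finU: "finite U" using U fin finite_subset by blast
    have cU: "card U \<le> p * L" unfolding U_def using card_UN_le[of "{..<p}" A] A(2) by simp
    define a where "a v = card {u \<in> U. \<not> adj G v u}" for v
    define X where "X = {v \<in> verts G. \<forall>i<p. b \<le> card {u \<in> A i. adj G v u}}"
    \<comment> \<open>At most \<open>2 ^ (p * L)\<close> neighbourhoods in \<open>U\<close> are
      possible. If \<open>X\<close> were larger than \<open>K1\<close>, more than \<open>b\<close>
      of its vertices would share one, and they would be the last class of a complete
      \<open>(p + 1)\<close>-partite graph.\<close>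
    have X: "card X \<le> K1"
    proof (rule ccontr)
      assume "\<not> card X \<le> K1"
      then have "2 ^ (p * L) * b < card X" by (simp add: K1_def)
      moreover have "card (Pow U) \<le> 2 ^ (p * L)" using finU cU by (simp add: card_Pow)
      ultimately have "card (Pow U) * b < card X" by (meson le_less_trans mult_le_mono1)
      then obtain B where B: "B \<in> Pow U" "b < card {v \<in> X. {u \<in> U. adj G v u} = B}"
        using large_fibre[of X "Pow U" "\<lambda>v. {u \<in> U. adj G v u}" b] finU fin by (auto simp: X_def)
      define H where "H = {v \<in> X. {u \<in> U. adj G v u} = B}"
      have "H \<noteq> {}" using B(2) by (auto simp: H_def[symmetric])
      then obtain v where v: "v \<in> H" by blast
      have AB: "{u \<in> A i. adj G v u} = A i \<inter> B" if "i < p" for i using v that by (auto simp: H_def U_def)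
      have HB: "adj G x y" if "x \<in> H" "y \<in> B" for x y using that B(1) by (auto simp: H_def)
      have "contains_copy G (edge_blowup T (p + 1))"
      proof (rule contains_blowup_if_multipartite[where A = "\<lambda>c. if c < p then A c \<inter> B else H" and \<chi> = \<chi>, OF T G])
        show "card (verts (edge_blowup T (p + 1))) \<le> card (if c < p then A c \<inter> B else H)" if "c \<le> p" for c
        proof (cases "c < p")
          case True
          then have "b \<le> card {u \<in> A c. adj G v u}" using v by (auto simp: H_def X_def)
          then show ?thesis using AB[OF True] True by (simp add: b_def)
        next
          case False
          then show ?thesis using B(2) by (simp add: b_def H_def)
        qed
        show "adj G x y" if "c \<le> p" "c' \<le> p" "c \<noteq> c'" "x \<in> (if c < p then A c \<inter> B else H)"
          "y \<in> (if c' < p then A c' \<inter> B else H)" for c c' x y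
          using that HB A(3) adj_commute[of G x y] by (auto split: if_splits)
        show "\<chi> u \<noteq> \<chi> v" if "{u, v} \<in> edges T" for u v using that by (rule \<chi>)
      qed (use p A(1) in \<open>auto simp: H_def X_def\<close>)
      then show False using free by blast
    qed
    define Y where "Y = {v \<in> verts G - X. a v > L - b + D}"
    have bL: "b \<le> L" by (simp add: L_def)
    have "\<exists>i<p. card {u \<in> A i. adj G v u} < b" if "v \<in> verts G - X" for v
      using that by (auto simp: X_def not_le)
    then obtain \<iota> where \<iota>: "\<And>v. v \<in> verts G - X \<Longrightarrow> \<iota> v < p"
        "\<And>v. v \<in> verts G - X \<Longrightarrow> card {u \<in> A (\<iota> v). adj G v u} < b" by metis
    have own: "L - b \<le> card {u \<in> A (\<iota> v). \<not> adj G v u}" if "v \<in> verts G - X" for v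
    proof -
      have "{u \<in> A (\<iota> v). \<not> adj G v u} = A (\<iota> v) - {u \<in> A (\<iota> v). adj G v u}" by auto
      then have "card {u \<in> A (\<iota> v). \<not> adj G v u} = L - card {u \<in> A (\<iota> v). adj G v u}"
        using finA A(2) \<iota>(1)[OF that] by (simp add: card_Diff_subset)
      then show ?thesis using \<iota>(2)[OF that] by simp
    qed
    have aL: "L - b \<le> a v" if "v \<in> verts G - X" for v
    proof -
      have "card {u \<in> A (\<iota> v). \<not> adj G v u} \<le> a v"
        unfolding a_def using finU \<iota>(1)[OF that] by (intro card_mono) (auto simp: U_def)
      then show ?thesis using own[OF that] by simp
    qed
    have Y: "card Y * real D \<le> b * n + p * L + K1 * L"
    proof -
      have "card (verts G - X) * (real L - b) + card Y * real D
          = (\<Sum>v\<in>verts G - X. (real L - b) + (if v \<in> Y then real D else 0))"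
        using fin by (simp add: sum.distrib sum.If_cases Y_def Int_def conj_commute)
      also have "\<dots> \<le> (\<Sum>v\<in>verts G - X. real (a v))"
      proof (rule sum_mono)
        fix v assume v: "v \<in> verts G - X"
        have "real L - b + (if v \<in> Y then real D else 0) = real (L - b + (if v \<in> Y then D else 0))"
          using bL by (simp add: of_nat_diff)
        also have "\<dots> \<le> real (a v)" using aL[OF v] by (intro of_nat_mono) (auto simp: Y_def)
        finally show "real L - b + (if v \<in> Y then real D else 0) \<le> real (a v)" .
      qed
      also have "\<dots> \<le> (\<Sum>v\<in>verts G. real (a v))" using fin by (intro sum_mono2) auto
      also have "\<dots> \<le> real (p * L) * (n / p + 1)"
        unfolding a_def n_def by (rule sum_nonadjacent_le[OF fin deg U cU])
      also have "\<dots> = n * L + p * L" using p by (simp add: field_simps)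
      finally have 1: "card (verts G - X) * (real L - b) + card Y * real D \<le> n * L + p * L" .
      have "real (card (verts G - X)) = n - real (card X)"
        using fin card_mono[of "verts G" X] by (subst card_Diff_subset) (auto simp: X_def n_def of_nat_diff)
      with 1 have "(n - real (card X)) * (real L - b) + card Y * real D \<le> n * real L + real (p * L)" by simp
      moreover have "(n - real (card X)) * (real L - b) = n * real L - n * real b - card X * (real L - b)"
        by (simp add: algebra_simps)
      moreover have "card X * (real L - b) \<le> K1 * real L" using X bL by (intro mult_mono) auto
      ultimately have "card Y * real D \<le> n * real b + real (p * L) + K1 * real L" by argo
      then show ?thesis by (simp add: mult.commute)
    qed
    define V where "V i = {v \<in> verts G - X - Y. \<iota> v = i}" for i
    \<comment> \<open>At least \<open>L - b\<close> of the at most \<open>L - b + D\<close>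
      non-neighbours of \<open>v\<close> lie in its own class.\<close>
    have missV: "card {u \<in> A c. \<not> adj G v u} \<le> D" if v: "v \<in> V i" and c: "c < p" "c \<noteq> i" for v c i
    proof -
      have v': "v \<in> verts G - X" "\<iota> v = i" "i < p" "a v \<le> L - b + D" using v \<iota>(1) by (auto simp: V_def Y_def)
      have disj: "{u \<in> A c. \<not> adj G v u} \<inter> {u \<in> A i. \<not> adj G v u} = {}"
        using A(3)[of c i] c v' simple_graph_adjD(3)[OF G] by blast
      have "card {u \<in> A c. \<not> adj G v u} + card {u \<in> A i. \<not> adj G v u}
          = card ({u \<in> A c. \<not> adj G v u} \<union> {u \<in> A i. \<not> adj G v u})"
        using finA c v' disj by (intro card_Un_disjoint[symmetric]) auto
      also have "\<dots> \<le> a v" unfolding a_def using finU c v' by (intro card_mono) (auto simp: U_def)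
      finally show ?thesis using own[OF v'(1)] v' by simp
    qed
    have "\<exists>C \<subseteq> V i. finite C \<and> card C \<le> 2 * M \<and> (\<forall>x\<in>V i - C. \<forall>y\<in>V i - C. \<not> adj G x y)"
      if i: "i < p" for i
    proof (rule blowup_free_cover[where K = "{..<p} - {i}" and I = A and d = 0 and X = "V i", OF T G p free \<chi>])
      show "card ({..<p} - {i}) = p - 1" using i by simp
      show "A c \<subseteq> verts G" if "c \<in> {..<p} - {i}" for c using A that by auto
      show "card {z \<in> A c'. \<not> adj G y z} \<le> 0"
        if "c \<in> {..<p} - {i}" "c' \<in> {..<p} - {i}" "c \<noteq> c'" "y \<in> A c" for c c' y
      proof -
        have "{z \<in> A c'. \<not> adj G y z} = {}" using A(3)[of c c' y] that by auto
        then show ?thesis by (simp only: card.empty)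
      qed
      show "card (verts (edge_blowup T (p + 1))) * (0 + 1) \<le> card {y \<in> A c. \<forall>x\<in>B. adj G x y}"
        if c: "c \<in> {..<p} - {i}" and B: "B \<subseteq> V i" "card B \<le> card (verts (edge_blowup T (p + 1)))" for c B
      proof -
        have "finite B" using B(1) fin by (auto simp: V_def intro: finite_subset)
        then have "card (A c) \<le> card {y \<in> A c. \<forall>x\<in>B. adj G x y} + b * D"
          using B c missV[of _ i c] by (intro card_le_common_neighbours finA) (auto simp: b_def)
        then show ?thesis using A(2) c by (simp add: L_def b_def)
      qed
      show ?thesis if "C \<subseteq> V i" "finite C" "card C \<le> 2 * card (edges T)"
        "\<And>x y. x \<in> V i - C \<Longrightarrow> y \<in> V i - C \<Longrightarrow> \<not> adj G x y" for C
        using that unfolding M_def by blast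
    qed
    then obtain C where C: "\<And>i. i < p \<Longrightarrow> C i \<subseteq> V i" "\<And>i. i < p \<Longrightarrow> finite (C i)"
      "\<And>i. i < p \<Longrightarrow> card (C i) \<le> 2 * M"
      "\<And>i x y. i < p \<Longrightarrow> x \<in> V i - C i \<Longrightarrow> y \<in> V i - C i \<Longrightarrow> \<not> adj G x y" by metis
    define I where "I i = V i - C i" for i
    have "card (verts G - (\<Union>i<p. I i)) \<le> card (X \<union> Y \<union> (\<Union>i<p. C i))"
      using fin C(2) \<iota>(1) by (intro card_mono) (auto simp: I_def V_def X_def Y_def)
    also have "\<dots> \<le> card X + card Y + card (\<Union>i<p. C i)"
      by (meson add_right_mono card_Un_le order_trans)
    also have "card (\<Union>i<p. C i) \<le> (\<Sum>i<p. card (C i))" by (intro card_UN_le) simp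
    also have "\<dots> \<le> (\<Sum>i<p. 2 * M)" using C(3) by (intro sum_mono) simp
    finally have "card (verts G - (\<Union>i<p. I i)) \<le> card X + card Y + p * (2 * M)" by simp
    then have "real (card (verts G - (\<Union>i<p. I i))) \<le> real (card X + card Y + p * (2 * M))"
      by (rule of_nat_mono)
    then have 1: "real (card (verts G - (\<Union>i<p. I i))) \<le> K1 + real (card Y) + p * (2 * M)"
      using X by simp
    have "real (card Y) \<le> \<epsilon> / 2 * n + p * L + K1 * L"
    proof -
      have "real b * n \<le> (\<epsilon> / 2 * D) * n" using D(2) by (intro mult_right_mono) (auto simp: mult.commute)
      moreover have "real (p * L + K1 * L) * 1 \<le> real (p * L + K1 * L) * real D"
        using D(1) by (intro mult_left_mono) auto
      ultimately have "card Y * real D \<le> (\<epsilon> / 2 * n + p * L + K1 * L) * D"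
        using Y by (simp add: algebra_simps)
      then show ?thesis using D(1) by simp
    qed
    then have "real (card (verts G - (\<Union>i<p. I i))) \<le> \<epsilon> / 2 * n + K2"
      using 1 by (simp add: K2_def)
    moreover have "K2 \<le> \<epsilon> / 2 * n"
    proof -
      have "2 * K2 / \<epsilon> \<le> n" using N' large by (simp add: n_def)
      then show ?thesis using \<epsilon> by (simp add: field_simps)
    qed
    ultimately have "real (card (verts G - (\<Union>i<p. I i))) \<le> \<epsilon> * card (verts G)" by (simp add: n_def)
    moreover have "I i \<inter> I j = {}" if "i \<noteq> j" for i j using that by (auto simp: I_def V_def)
    moreover have "I i \<subseteq> verts G" for i by (auto simp: I_def V_def)
    moreover have "\<not> adj G x y" if "i < p" "x \<in> I i" "y \<in> I i" for i x y
      using C(4) that unfolding I_def by blast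
    ultimately show ?thesis by (intro exI[of _ I]) blast
  qed
  then show ?thesis by blast
qed

section \<open>Graphs close to a Turan graph\<close>

text \<open>The independent sets \<open>I 0, \<dots>, I (p - 1)\<close> miss at most \<open>E\<close> vertices of \<open>G\<close>; a vertex counts as full if
  it has at least \<open>Y\<close> neighbours in each of them. The forbidden graph will have \<open>b\<close> vertices.\<close>

locale near_turan =
  fixes G :: "'a sgraph" and p b :: nat and I :: "nat \<Rightarrow> 'a set" and E Y :: real
  assumes simple: "simple_graph G" and p: "p \<ge> 3" and pb: "p \<le> b" and deg: "turan_degrees p G"
    and I_sub: "\<And>i. i < p \<Longrightarrow> I i \<subseteq> verts G"
    and I_indep: "\<And>i x y. i < p \<Longrightarrow> x \<in> I i \<Longrightarrow> y \<in> I i \<Longrightarrow> \<not> adj G x y"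
    and I_disj: "\<And>i j. i < p \<Longrightarrow> j < p \<Longrightarrow> i \<noteq> j \<Longrightarrow> I i \<inter> I j = {}"
    and rest: "card (verts G - (\<Union>i<p. I i)) \<le> E"
    and E_large: "b + p + 1 \<le> E"
    and E_le: "16 * real b ^ 2 * E \<le> Y"
    and Y_le: "16 * real b ^ 4 * Y \<le> card (verts G)"
begin

abbreviation "n \<equiv> card (verts G)"
abbreviation "d \<equiv> nat \<lfloor>2 * E\<rfloor>"

definition nonadj :: "'a \<Rightarrow> nat \<Rightarrow> nat" where
  "nonadj v i = card {z \<in> I i. \<not> adj G v z}"

definition full :: "'a set" where
  "full = {v \<in> verts G. \<forall>i<p. Y \<le> card {z \<in> I i. adj G v z}}"

definition cls :: "'a \<Rightarrow> nat" where
  "cls v = (SOME i. i < p \<and> card {z \<in> I i. adj G v z} < Y)"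

section \<open>Comparison of the scales \<open>E\<close>, \<open>Y\<close> and
  \<open>n\<close>\<close>

lemma fin: "finite (verts G)"
  using simple by (simp add: simple_graph_def)

lemma finI: "i < p \<Longrightarrow> finite (I i)"
  using I_sub fin finite_subset by blast

lemma b_ge_3: "real b \<ge> 3"
  using p pb by simp

lemma E_ge_1: "E \<ge> 1"
  using E_large by simp

text \<open>This and the next inequalities form a chain from \<open>E\<close> over
  \<open>b * E\<close>, \<open>Y\<close> and \<open>b * Y\<close> up to \<open>n / p\<close>. Later
  estimates use the products as atoms, so that linear arithmetic decides them.\<close>

lemma b2E_le_Y: "real b * b * E \<le> Y / 16"
  using E_le by (simp add: power2_eq_square)

lemma pbE_le_Y: "real p * b * E \<le> Y / 16"
proof -
  have "real p * b * E \<le> real b * b * E" using pb E_ge_1 by (intro mult_right_mono) auto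
  then show ?thesis using b2E_le_Y by simp
qed

lemma bE_le_Y: "3 * (real b * E) \<le> Y / 16"
proof -
  have "3 * (real b * E) \<le> b * (b * E)" using b_ge_3 E_ge_1 by (intro mult_right_mono) auto
  then show ?thesis using b2E_le_Y by (simp add: mult.assoc)
qed

lemma E_le_Y: "9 * E \<le> Y / 16"
proof -
  have "3 * E \<le> b * E" using b_ge_3 E_ge_1 by (intro mult_right_mono) auto
  then show ?thesis using bE_le_Y by simp
qed

lemma Y_nonneg: "Y \<ge> 0"
  using E_le_Y E_ge_1 by simp

lemma b3Y_le_part: "16 * (real b ^ 3 * Y) \<le> n / p"
proof -
  have "16 * (real b ^ 3 * Y) * p \<le> 16 * (real b ^ 3 * Y) * b"
    using pb Y_nonneg by (intro mult_left_mono) auto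
  also have "\<dots> = 16 * real b ^ 4 * Y" by (simp add: power_numeral_reduce)
  also have "\<dots> \<le> n" by (rule Y_le)
  finally show ?thesis using p by (simp add: field_simps)
qed

lemma b2Y_le_b3Y: "3 * (real b ^ 2 * Y) \<le> real b ^ 3 * Y"
proof -
  have "3 * (real b ^ 2 * Y) \<le> b * (real b ^ 2 * Y)" using b_ge_3 Y_nonneg by (intro mult_right_mono) auto
  then show ?thesis by (simp add: power_numeral_reduce)
qed

lemma bY_le_b2Y: "3 * (real b * Y) \<le> real b ^ 2 * Y"
proof -
  have "3 * (real b * Y) \<le> b * (real b * Y)" using b_ge_3 Y_nonneg by (intro mult_right_mono) auto
  then show ?thesis by (simp add: power_numeral_reduce)
qed

lemma Y_le_bY: "3 * Y \<le> real b * Y"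
  using b_ge_3 Y_nonneg by (intro mult_right_mono) auto

text \<open>\<open>b * (d + 1)\<close> is the number of candidates that the greedy embedding
  demands; \<open>d + 1 \<le> 2 * E + 1 \<le> 3 * E\<close>.\<close>

lemma threshold_le: "real (b * (d + 1)) \<le> 3 * (real b * E)"
proof -
  have "real d + 1 \<le> 3 * E" using E_ge_1 of_nat_floor[of "2 * E"] by linarith
  then have "real b * (real d + 1) \<le> real b * (3 * E)" by (intro mult_left_mono) auto
  moreover have "real (b * (d + 1)) = real b * (real d + 1)" by (simp only: of_nat_mult of_nat_add of_nat_1)
  moreover have "real b * (3 * E) = 3 * (real b * E)" by simp
  ultimately show ?thesis by linarith
qed

lemma threshold_leI: "3 * (real b * E) \<le> card A \<Longrightarrow> b * (d + 1) \<le> card A"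
  using order_trans[OF threshold_le, of "real (card A)"] by (simp only: of_nat_le_iff)

section \<open>Class sizes and non-neighbours\<close>

lemma sum_nonadj:
  assumes "v \<in> verts G" "S \<subseteq> {..<p}"
  shows "(\<Sum>i\<in>S. real (nonadj v i)) \<le> n / p + 1"
proof -
  have finS: "finite S" using assms(2) finite_subset by blast
  have "(\<Sum>i\<in>S. nonadj v i) = card (\<Union>i\<in>S. {z \<in> I i. \<not> adj G v z})"
    unfolding nonadj_def
  proof (rule card_UN_disjoint[symmetric, OF finS])
    show "\<forall>i\<in>S. finite {z \<in> I i. \<not> adj G v z}" using finI assms(2) by auto
    show "\<forall>i\<in>S. \<forall>j\<in>S. i \<noteq> j \<longrightarrow> {z \<in> I i. \<not> adj G v z} \<inter> {z \<in> I j. \<not> adj G v z} = {}"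
    proof (intro ballI impI)
      fix i j assume "i \<in> S" "j \<in> S" "i \<noteq> j"
      then have "I i \<inter> I j = {}" using assms(2) by (intro I_disj) auto
      then show "{z \<in> I i. \<not> adj G v z} \<inter> {z \<in> I j. \<not> adj G v z} = {}" by blast
    qed
  qed
  also have "\<dots> \<le> card {u \<in> verts G. \<not> adj G v u}"
    using I_sub fin assms(2) by (intro card_mono) auto
  finally have "(\<Sum>i\<in>S. real (nonadj v i)) \<le> card {u \<in> verts G. \<not> adj G v u}"
    by (simp flip: of_nat_sum)
  also have "\<dots> \<le> n / p + 1" using deg assms(1) by (simp add: turan_degrees_def)
  finally show ?thesis .
qed

lemma nonadj_pair:
  assumes "v \<in> verts G" "i < p" "j < p" "i \<noteq> j"
  shows "nonadj v i + real (nonadj v j) \<le> n / p + 1"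
  using sum_nonadj[OF assms(1), of "{i, j}"] assms by simp

text \<open>A vertex of \<open>I i\<close> misses all of \<open>I i\<close>, so the degree bound
  limits the class.\<close>

lemma card_I_le: "i < p \<Longrightarrow> card (I i) \<le> n / p + 1"
proof (cases "I i = {}")
  case False
  assume i: "i < p"
  then obtain v where v: "v \<in> I i" using False by blast
  have "{z \<in> I i. \<not> adj G v z} = I i" using v I_indep i by blast
  then have "real (card (I i)) = nonadj v i" by (simp add: nonadj_def)
  then show ?thesis using sum_nonadj[of v "{i}"] v I_sub i by auto
qed simp

lemma sum_card_I: "(\<Sum>i<p. real (card (I i))) \<ge> n - E"
proof -
  have "(\<Sum>i<p. card (I i)) = card (\<Union>i<p. I i)"
    using finI I_disj by (subst card_UN_disjoint) auto
  moreover have "n = card (verts G - (\<Union>i<p. I i)) + card (\<Union>i<p. I i)"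
  proof -
    have "(\<Union>i<p. I i) \<subseteq> verts G" using I_sub by blast
    then show ?thesis
      using fin card_mono[of "verts G" "\<Union>i<p. I i"] finite_subset[of "\<Union>i<p. I i" "verts G"]
      by (simp add: card_Diff_subset)
  qed
  ultimately show ?thesis using rest by (simp flip: of_nat_sum)
qed

text \<open>The other \<open>p - 1\<close> classes have at most \<open>n / p + 1\<close> vertices
  each; the second \<open>E\<close> absorbs the \<open>p - 1\<close> units.\<close>

lemma card_I_ge:
  assumes i: "i < p" shows "n / p - 2 * E \<le> card (I i)"
proof -
  have "(\<Sum>j<p. real (card (I j))) = card (I i) + (\<Sum>j\<in>{..<p} - {i}. real (card (I j)))"
    using i by (subst sum.remove[of _ i]) auto
  also have "(\<Sum>j\<in>{..<p} - {i}. real (card (I j))) \<le> (\<Sum>j\<in>{..<p} - {i}. n / p + 1)"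
    using card_I_le by (intro sum_mono) auto
  also have "\<dots> = (real p - 1) * (n / p + 1)" using i by (simp add: of_nat_diff)
  also have "\<dots> = n - n / p + p - 1" using p by (simp add: field_simps)
  finally show ?thesis using sum_card_I E_large by linarith
qed

text \<open>\<open>x\<close> already misses its own class, which has at least
  \<open>n / p - E - (p - 1)\<close> vertices; the degree bound leaves at most \<open>E + p\<close>
  for any other class.\<close>

lemma nonadj_I:
  assumes "x \<in> I c" "c < p" "c' < p" "c \<noteq> c'"
  shows "nonadj x c' \<le> 2 * E" "card {z \<in> I c'. \<not> adj G x z} \<le> d"
proof -
  have "{z \<in> I c. \<not> adj G x z} = I c" using assms I_indep by blast
  then have "nonadj x c = card (I c)" by (simp add: nonadj_def)
  moreover have "(\<Sum>j\<in>{..<p} - {c}. real (card (I j))) \<le> (\<Sum>j\<in>{..<p} - {c}. n / p + 1)"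
    using card_I_le by (intro sum_mono) auto
  moreover have "(\<Sum>j\<in>{..<p} - {c}. n / p + 1) = n - n / p + p - 1"
    using assms p by (simp add: of_nat_diff field_simps)
  moreover have "(\<Sum>j<p. real (card (I j))) = card (I c) + (\<Sum>j\<in>{..<p} - {c}. real (card (I j)))"
    using assms by (subst sum.remove[of _ c]) auto
  moreover have "nonadj x c + real (nonadj x c') \<le> n / p + 1"
    using nonadj_pair assms I_sub by blast
  ultimately show "nonadj x c' \<le> 2 * E" using sum_card_I E_large by linarith
  then show "card {z \<in> I c'. \<not> adj G x z} \<le> d" by (simp add: nonadj_def le_nat_floor)
qed

lemma card_I_split: "i < p \<Longrightarrow> card (I i) = card {z \<in> I i. adj G v z} + nonadj v i"
  unfolding nonadj_def using finI
  by (subst card_Un_disjoint[symmetric]) (auto intro: arg_cong[of _ _ card])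

text \<open>Together the vertices of \<open>B\<close> miss at most \<open>5 * b^3 * Y\<close>
  vertices of a class of about \<open>n / p \<ge> 16 * b^3 * Y\<close>. The bound per vertex is what
  full vertices turn out to satisfy once there are \<open>k\<close> of them:
  \<open>4 * b^2 * Y\<close> from counting edges, plus slack.\<close>

lemma common_nbrs:
  assumes c: "c < p" and B: "finite B" "card B \<le> b" "\<And>x. x \<in> B \<Longrightarrow> nonadj x c \<le> 5 * (real b ^ 2 * Y)"
  shows "b * (d + 1) \<le> card {z \<in> I c. \<forall>x\<in>B. adj G x z}"
proof (rule threshold_leI)
  have "card (I c) \<le> card {z \<in> I c. \<forall>x\<in>B. adj G x z} + b * nat \<lfloor>5 * (real b ^ 2 * Y)\<rfloor>"
    using B finI[OF c] by (intro card_le_common_neighbours) (auto simp: nonadj_def le_nat_floor)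
  then have "real (card (I c)) \<le> real (card {z \<in> I c. \<forall>x\<in>B. adj G x z} + b * nat \<lfloor>5 * (real b ^ 2 * Y)\<rfloor>)"
    by (rule of_nat_mono)
  also have "\<dots> = card {z \<in> I c. \<forall>x\<in>B. adj G x z} + real b * real (nat \<lfloor>5 * (real b ^ 2 * Y)\<rfloor>)" by simp
  also have "real b * real (nat \<lfloor>5 * (real b ^ 2 * Y)\<rfloor>) \<le> real b * (5 * (real b ^ 2 * Y))"
    using Y_nonneg by (intro mult_left_mono of_nat_floor) auto
  also have "\<dots> = 5 * (real b ^ 3 * Y)" by (simp add: power_numeral_reduce)
  finally show "3 * (real b * E) \<le> card {z \<in> I c. \<forall>x\<in>B. adj G x z}"
    using card_I_ge[OF c] b3Y_le_part bE_le_Y E_le_Y b2Y_le_b3Y bY_le_b2Y Y_le_bY Y_nonneg by linarith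
qed

section \<open>Common neighbours of two and three vertices\<close>

definition common :: "'a \<Rightarrow> 'a \<Rightarrow> nat \<Rightarrow> nat" where
  "common u v c = card {z \<in> I c. adj G u z \<and> adj G v z}"

lemma common_commute: "common u v c = common v u c"
  by (simp add: common_def conj_commute)

lemma p_threshold_le: "p * (3 * (real b * E)) \<le> 3 * Y / 16"
  using pbE_le_Y by (simp add: mult.assoc mult.left_commute)

lemma n_bounds: "n / p \<le> n / 3" "48 * Y \<le> n"
proof -
  show "n / p \<le> n / 3" using p by (intro divide_left_mono) auto
  then show "48 * Y \<le> n" using b3Y_le_part b2Y_le_b3Y bY_le_b2Y Y_le_bY Y_nonneg by linarith
qed

text \<open>Two vertices together miss at most \<open>2 * (n / p + 1)\<close> vertices, which for
  \<open>p \<ge> 3\<close> is well below \<open>n - E\<close>; so they cannot have few common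
  neighbours in all classes at once.\<close>

lemma pair_common:
  assumes "x \<in> verts G" "y \<in> verts G"
  obtains c where "c < p" "3 * (real b * E) \<le> common x y c"
proof (rule ccontr)
  assume "\<not> thesis"
  then have lt: "\<And>c. c < p \<Longrightarrow> common x y c < 3 * (real b * E)" using that by force
  have "real (card (I c)) \<le> common x y c + real (nonadj x c) + nonadj y c" if c: "c < p" for c
  proof -
    have "card (I c) \<le> card ({z \<in> I c. adj G x z \<and> adj G y z} \<union> {z \<in> I c. \<not> adj G x z} \<union> {z \<in> I c. \<not> adj G y z})"
      using finI[OF c] by (intro card_mono) auto
    also have "\<dots> \<le> common x y c + nonadj x c + nonadj y c"
      unfolding common_def nonadj_def by (meson add_right_mono card_Un_le order_trans)
    finally show ?thesis by linarith
  qed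
  then have "(\<Sum>c<p. real (card (I c))) \<le> (\<Sum>c<p. 3 * (real b * E) + real (nonadj x c) + nonadj y c)"
    using lt by (intro sum_mono) (smt (verit) lessThan_iff)
  also have "\<dots> = p * (3 * (real b * E)) + (\<Sum>c<p. real (nonadj x c)) + (\<Sum>c<p. real (nonadj y c))"
    by (simp add: sum.distrib)
  finally show False
    using sum_card_I p_threshold_le sum_nonadj[OF assms(1) order_refl] sum_nonadj[OF assms(2) order_refl]
      n_bounds E_le_Y E_ge_1 by argo
qed

text \<open>A vertex of \<open>I c\<close> adjacent to 0, 1, 2 or 3 of \<open>x\<close>,
  \<open>y\<close>, \<open>z\<close> contributes 3, 2, 3 or 6 to the right-hand side, always at
  least 2.\<close>

lemma triple_count:
  assumes "c < p"
  shows "2 * real (card (I c)) \<le> real (nonadj x c) + nonadj y c + nonadj z c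
      + 2 * (real (common x y c) + common y z c + common x z c)"
proof -
  have card_if: "card {a \<in> I c. Q a} = (\<Sum>a\<in>I c. if Q a then 1 else 0)" for Q
    using finI[OF assms] by (simp add: sum.If_cases Int_def)
  have "2 * card (I c) = (\<Sum>a\<in>I c. 2)" by simp
  also have "\<dots> \<le> (\<Sum>a\<in>I c. (if \<not> adj G x a then 1 else 0) + (if \<not> adj G y a then 1 else 0)
      + (if \<not> adj G z a then 1 else 0) + 2 * ((if adj G x a \<and> adj G y a then 1 else 0)
      + (if adj G y a \<and> adj G z a then 1 else 0) + (if adj G x a \<and> adj G z a then 1 else 0)))"
    by (intro sum_mono) auto
  also have "\<dots> = nonadj x c + nonadj y c + nonadj z c + 2 * (common x y c + common y z c + common x z c)"
    unfolding nonadj_def common_def card_if by (simp only: sum.distrib sum_distrib_left[symmetric])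
  finally have "real (2 * card (I c)) \<le> real (nonadj x c + nonadj y c + nonadj z c
      + 2 * (common x y c + common y z c + common x z c))" by (rule of_nat_mono)
  then show ?thesis by simp
qed

text \<open>If no ordering works, then all pairs have their common neighbours in one and the same class.
  Outside that class, two of the three neighbourhoods miss almost every vertex, so the three vertices
  together have about \<open>2(1 - 1/p)n\<close> non-neighbours, more than the \<open>3n/p\<close> allowed.\<close>

lemma triple_common:
  assumes "x \<in> verts G" "y \<in> verts G" "z \<in> verts G"
  obtains x' y' z' c c' where "{x', y', z'} = {x, y, z}" "c < p" "c' < p" "c \<noteq> c'"
    "3 * (real b * E) \<le> common x' y' c" "3 * (real b * E) \<le> common y' z' c'"
proof (rule ccontr)
  assume "\<not> thesis"
  then have no: "\<And>x' y' z' c c'. {x', y', z'} = {x, y, z} \<Longrightarrow> c < p \<Longrightarrow> c' < p \<Longrightarrow> c \<noteq> c' \<Longrightarrow>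
      \<not> (3 * (real b * E) \<le> common x' y' c \<and> 3 * (real b * E) \<le> common y' z' c')"
    using that by metis
  obtain c where c: "c < p" "3 * (real b * E) \<le> common x y c" using pair_common[OF assms(1,2)] .
  obtain c' where c': "c' < p" "3 * (real b * E) \<le> common y z c'" using pair_common[OF assms(2,3)] .
  have cc: "c' = c" using no[of x y z c c'] c c' by auto
  have lt: "common y z e < 3 * (real b * E)" "common x z e < 3 * (real b * E)" "common x y e < 3 * (real b * E)"
    if "e < p" "e \<noteq> c" for e
    using no[of x y z c e] no[of y x z c e] no[of x y z e c] c c' cc that common_commute[of y x]
    by (auto simp: insert_commute not_le)
  have "2 * (\<Sum>e\<in>{..<p} - {c}. real (card (I e))) = (\<Sum>e\<in>{..<p} - {c}. 2 * real (card (I e)))"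
    by (simp add: sum_distrib_left)
  also have "\<dots> \<le> (\<Sum>e\<in>{..<p} - {c}. real (nonadj x e) + nonadj y e + nonadj z e + 6 * (3 * (real b * E)))"
  proof (rule sum_mono)
    fix e assume "e \<in> {..<p} - {c}"
    then show "2 * real (card (I e)) \<le> real (nonadj x e) + nonadj y e + nonadj z e + 6 * (3 * (real b * E))"
      using triple_count[of e x y z] lt[of e] by auto
  qed
  also have "\<dots> = (\<Sum>e\<in>{..<p} - {c}. real (nonadj x e)) + (\<Sum>e\<in>{..<p} - {c}. real (nonadj y e))
      + (\<Sum>e\<in>{..<p} - {c}. real (nonadj z e)) + (real p - 1) * (6 * (3 * (real b * E)))"
    using c(1) by (simp add: sum.distrib of_nat_diff)
  also have "\<dots> \<le> (n / p + 1) + (n / p + 1) + (n / p + 1) + p * (6 * (3 * (real b * E)))"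
    using assms E_ge_1 by (intro add_mono sum_nonadj mult_right_mono) auto
  finally have 1: "2 * (\<Sum>e\<in>{..<p} - {c}. real (card (I e))) \<le> 3 * (n / p + 1) + 6 * (p * (3 * (real b * E)))"
    by simp
  have "(\<Sum>j<p. real (card (I j))) = card (I c) + (\<Sum>j\<in>{..<p} - {c}. real (card (I j)))"
    using c by (subst sum.remove[of _ c]) auto
  then have 2: "(\<Sum>j\<in>{..<p} - {c}. real (card (I j))) \<ge> n - E - n / p - 1"
    using sum_card_I card_I_le[OF c(1)] by linarith
  show False using 1 2 p_threshold_le n_bounds E_le_Y E_ge_1 by argo
qed

section \<open>Full vertices and the parts of the others\<close>

lemma full_sub: "full \<subseteq> verts G"
  by (auto simp: full_def)

lemma cls:
  assumes "v \<in> verts G - full"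
  shows "cls v < p" "card {z \<in> I (cls v). adj G v z} < Y"
proof -
  have "\<exists>i. i < p \<and> card {z \<in> I i. adj G v z} < Y" using assms by (auto simp: full_def not_le)
  then have "cls v < p \<and> card {z \<in> I (cls v). adj G v z} < Y"
    unfolding cls_def by (rule someI_ex)
  then show "cls v < p" "card {z \<in> I (cls v). adj G v z} < Y" by auto
qed

text \<open>\<open>v\<close> misses all but fewer than \<open>Y\<close> vertices of
  \<open>I (cls v)\<close>, which nearly exhausts the degree bound \<open>n / p + 1\<close>.\<close>

lemma nonadj_cls:
  assumes v: "v \<in> verts G - full" and j: "j < p" "j \<noteq> cls v"
  shows "nonadj v j \<le> 2 * Y"
proof -
  have "nonadj v (cls v) + real (nonadj v j) \<le> n / p + 1"
    using nonadj_pair[of v "cls v" j] v cls j by auto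
  moreover have "real (card (I (cls v))) = card {z \<in> I (cls v). adj G v z} + real (nonadj v (cls v))"
    using card_I_split[OF cls(1)[OF v], of v] by simp
  ultimately show ?thesis
    using cls(2)[OF v] card_I_ge[OF cls(1)[OF v]] E_le_Y E_ge_1 by linarith
qed

text \<open>A vertex of \<open>I i\<close> is joined to almost all of every other class, so only
  \<open>I i\<close> itself can be the class with few neighbours.\<close>

lemma cls_I:
  assumes v: "v \<in> verts G - full" "v \<in> I i" "i < p" shows "cls v = i"
proof (rule ccontr)
  assume ne: "cls v \<noteq> i"
  have "real (card (I (cls v))) = card {z \<in> I (cls v). adj G v z} + real (nonadj v (cls v))"
    using card_I_split[OF cls(1)[OF v(1)], of v] by simp
  moreover have "nonadj v (cls v) \<le> 2 * E" using nonadj_I(1)[of v i "cls v"] v ne cls(1) by auto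
  ultimately show False
    using cls(2)[OF v(1)] card_I_ge[OF cls(1)[OF v(1)]] b3Y_le_part b2Y_le_b3Y bY_le_b2Y Y_le_bY Y_nonneg E_le_Y E_ge_1 by linarith
qed

text \<open>Unlike the sets \<open>I\<close>, the parts and \<open>full\<close> together cover all
  vertices, which exact edge counting needs; the price is that a part may contain edges.\<close>

definition part :: "nat \<Rightarrow> 'a set" where
  "part i = {v \<in> verts G - full. cls v = i}"

lemma card_nbrs_part:
  assumes v: "v \<in> part i" shows "card {z \<in> part i. adj G v z} \<le> Y + E"
proof -
  have v': "v \<in> verts G - full" "i = cls v" "i < p" using v cls(1) by (auto simp: part_def)
  have "{z \<in> part i. adj G v z} \<subseteq> {z \<in> I i. adj G v z} \<union> (verts G - (\<Union>i<p. I i))"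
    using cls_I by (auto simp: part_def)
  then have "card {z \<in> part i. adj G v z} \<le> card ({z \<in> I i. adj G v z} \<union> (verts G - (\<Union>i<p. I i)))"
    using fin finI v' by (intro card_mono) auto
  also have "\<dots> \<le> card {z \<in> I i. adj G v z} + card (verts G - (\<Union>i<p. I i))" by (rule card_Un_le)
  finally show ?thesis using cls(2)[OF v'(1)] rest v'(2) by simp
qed

lemma card_full_le:
  assumes k: "k \<ge> 2" and b: "b = card (verts (edge_blowup (double_broom (2 * k) s t) (p + 1)))"
    and free: "\<not> contains_copy G (edge_blowup (double_broom (2 * k) s t) (p + 1))"
  shows "card full \<le> k"
proof (rule ccontr)
  assume "\<not> card full \<le> k"
  then have kf: "k + 1 \<le> card full" by simp
  then have "3 \<le> card full" using k by simp
  then obtain S where S: "S \<subseteq> full" "card S = 3" by (meson obtain_subset_with_card_n)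
  then obtain x y z where xyz: "S = {x, y, z}" unfolding card_3_iff by blast
  have mem: "x \<in> verts G" "y \<in> verts G" "z \<in> verts G" using S(1) xyz full_sub by auto
  obtain x' y' z' c c' where x': "{x', y', z'} = {x, y, z}" "c < p" "c' < p" "c \<noteq> c'"
    "3 * (real b * E) \<le> common x' y' c" "3 * (real b * E) \<le> common y' z' c'"
    using triple_common[OF mem] .
  have S': "S = {x', y', z'}" using x' xyz by simp
  have dist: "x' \<noteq> y'" "y' \<noteq> z'" "x' \<noteq> z'"
    using S(2) unfolding S' by (auto simp: card_insert_if split: if_splits)
  have "finite full" using full_sub fin finite_subset by blast
  then have "k - 2 \<le> card (full - S)" using kf S by (subst card_Diff_subset) (auto intro: finite_subset)
  then obtain R where R: "R \<subseteq> full - S" "card R = k - 2" by (meson obtain_subset_with_card_n)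
  have "finite R" using R(1) \<open>finite full\<close> finite_subset by blast
  then obtain g where g: "bij_betw g {3..k} R"
    using finite_same_card_bij[of "{3..k}" R] R(2) k by auto
  \<comment> \<open>The middle vertex \<open>y'\<close> of the ordered triple gets index 1, the
    place in the clique on \<open>{1, 2}\<close>; \<open>x'\<close> and \<open>z'\<close> take the
    path vertices 0 and 3. Then the path vertices 1 and 2 go to the different classes
    \<open>c\<close> and \<open>c'\<close>. For the other full vertices any order works, by
    \<open>pair_common\<close>.\<close>
  define w where "w j = (if j = 0 then x' else if j = 1 then y' else if j = 2 then z' else g j)" for j :: nat
  have gR: "g j \<in> R" if "j \<in> {3..k}" for j using g that bij_betwE by blast
  have w_full: "w j \<in> full" if "j \<le> k" for j
    using gR[of j] that S R(1) S' by (auto simp: w_def)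
  have winj: "inj_on w {..k}"
  proof (rule inj_onI)
    fix i j assume ij: "i \<in> {..k}" "j \<in> {..k}" "w i = w j"
    have cases: "j = 0 \<or> j = 1 \<or> j = 2 \<or> j \<in> {3..k} \<and> w j = g j" if "j \<le> k" for j
      using that by (auto simp: w_def)
    have gS: "g j \<notin> {x', y', z'}" if "j \<in> {3..k}" for j using gR[OF that] R(1) S' by auto
    have w012: "w 0 = x'" "w 1 = y'" "w 2 = z'" by (auto simp: w_def)
    have ginj: "i = j" if "i \<in> {3..k}" "j \<in> {3..k}" "g i = g j"
      using that g by (auto simp: bij_betw_def inj_on_def)
    show "i = j"
      using cases[of i] cases[of j] ij gS[of i] gS[of j] w012 ginj dist by (auto simp del: One_nat_def)
  qed
  have one: "b * (d + 1) \<le> card {z \<in> I c. adj G (w j) z}" if "j \<le> k" "c < p" for j c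
  proof (rule threshold_leI)
    have "Y \<le> card {z \<in> I c. adj G (w j) z}" using w_full[OF that(1)] that(2) by (simp add: full_def)
    then show "3 * (real b * E) \<le> card {z \<in> I c. adj G (w j) z}" using bE_le_Y Y_nonneg by linarith
  qed
  have k2: "1 \<le> k" "2 \<le> k" using k by auto
  have "contains_copy G (edge_blowup (double_broom (2 * k) s t) (p + 1))"
  proof (rule broom_blowup_embedding[where k = k and p = p and s = s and t = t and w = w and I = I and q = 1 and y = x' and L = "{..<p}"
        and ?c1.0 = c and ?c2.0 = c' and d = d, folded b, OF k p simple winj])
    show "w ` {..k} \<subseteq> verts G" using w_full full_sub by auto
    show "b * (d + 1) \<le> card {z \<in> I c. adj G (w 0) z \<and> adj G (w 1) z \<and> ((1::nat) = 2 \<longrightarrow> adj G x' z)}"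
      using threshold_leI[of "{z \<in> I c. adj G x' z \<and> adj G y' z}"] x'(5) by (simp add: w_def common_def)
    show "b * (d + 1) \<le> card {z \<in> I c'. adj G (w 1) z \<and> adj G (w 2) z \<and> ((1::nat) = 2 \<longrightarrow> adj G x' z)}"
      using threshold_leI[of "{z \<in> I c'. adj G y' z \<and> adj G z' z}"] x'(6) by (simp add: w_def common_def)
    show "\<exists>c<p. b * (d + 1) \<le> card {z \<in> I c. adj G (w j) z \<and> adj G (w (j + 1)) z}"
      if "2 \<le> j" "j < k" for j
    proof -
      have "w j \<in> verts G" "w (j + 1) \<in> verts G"
        using w_full[of j] w_full[of "j + 1"] that full_sub by auto
      from pair_common[OF this] obtain e where "e < p" "3 * (real b * E) \<le> common (w j) (w (j + 1)) e" .
      then show ?thesis using threshold_leI unfolding common_def by blast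
    qed
    show "b * (d + 1) \<le> card {z \<in> I c. adj G (w 1) z \<and> ((1::nat) = 2 \<longrightarrow> adj G x' z)}" if "c \<in> {..<p}" for c
      using one[OF k2(1), of c] that by simp
  qed (use one x'(2,3,4) I_sub nonadj_I(2) in auto)
  then show False using free by blast
qed

text \<open>The comparison is with the ideal graph \<open>J\<close>, the join of \<open>full\<close>
  with the complete multipartite graph of the parts. First the edges of \<open>G\<close> outside
  \<open>J\<close> are only bounded by \<open>4 * b^2 * Y\<close>. This suffices to find
  \<open>k\<close> full vertices and to make them almost complete to the classes, and these in turn
  exclude any edge outside \<open>J\<close>.\<close>

lemma iso_H_graph:
  assumes k: "k \<ge> 2" and b: "b = card (verts (edge_blowup (double_broom (2 * k) s t) (p + 1)))"
    and free: "\<not> contains_copy G (edge_blowup (double_broom (2 * k) s t) (p + 1))"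
    and M: "card (edges (double_broom (2 * k) s t)) \<le> b" and kb: "k \<le> b"
    and many: "h_num n p (k + 1) \<le> card (edges G)"
  shows "graph_iso G (H_graph n p (k + 1))"
proof -
  define T where "T = double_broom (2 * k) s t"
  have T: "simple_graph T" using k by (simp add: T_def simple_graph_double_broom)
  have "\<exists>C \<subseteq> part i. finite C \<and> card C \<le> 2 * card (edges T) \<and> (\<forall>x\<in>part i - C. \<forall>y\<in>part i - C. \<not> adj G x y)"
    if i: "i < p" for i
  proof (rule blowup_free_cover[where K = "{..<p} - {i}" and I = I and d = d and X = "part i"
        and \<chi> = "broom_side k s", OF T simple p free[folded T_def]])
    show "card ({..<p} - {i}) = p - 1" using i by simp
    show "broom_side k s u \<noteq> broom_side k s v" if "{u, v} \<in> edges T" for u v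
      using broom_side_proper that k by (auto simp: T_def)
    show "card (verts (edge_blowup T (p + 1))) * (d + 1) \<le> card {y \<in> I c. \<forall>x\<in>B. adj G x y}"
      if c: "c \<in> {..<p} - {i}" and B: "B \<subseteq> part i" "card B \<le> card (verts (edge_blowup T (p + 1)))" for c B
      unfolding T_def b[symmetric]
    proof (rule common_nbrs)
      show "finite B" using B(1) fin by (auto simp: part_def intro: finite_subset)
      show "nonadj x c \<le> 5 * (real b ^ 2 * Y)" if "x \<in> B" for x
        using nonadj_cls[of x c] that B(1) c bY_le_b2Y Y_le_bY Y_nonneg by (force simp: part_def)
    qed (use c B in \<open>auto simp: b T_def\<close>)
    show ?thesis if "C \<subseteq> part i" "finite C" "card C \<le> 2 * card (edges T)"
      "\<And>x y. x \<in> part i - C \<Longrightarrow> y \<in> part i - C \<Longrightarrow> \<not> adj G x y" for C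
      using that by blast
  qed (use I_sub nonadj_I(2) in auto)
  then obtain C where C: "\<And>i. i < p \<Longrightarrow> C i \<subseteq> part i" "\<And>i. i < p \<Longrightarrow> finite (C i)"
    "\<And>i. i < p \<Longrightarrow> card (C i) \<le> 2 * card (edges T)"
    "\<And>i x y. i < p \<Longrightarrow> x \<in> part i - C i \<Longrightarrow> y \<in> part i - C i \<Longrightarrow> \<not> adj G x y" by metis
  define inner where "inner i = {e \<in> edges G. e \<subseteq> part i}" for i
  \<comment> \<open>Every edge inside a part meets its cover \<open>C i\<close> of at most
    \<open>2 * b\<close> vertices, and each of these has at most \<open>Y + E \<le> 2 * Y\<close>
    neighbours in the part.\<close>
  have inner: "real (card (inner i)) \<le> 4 * (b * Y)" if i: "i < p" for i
  proof -
    have "inner i \<subseteq> (\<Union>x\<in>C i. (\<lambda>z. {x, z}) ` {z \<in> part i. adj G x z})"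
    proof
      fix e assume "e \<in> inner i"
      then have "e \<in> edges G" "e \<subseteq> part i" by (auto simp: inner_def)
      then obtain x z where e: "e = {x, z}" "adj G x z" "x \<in> part i" "z \<in> part i"
        using simple_graph_edgeE[OF simple] by (metis insert_subset)
      then have "x \<in> C i \<or> z \<in> C i" using C(4)[OF i] by blast
      then show "e \<in> (\<Union>x\<in>C i. (\<lambda>z. {x, z}) ` {z \<in> part i. adj G x z})"
      proof
        assume "x \<in> C i" then show ?thesis using e by blast
      next
        assume z: "z \<in> C i"
        have "e = {z, x}" "adj G z x" using e adj_commute[of G x z] by auto
        then show ?thesis using z e(3) by blast
      qed
    qed
    moreover have "finite (part i)" using fin by (auto simp: part_def)
    ultimately have "card (inner i) \<le> card (\<Union>x\<in>C i. (\<lambda>z. {x, z}) ` {z \<in> part i. adj G x z})"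
      using C(2)[OF i] by (intro card_mono) auto
    also have "\<dots> \<le> (\<Sum>x\<in>C i. card ((\<lambda>z. {x, z}) ` {z \<in> part i. adj G x z}))"
      using C(2)[OF i] by (rule card_UN_le)
    also have "\<dots> \<le> (\<Sum>x\<in>C i. card {z \<in> part i. adj G x z})"
      using \<open>finite (part i)\<close> by (intro sum_mono card_image_le) auto
    finally have "real (card (inner i)) \<le> (\<Sum>x\<in>C i. real (card {z \<in> part i. adj G x z}))"
      by (simp flip: of_nat_sum)
    also have "\<dots> \<le> (\<Sum>x\<in>C i. Y + E)" using card_nbrs_part C(1)[OF i] by (intro sum_mono) auto
    also have "\<dots> = card (C i) * (Y + E)" by simp
    also have "\<dots> \<le> (2 * b) * (2 * Y)"
      using C(3)[OF i] M E_le_Y E_ge_1 Y_nonneg by (intro mult_mono) (auto simp: T_def)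
    finally show ?thesis by simp
  qed
  define J where "J = join_edges (verts G) full cls"
  have finJ: "finite J" unfolding J_def using fin by (rule finite_join_edges)
  have finE: "finite (edges G)" using simple by (rule finite_edges)
  have split: "edges G \<subseteq> (edges G \<inter> J) \<union> (\<Union>i<p. inner i)"
  proof
    fix e assume e: "e \<in> edges G"
    then obtain u v where uv: "e = {u, v}" "u \<in> verts G" "v \<in> verts G" "u \<noteq> v"
      using simple_graph_edgeE[OF simple] by metis
    show "e \<in> (edges G \<inter> J) \<union> (\<Union>i<p. inner i)"
    proof (cases "e \<in> J")
      case False
      then have "u \<notin> full" "v \<notin> full" "cls u = cls v" using uv by (auto simp: J_def join_edges_iff)
      then have "e \<in> inner (cls u)" "cls u < p" using uv e cls(1)[of u] by (auto simp: inner_def part_def)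
      then show ?thesis by blast
    qed (use e in blast)
  qed
  have eG: "real (card (edges G)) \<le> card (edges G \<inter> J) + 4 * (real b ^ 2 * Y)"
  proof -
    have "card (edges G) \<le> card ((edges G \<inter> J) \<union> (\<Union>i<p. inner i))"
      using split finE by (intro card_mono) (auto simp: inner_def)
    also have "\<dots> \<le> card (edges G \<inter> J) + card (\<Union>i<p. inner i)" by (rule card_Un_le)
    also have "card (\<Union>i<p. inner i) \<le> (\<Sum>i<p. card (inner i))" by (intro card_UN_le) simp
    finally have "real (card (edges G)) \<le> card (edges G \<inter> J) + (\<Sum>i<p. real (card (inner i)))"
      by (simp flip: of_nat_sum of_nat_add)
    also have "(\<Sum>i<p. real (card (inner i))) \<le> (\<Sum>i<p. 4 * (b * Y))"
      using inner by (intro sum_mono) auto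
    also have "\<dots> = p * (4 * (b * Y))" by simp
    also have "\<dots> \<le> b * (4 * (b * Y))" using pb Y_nonneg by (intro mult_right_mono) auto
    also have "\<dots> = 4 * (real b ^ 2 * Y)" by (simp add: power_numeral_reduce)
    finally show ?thesis by simp
  qed
  have JE: "card J \<le> h_num n p (card full + 1)"
    unfolding J_def using fin full_sub cls(1) by (intro card_join_edges_le) auto
  have EJ: "card (edges G \<inter> J) \<le> card J" using finJ by (intro card_mono) auto
  \<comment> \<open>Rounding and the shift by \<open>k\<close> cost less than \<open>k + 1\<close>,
    hence less than \<open>E\<close>.\<close>
  have nk: "real n / p - E \<le> (n - k) div p"
  proof -
    have "real (n - k) / p < real_of_int \<lfloor>real (n - k) / real p\<rfloor> + 1" by linarith
    then have "real (n - k) / p < (n - k) div p + 1" by (simp add: floor_divide_of_nat_eq)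
    moreover have "real n - k \<le> real (n - k)" by linarith
    then have "(real n - k) / p \<le> real (n - k) / p" by (intro divide_right_mono) auto
    moreover have "(real n - k) / p = n / p - k / p" by (simp add: diff_divide_distrib)
    moreover have "real k / p \<le> k" using p by (simp add: field_simps mult_le_cancel_left1)
    moreover have "k + 1 \<le> E" using E_large kb by simp
    ultimately show ?thesis by linarith
  qed
  \<comment> \<open>With fewer than \<open>k\<close> full vertices \<open>J\<close> would fall short
    of \<open>h_num n p (k + 1)\<close> by about \<open>n / p\<close>, more than the edges inside
    parts can make up.\<close>
  have cf: "card full = k"
  proof (rule ccontr)
    assume "card full \<noteq> k"
    then have lt: "card full < k" using card_full_le[OF k b free] by simp
    have "k \<le> n"
    proof -
      have "real k \<le> E" using E_large kb by simp
      also have "E \<le> n" using E_le_Y E_ge_1 n_bounds(2) Y_nonneg by linarith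
      finally show ?thesis by simp
    qed
    then have "h_num n p (card full + 1) + (n - k) div p \<le> h_num n p (k + 1)"
      using h_num_mono[OF lt, of n p] p by simp
    then have "real (h_num n p (card full + 1)) + (n - k) div p \<le> card (edges G)" using many by linarith
    moreover have "real (card (edges G \<inter> J)) \<le> h_num n p (card full + 1)" using EJ JE by simp
    ultimately have "real ((n - k) div p) \<le> 4 * (real b ^ 2 * Y)" using eG by linarith
    then show False using nk b3Y_le_part b2Y_le_b3Y bY_le_b2Y Y_le_bY E_le_Y E_ge_1 by linarith
  qed
  \<comment> \<open>Each non-neighbour of a full vertex is an edge of \<open>J\<close> missing from
    \<open>G\<close>. Since \<open>J\<close> has at most \<open>h_num n p (k + 1)\<close> edges, no
    more can be missing than \<open>G\<close> has outside \<open>J\<close>. The vertex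
    \<open>v\<close> is set aside because it may lie in \<open>I j\<close>.\<close>
  have nonadj_full: "nonadj v j \<le> 5 * (real b ^ 2 * Y)" if v: "v \<in> full" and j: "j < p" for v j
  proof -
    let ?Z = "{z \<in> I j. \<not> adj G v z} - {v}"
    have finZ: "finite ?Z" using finI[OF j] by simp
    have "card ?Z = card ((\<lambda>z. {v, z}) ` ?Z)"
      by (rule card_image[symmetric]) (auto simp: inj_on_def doubleton_eq_iff)
    also have "\<dots> \<le> card (J - edges G)"
      using finJ v full_sub I_sub[OF j] by (intro card_mono) (auto simp: J_def join_edges_iff adj_def)
    also have "\<dots> = card J - card (edges G \<inter> J)"
      using finJ by (simp add: card_Diff_subset_Int Int_commute)
    finally have "card ?Z + card (edges G \<inter> J) \<le> card J" using EJ by simp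
    then have "real (card ?Z) \<le> 4 * (real b ^ 2 * Y)" using eG JE many cf by simp
    moreover have "nonadj v j \<le> card ?Z + 1"
      unfolding nonadj_def using diff_card_le_card_Diff[of "{v}" "{z \<in> I j. \<not> adj G v z}"] by simp
    ultimately show ?thesis using bY_le_b2Y Y_le_bY E_le_Y E_ge_1 Y_nonneg by linarith
  qed
  have part_indep: "\<not> adj G x z" if x: "x \<in> part i" "z \<in> part i" for x z i
  proof
    assume xz: "adj G x z"
    have i: "i < p" using x cls(1) by (auto simp: part_def)
    have finf: "finite full" using full_sub fin finite_subset by blast
    obtain g where g: "bij_betw g ({..k} - {1}) full"
      using finite_same_card_bij[of "{..k} - {1}" full] finf cf k by auto
    \<comment> \<open>The \<open>k\<close> full vertices take all indices but 1. The ends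
      \<open>x\<close> and \<open>z\<close> of the offending edge become two new vertices of the
      clique on \<open>{1, 2}\<close>, whose other \<open>p - 1\<close> vertices fit into the
      classes different from \<open>i\<close>.\<close>
    define w where "w j = (if j = 1 then x else g j)" for j
    have wf: "w j \<in> full" if "j \<le> k" "j \<noteq> 1" for j
      using bij_betwE[OF g] that by (auto simp: w_def)
    have xz': "x \<noteq> z" "x \<notin> full" "z \<notin> full" "x \<in> verts G" "z \<in> verts G"
      using simple_graph_adjD[OF simple xz] x by (auto simp: part_def)
    have w1: "w 1 = x" by (simp add: w_def)
    have winj: "inj_on w {..k}"
    proof (rule inj_onI)
      fix a c assume ac: "a \<in> {..k}" "c \<in> {..k}" "w a = w c"
      have "c = 1" if "a = 1" using ac(2,3) wf[of c] w1 xz'(2) that by auto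
      moreover have "a = 1" if "c = 1" using ac(1,3) wf[of a] w1 xz'(2) that by auto
      moreover have "a = c" if "a \<noteq> 1" "c \<noteq> 1"
        using ac that inj_onD[OF bij_betw_imp_inj_on[OF g], of a c] by (simp add: w_def)
      ultimately show "a = c" by blast
    qed
    have small: "nonadj u c \<le> 5 * (real b ^ 2 * Y)"
      if "u \<in> full \<or> u \<in> {x, z} \<and> c \<noteq> i" "c < p" for u c
      using that nonadj_full[of u c] nonadj_cls[of u c] x bY_le_b2Y Y_le_bY Y_nonneg by (force simp: part_def)
    have big: "b * (d + 1) \<le> card {a \<in> I c. Q a}"
      if "c < p" "finite B" "card B \<le> 3" "\<And>u. u \<in> B \<Longrightarrow> u \<in> full \<or> u \<in> {x, z} \<and> c \<noteq> i"
        "\<And>a. (\<forall>u\<in>B. adj G u a) \<longleftrightarrow> Q a" for c B Q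
    proof -
      have "b * (d + 1) \<le> card {a \<in> I c. \<forall>u\<in>B. adj G u a}"
        using that small p pb by (intro common_nbrs) auto
      then show ?thesis using that(5) by simp
    qed
    have "2 \<le> card ({..<p} - {i})" using i p by simp
    then obtain c1 c2 where c12: "c1 \<in> {..<p} - {i}" "c2 \<in> {..<p} - {i}" "c1 \<noteq> c2"
      by (metis card_2_iff insert_subset obtain_subset_with_card_n)
    have k2: "1 \<le> k" "2 \<le> k" using k by auto
    have c3: "card {u, v, a} \<le> 3" for u v a :: 'a by (simp add: card_insert_if)
    have "contains_copy G (edge_blowup (double_broom (2 * k) s t) (p + 1))"
    proof (rule broom_blowup_embedding[where k = k and p = p and s = s and t = t and w = w and I = I and q = 2 and y = z and L = "{..<p} - {i}"
          and ?c1.0 = c1 and ?c2.0 = c2 and d = d, folded b, OF k p simple winj])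
      show "w ` {..k} \<subseteq> verts G" using wf xz' full_sub w1 by fastforce
      show "2 = 1 \<or> 2 = 2 \<and> z \<in> verts G \<and> z \<notin> w ` {..k} \<and> adj G (w 1) z"
        using xz xz' wf w1 by (metis (no_types, lifting) atMost_iff imageE)
      show "b * (d + 1) \<le> card {a \<in> I c. adj G (w j) a}" if "j \<le> k" "j \<noteq> 1" "c < p" for j c
        by (rule big[of c "{w j}"]) (use that wf in auto)
      show "b * (d + 1) \<le> card {a \<in> I c. adj G (w 1) a \<and> (2 = 2 \<longrightarrow> adj G z a)}" if "c \<in> {..<p} - {i}" for c
        by (rule big[of c "{x, z}"]) (use that w1 in \<open>auto simp: card_insert_if\<close>)
      show "b * (d + 1) \<le> card {a \<in> I c1. adj G (w 0) a \<and> adj G (w 1) a \<and> (2 = 2 \<longrightarrow> adj G z a)}"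
        by (rule big[of c1 "{w 0, x, z}", OF _ _ c3]) (use c12 w1 wf[of 0] in auto)
      show "b * (d + 1) \<le> card {a \<in> I c2. adj G (w 1) a \<and> adj G (w 2) a \<and> (2 = 2 \<longrightarrow> adj G z a)}"
        by (rule big[of c2 "{w 2, x, z}", OF _ _ c3]) (use c12 w1 wf[of 2] k2 in auto)
      show "\<exists>c<p. b * (d + 1) \<le> card {a \<in> I c. adj G (w j) a \<and> adj G (w (j + 1)) a}"
        if "2 \<le> j" "j < k" for j
      proof (intro exI conjI)
        show "0 < p" using p by simp
        then show "b * (d + 1) \<le> card {a \<in> I 0. adj G (w j) a \<and> adj G (w (j + 1)) a}"
          using that wf[of j] wf[of "j + 1"] by (intro big[of 0 "{w j, w (j + 1)}"]) (auto simp: card_insert_if)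
      qed
    qed (use c12 I_sub nonadj_I(2) i in auto)
    then show False using free by blast
  qed
  have "edges G \<subseteq> J"
  proof
    fix e assume e: "e \<in> edges G"
    then obtain u v where uv: "e = {u, v}" "u \<in> verts G" "v \<in> verts G" "u \<noteq> v" "adj G u v"
      using simple_graph_edgeE[OF simple] by metis
    show "e \<in> J"
    proof (rule ccontr)
      assume "e \<notin> J"
      then have "u \<in> part (cls v)" "v \<in> part (cls v)" using uv by (auto simp: J_def join_edges_iff part_def)
      then show False using part_indep uv(5) by blast
    qed
  qed
  \<comment> \<open>\<open>h_num n p (k + 1)\<close> bounds \<open>card J\<close> from above and
    \<open>card (edges G)\<close> from below, so the inclusion is an equality.\<close>
  moreover have "card J \<le> card (edges G)" using JE many cf by simp
  ultimately have eq: "edges G = J" using finJ by (simp add: card_seteq)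
  then have "card J = h_num n p (card full + 1)" using JE many cf by simp
  then show ?thesis
    using fin full_sub cf cls(1) p eq
    by (intro graph_iso_H_graph[where W = full and c = cls] join_edges_balanced) (auto simp: J_def)
qed

end

section \<open>Progressive induction\<close>

lemma double_broom_blowup_size:
  fixes k p s t :: nat
  assumes "k \<ge> 1" "p \<ge> 2"
  defines "b \<equiv> card (verts (edge_blowup (double_broom (2 * k) s t) (p + 1)))"
  shows "p \<le> b" "k \<le> b" "card (edges (double_broom (2 * k) s t)) \<le> b"
proof -
  define T where "T = double_broom (2 * k) s t"
  let ?X = "verts (edge_blowup T (p + 1))"
  have T: "simple_graph T" using assms(1) by (simp add: T_def simple_graph_double_broom)
  have fin: "finite ?X" by (rule finite_verts_edge_blowup[OF T])
  have b: "b = card ?X" by (simp add: b_def T_def)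
  have e: "{0, 1} \<in> edges T" using assms(1) by (auto simp: T_def broom_edge_iff)
  have eX: "Inr (e, j) \<in> ?X" if "e \<in> edges T" "j < p - 1" for e j
    using that by (fastforce simp: edge_blowup_def blowup_clique_def)
  have "Inl ` {..<2 * k} \<subseteq> ?X" by (auto simp: edge_blowup_def T_def double_broom_def)
  then have "card (Inl ` {..<2 * k} :: (nat + nat set \<times> nat) set) \<le> b" unfolding b by (rule card_mono[OF fin])
  then have "2 * k \<le> b" by (simp add: card_image)
  then show "k \<le> b" by simp
  have "insert (Inl 0) ((\<lambda>j. Inr ({0, 1}, j)) ` {..<p - 1}) \<subseteq> ?X"
  proof -
    have "Inl 0 \<in> ?X" using assms(1) by (simp add: edge_blowup_def T_def double_broom_def)
    then show ?thesis using eX[OF e] by blast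
  qed
  then have "card (insert (Inl 0) ((\<lambda>j. Inr ({0, 1}, j)) ` {..<p - 1}) :: (nat + nat set \<times> nat) set) \<le> b"
    unfolding b by (rule card_mono[OF fin])
  then show "p \<le> b" using assms(2) by (subst (asm) card_insert_disjoint) (auto simp: card_image inj_on_def)
  have "(\<lambda>e. Inr (e, 0)) ` edges T \<subseteq> ?X" using eX assms(2) by auto
  then have "card ((\<lambda>e. Inr (e, 0)) ` edges T :: (nat + nat set \<times> nat) set) \<le> b"
    unfolding b by (rule card_mono[OF fin])
  then show "card (edges (double_broom (2 * k) s t)) \<le> b"
    by (subst (asm) card_image) (auto simp: inj_on_def T_def)
qed

lemma extremal_with_turan_degrees:
  fixes p k s t :: nat
  assumes p: "p \<ge> 3" and k: "k \<ge> 2"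
  shows "\<exists>N. \<forall>G :: 'a sgraph. simple_graph G \<longrightarrow> N \<le> card (verts G) \<longrightarrow> turan_degrees p G \<longrightarrow>
    \<not> contains_copy G (edge_blowup (double_broom (2 * k) s t) (p + 1)) \<longrightarrow>
    h_num (card (verts G)) p (k + 1) \<le> card (edges G) \<longrightarrow> graph_iso G (H_graph (card (verts G)) p (k + 1))"
proof -
  define T where "T = double_broom (2 * k) s t"
  define b where "b = card (verts (edge_blowup T (p + 1)))"
  have T: "simple_graph T" using k by (simp add: T_def simple_graph_double_broom)
  have sizes: "p \<le> b" "k \<le> b" "card (edges T) \<le> b"
    using double_broom_blowup_size[of k p s t] p k by (auto simp: b_def T_def)
  have b_ge_3: "real b \<ge> 3" using sizes p by simp
  \<comment> \<open>Chosen so that \<open>E = \<epsilon> * n\<close> and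
    \<open>Y = n / (16 * b^4)\<close> satisfy \<open>16 * b^2 * E = Y\<close> and
    \<open>16 * b^4 * Y = n\<close>.\<close>
  define \<epsilon> where "\<epsilon> = 1 / (256 * real b ^ 6)"
  have \<epsilon>: "\<epsilon> > 0" using b_ge_3 by (simp add: \<epsilon>_def)
  obtain N where N: "\<And>G :: 'a sgraph. simple_graph G \<Longrightarrow> N \<le> card (verts G) \<Longrightarrow> turan_degrees p G \<Longrightarrow>
    \<not> contains_copy G (edge_blowup T (p + 1)) \<Longrightarrow>
    (\<exists>I. (\<forall>i<p. I i \<subseteq> verts G \<and> (\<forall>x\<in>I i. \<forall>y\<in>I i. \<not> adj G x y)) \<and>
      (\<forall>i<p. \<forall>j<p. i \<noteq> j \<longrightarrow> I i \<inter> I j = {}) \<and>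
      real (card (verts G - (\<Union>i<p. I i))) \<le> \<epsilon> * card (verts G))"
    using blowup_free_independent_sets[OF T p \<epsilon>, of "broom_side k s", where 'a = 'a]
      broom_side_proper[of k _ _ s t] k unfolding T_def by (metis One_nat_def Suc_1 Suc_leD)
  \<comment> \<open>From here on \<open>\<epsilon> * n\<close> is at least \<open>b + p + 1\<close>,
    the lower bound required of \<open>E\<close>.\<close>
  obtain N' :: nat where N': "(b + p + 1) / \<epsilon> \<le> N'" using real_arch_simple by blast
  have "graph_iso G (H_graph (card (verts G)) p (k + 1))"
    if G: "simple_graph G" and large: "max N N' \<le> card (verts G)" and deg: "turan_degrees p G"
      and free: "\<not> contains_copy G (edge_blowup T (p + 1))"
      and many: "h_num (card (verts G)) p (k + 1) \<le> card (edges G)" for G :: "'a sgraph"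
  proof -
    define n where "n = card (verts G)"
    obtain I where I: "\<And>i. i < p \<Longrightarrow> I i \<subseteq> verts G" "\<And>i x y. i < p \<Longrightarrow> x \<in> I i \<Longrightarrow> y \<in> I i \<Longrightarrow> \<not> adj G x y"
      "\<And>i j. i < p \<Longrightarrow> j < p \<Longrightarrow> i \<noteq> j \<Longrightarrow> I i \<inter> I j = {}"
      "real (card (verts G - (\<Union>i<p. I i))) \<le> \<epsilon> * n"
      using N[OF G _ deg free] large unfolding n_def by (metis max.boundedE)
    have "(b + p + 1) / \<epsilon> \<le> n" using N' large by (simp add: n_def)
    then have E_ge_1: "b + p + 1 \<le> \<epsilon> * n" using \<epsilon> by (simp add: field_simps)
    have E2: "16 * real b ^ 2 * (\<epsilon> * n) = n / (16 * real b ^ 4)"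
      using b_ge_3 by (simp add: \<epsilon>_def field_simps power_numeral_reduce)
    have E3: "16 * real b ^ 4 * (n / (16 * real b ^ 4)) = n" using b_ge_3 by simp
    interpret near_turan G p b I "\<epsilon> * n" "n / (16 * real b ^ 4)"
    proof unfold_locales
      show "real (b + p + 1) \<le> \<epsilon> * n" by (rule E_ge_1)
      show "16 * real b ^ 2 * (\<epsilon> * n) \<le> n / (16 * real b ^ 4)" using E2 by simp
      show "16 * real b ^ 4 * (n / (16 * real b ^ 4)) \<le> card (verts G)" using E3 by (simp add: n_def)
    qed (use G p deg I sizes in \<open>auto simp: n_def\<close>)
    show ?thesis
      using iso_H_graph[OF k, of s t] free many sizes unfolding b_def T_def by blast
  qed
  then show ?thesis unfolding T_def by blast
qed

section \<open>Deleting vertices of small degree\<close>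

definition delete_vertex :: "'a \<Rightarrow> 'a sgraph \<Rightarrow> 'a sgraph" where
  "delete_vertex v G = \<lparr>verts = verts G - {v}, edges = {e \<in> edges G. v \<notin> e}\<rparr>"

lemma simple_graph_delete_vertex: "simple_graph G \<Longrightarrow> simple_graph (delete_vertex v G)"
  by (auto simp: simple_graph_def delete_vertex_def nsets_def)

lemma contains_copy_delete_vertex: "contains_copy (delete_vertex v G) F \<Longrightarrow> contains_copy G F"
  unfolding contains_copy_def delete_vertex_def by fastforce

lemma card_edges_delete_vertex:
  assumes G: "simple_graph G"
  shows "card (edges G) = card (edges (delete_vertex v G)) + card {u \<in> verts G. adj G v u}"
proof -
  have fin: "finite (edges G)" using G by (rule finite_edges)
  have "{e \<in> edges G. v \<in> e} = (\<lambda>u. {v, u}) ` {u \<in> verts G. adj G v u}"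
  proof (intro equalityI subsetI)
    fix e assume "e \<in> {e \<in> edges G. v \<in> e}"
    then have e: "e \<in> edges G" "v \<in> e" by auto
    obtain x y where xy: "e = {x, y}" "x \<in> verts G" "y \<in> verts G" "adj G x y"
      using simple_graph_edgeE[OF G e(1)] by metis
    then have "e = {v, x} \<and> adj G v x \<or> e = {v, y} \<and> adj G v y" using e adj_commute[of G x y] by auto
    then show "e \<in> (\<lambda>u. {v, u}) ` {u \<in> verts G. adj G v u}" using xy by auto
  qed (auto simp: adj_def)
  moreover have "inj_on (\<lambda>u. {v, u}) {u \<in> verts G. adj G v u}" by (auto simp: inj_on_def doubleton_eq_iff)
  ultimately have "card {e \<in> edges G. v \<in> e} = card {u \<in> verts G. adj G v u}" by (simp add: card_image)
  moreover have "card (edges G) = card ({e \<in> edges G. v \<notin> e} \<union> {e \<in> edges G. v \<in> e})"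
    by (rule arg_cong[of _ _ card]) auto
  moreover have "\<dots> = card {e \<in> edges G. v \<notin> e} + card {e \<in> edges G. v \<in> e}"
    using fin by (intro card_Un_disjoint) auto
  ultimately show ?thesis by (simp add: delete_vertex_def)
qed

lemma graph_iso_card_edges:
  assumes "simple_graph G" "graph_iso G H" shows "card (edges H) = card (edges G)"
proof -
  obtain f where f: "bij_betw f (verts G) (verts H)" "edges H = (\<lambda>e. f ` e) ` edges G"
    using assms(2) by (auto simp: graph_iso_def)
  have "inj_on (\<lambda>e. f ` e) (Pow (verts G))" using f(1) by (simp add: bij_betw_def inj_on_image_Pow)
  moreover have "edges G \<subseteq> Pow (verts G)" using assms(1) by (auto simp: simple_graph_def nsets_def)
  ultimately show ?thesis unfolding f(2) by (meson card_image inj_on_subset)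
qed

text \<open>The crude bound serves twice: it limits the excess where the induction stops, and it
  makes the set under \<open>Max\<close> finite.\<close>

lemma card_edges_le:
  assumes "simple_graph G" shows "card (edges G) \<le> card (verts G) ^ 2"
proof -
  have fin: "finite (verts G)" using assms by (simp add: simple_graph_def)
  have "edges G \<subseteq> (\<lambda>(u, v). {u, v}) ` (verts G \<times> verts G)"
  proof
    fix e assume "e \<in> edges G"
    then obtain u v where "e = {u, v}" "u \<in> verts G" "v \<in> verts G"
      using simple_graph_edgeE[OF assms] by metis
    then show "e \<in> (\<lambda>(u, v). {u, v}) ` (verts G \<times> verts G)" by auto
  qed
  then have "card (edges G) \<le> card ((\<lambda>(u, v). {u, v}) ` (verts G \<times> verts G))"
    using fin by (intro card_mono) auto
  also have "\<dots> \<le> card (verts G \<times> verts G)" using fin by (intro card_image_le) auto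
  finally show ?thesis by (simp add: card_cartesian_product power2_eq_square)
qed

text \<open>Deleting a vertex that violates \<^const>\<open>turan_degrees\<close> increases the excess over \<^const>\<open>h_num\<close>,
  and the excess on \<open>N\<close> vertices is at most \<open>N\<^sup>2\<close>.\<close>

lemma extremal_unique:
  fixes p k s t :: nat
  assumes p: "p \<ge> 3" and k: "k \<ge> 2"
  shows "\<exists>N. \<forall>G :: 'a sgraph. simple_graph G \<longrightarrow> N \<le> card (verts G) \<longrightarrow>
    \<not> contains_copy G (edge_blowup (double_broom (2 * k) s t) (p + 1)) \<longrightarrow>
    h_num (card (verts G)) p (k + 1) \<le> card (edges G) \<longrightarrow> graph_iso G (H_graph (card (verts G)) p (k + 1))"
proof -
  define F where "F = edge_blowup (double_broom (2 * k) s t) (p + 1)"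
  obtain N0 where N0: "\<And>G :: 'a sgraph. simple_graph G \<Longrightarrow> N0 \<le> card (verts G) \<Longrightarrow> turan_degrees p G \<Longrightarrow>
    \<not> contains_copy G F \<Longrightarrow> h_num (card (verts G)) p (k + 1) \<le> card (edges G) \<Longrightarrow>
    graph_iso G (H_graph (card (verts G)) p (k + 1))"
    using extremal_with_turan_degrees[OF p k, of s t, where 'a = 'a] unfolding F_def by blast
  define N where "N = max N0 k"
  \<comment> \<open>Here \<open>x\<close> is a lower bound for the excess. Each deletion lowers
    \<open>n\<close> by one and raises \<open>x\<close> by at least one, so \<open>x + n\<close>
    does not decrease until \<open>n = N\<close>, where it is at most \<open>N ^ 2 + N\<close>. If
    the deletions stop earlier, the structure theorem makes the excess zero, which is possible only
    if nothing was deleted.\<close>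
  have key: "x = 0 \<and> graph_iso G (H_graph n p (k + 1)) \<or> x + n \<le> N + N ^ 2"
    if "N \<le> n" and G: "simple_graph G" "card (verts G) = n" "\<not> contains_copy G F"
      "h_num n p (k + 1) + x \<le> card (edges G)" for n x and G :: "'a sgraph"
    using that
  proof (induction n arbitrary: G x rule: dec_induct)
    case base
    then show ?case using card_edges_le[of G] by simp
  next
    case (step n)
    show ?case
    proof (cases "turan_degrees p G")
      case True
      have iso: "graph_iso G (H_graph (Suc n) p (k + 1))"
        using True N0[of G] step.prems step.hyps by (auto simp: N_def)
      have "card (edges G) = h_num (Suc n) p (k + 1)"
        using graph_iso_card_edges[OF step.prems(1) iso] unfolding h_num_def by (rule sym)
      then show ?thesis using iso step.prems(4) by simp
    next
      case False
      \<comment> \<open>\<open>v\<close> has fewer than \<open>n - (n + 1) / p\<close> neighbours,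
        while by \<open>h_num_Suc\<close> one vertex more is worth \<open>n - (n - k) div p\<close>
        edges; so removing \<open>v\<close> gains at least one over \<open>h_num\<close>.\<close>
      then obtain v where v: "v \<in> verts G" "real (card {u \<in> verts G. \<not> adj G v u}) > Suc n / p + 1"
        using step.prems(2) by (auto simp: turan_degrees_def not_le)
      have fin: "finite (verts G)" using step.prems(1) by (simp add: simple_graph_def)
      let ?G = "delete_vertex v G"
      have "card (verts G) = card ({u \<in> verts G. adj G v u} \<union> {u \<in> verts G. \<not> adj G v u})"
        by (rule arg_cong[of _ _ card]) auto
      also have "\<dots> = card {u \<in> verts G. adj G v u} + card {u \<in> verts G. \<not> adj G v u}"
        using fin by (intro card_Un_disjoint) auto
      finally have "real (card {u \<in> verts G. adj G v u}) < n - Suc n / p"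
        using v(2) step.prems(2) by linarith
      moreover have "(n - k) div p \<le> Suc n / p"
      proof -
        have "real ((n - k) div p) \<le> real (n - k) / p" by (rule of_nat_div_le_of_nat)
        also have "\<dots> \<le> Suc n / p" by (intro divide_right_mono) auto
        finally show ?thesis .
      qed
      ultimately have "real (card {u \<in> verts G. adj G v u} + (n - k) div p) < n" by simp
      then have "card {u \<in> verts G. adj G v u} + (n - k) div p < n" by (simp only: of_nat_less_iff)
      moreover have "h_num (Suc n) p (k + 1) + (n - k) div p = h_num n p (k + 1) + n"
        using h_num_Suc[of k n p] step.hyps p by (simp add: N_def)
      ultimately have more: "h_num n p (k + 1) + (x + 1) \<le> card (edges ?G)"
        using card_edges_delete_vertex[OF step.prems(1), of v] step.prems(4) by linarith
      have "card (verts ?G) = n" using v(1) step.prems(2) fin by (simp add: delete_vertex_def)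
      then have "x + 1 = 0 \<and> graph_iso ?G (H_graph n p (k + 1)) \<or> (x + 1) + n \<le> N + N ^ 2"
        using step.prems contains_copy_delete_vertex[of v G F] more
        by (intro step.IH simple_graph_delete_vertex) auto
      then show ?thesis by simp
    qed
  qed
  show ?thesis
  \<comment> \<open>Beyond this bound the second alternative of \<open>key\<close> fails already for
    \<open>x = 0\<close>.\<close>
  proof (intro exI[of _ "N + N ^ 2 + 1"] allI impI)
    fix G :: "'a sgraph"
    assume G: "simple_graph G" "N + N ^ 2 + 1 \<le> card (verts G)"
      "\<not> contains_copy G (edge_blowup (double_broom (2 * k) s t) (p + 1))"
      "h_num (card (verts G)) p (k + 1) \<le> card (edges G)"
    then show "graph_iso G (H_graph (card (verts G)) p (k + 1))"
      using key[of "card (verts G)" G 0] by (simp add: F_def)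
  qed
qed

lemma H_graph_blowup_free:
  assumes "p \<ge> 1" "k \<ge> 2" "s \<ge> 1" "t \<ge> 1"
  shows "\<not> contains_copy (H_graph n p (k + 1)) (edge_blowup (double_broom (2 * k) s t) (p + 1))"
proof (rule join_graph_broom_blowup_free[OF assms(2-4,1)])
  show "edges (H_graph n p (k + 1)) \<subseteq> join_edges (verts (H_graph n p (k + 1))) (Inl ` {..<k})
      (\<lambda>x. case x of Inl _ \<Rightarrow> 0 | Inr v \<Rightarrow> v mod p)"
    unfolding H_graph_eq by (rule order_refl)
  show "(case v of Inl _ \<Rightarrow> 0 | Inr v \<Rightarrow> v mod p) < p" for v :: "nat + nat"
    using assms(1) by (simp split: sum.split)
qed (simp_all add: card_image)

text \<open>\<open>ex_num\<close> ranges over graphs on the naturals, while \<open>H_graph\<close>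
  lives on a sum type; the transported copy shows that the maximum is attained.\<close>

lemma ex_nat_copy:
  fixes G :: "'a sgraph"
  assumes "simple_graph G"
  obtains G' :: "nat sgraph" where "simple_graph G'" "card (verts G') = card (verts G)"
    "card (edges G') = card (edges G)" "\<And>F :: 'b sgraph. contains_copy G' F \<Longrightarrow> contains_copy G F"
proof -
  have fin: "finite (verts G)" using assms by (simp add: simple_graph_def)
  obtain f where f: "bij_betw f (verts G) {..<card (verts G)}"
    using ex_bij_betw_finite_nat[OF fin] by (auto simp: atLeast0LessThan)
  define G' where "G' = \<lparr>verts = {..<card (verts G)}, edges = (\<lambda>e. f ` e) ` edges G\<rparr>"
  have eG: "e \<subseteq> verts G" "card e = 2" if "e \<in> edges G" for e
    using that assms by (auto simp: simple_graph_def nsets_def)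
  have inj: "inj_on f (verts G)" using f by (simp add: bij_betw_def)
  have "f ` e \<in> nsets {..<card (verts G)} 2" if "e \<in> edges G" for e
    using eG[OF that] f inj fin by (auto simp: nsets_def bij_betw_def card_image inj_on_subset intro: finite_subset)
  then have "simple_graph G'" by (auto simp: simple_graph_def G'_def)
  moreover have "graph_iso G G'" using f by (auto simp: graph_iso_def G'_def)
  then have "card (edges G') = card (edges G)" by (rule graph_iso_card_edges[OF assms])
  moreover have "contains_copy G F" if F: "contains_copy G' F" for F :: "'b sgraph"
  proof -
    obtain g where g: "inj_on g (verts F)" "g ` verts F \<subseteq> {..<card (verts G)}"
      "\<And>e. e \<in> edges F \<Longrightarrow> g ` e \<in> (\<lambda>e. f ` e) ` edges G"
      using F by (auto simp: contains_copy_def G'_def)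
    let ?i = "inv_into (verts G) f"
    have i: "bij_betw ?i {..<card (verts G)} (verts G)" using f by (rule bij_betw_inv_into)
    have "inj_on (?i \<circ> g) (verts F)"
      using g i by (intro comp_inj_on) (auto simp: bij_betw_def intro: inj_on_subset)
    moreover have "(?i \<circ> g) ` verts F \<subseteq> verts G" using g(2) i by (auto simp: bij_betw_def)
    moreover have "(?i \<circ> g) ` e \<in> edges G" if e: "e \<in> edges F" for e
    proof -
      obtain a where a: "a \<in> edges G" "g ` e = f ` a" using g(3)[OF e] by auto
      have "(?i \<circ> g) ` e = ?i ` (g ` e)" by (rule image_comp[symmetric])
      also have "\<dots> = ?i ` (f ` a)" by (simp only: a(2))
      finally have "(?i \<circ> g) ` e = ?i ` (f ` a)" .
      also have "\<dots> = a" using inj eG(1)[OF a(1)] by (simp add: inv_into_image_cancel)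
      finally show ?thesis using a(1) by simp
    qed
    ultimately show ?thesis unfolding contains_copy_def by blast
  qed
  ultimately show thesis by (intro that[of G']) (auto simp: G'_def)
qed

theorem corollary1p6:
  fixes p k s t :: nat
  assumes "p \<ge> 3" and "k \<ge> 2" and "s \<ge> 2" and "t \<ge> 2"
  shows "(\<forall>\<^sub>F n in sequentially.
            ex_num n (edge_blowup (double_broom (2 * k) s t) (p + 1)) = h_num n p (k + 1))
       \<and> (\<forall>\<^sub>F n in sequentially.
            extremal_graph n (edge_blowup (double_broom (2 * k) s t) (p + 1)) (H_graph n p (k + 1))
          \<and> (\<forall>G :: 'a sgraph.
               extremal_graph n (edge_blowup (double_broom (2 * k) s t) (p + 1)) G
                 \<longrightarrow> graph_iso G (H_graph n p (k + 1))))"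
proof -
  define F where "F = edge_blowup (double_broom (2 * k) s t) (p + 1)"
  obtain N1 where N1: "\<And>G :: 'a sgraph. simple_graph G \<Longrightarrow> N1 \<le> card (verts G) \<Longrightarrow> \<not> contains_copy G F \<Longrightarrow>
    h_num (card (verts G)) p (k + 1) \<le> card (edges G) \<Longrightarrow> graph_iso G (H_graph (card (verts G)) p (k + 1))"
    using extremal_unique[OF assms(1,2), of s t, where 'a = 'a] unfolding F_def by blast
  \<comment> \<open>A second instance on the type \<open>nat\<close>: the value of
    \<open>ex_num\<close> concerns graphs on the naturals, uniqueness those on
    \<open>'a\<close>.\<close>
  obtain N2 where N2: "\<And>G :: nat sgraph. simple_graph G \<Longrightarrow> N2 \<le> card (verts G) \<Longrightarrow> \<not> contains_copy G F \<Longrightarrow>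
    h_num (card (verts G)) p (k + 1) \<le> card (edges G) \<Longrightarrow> graph_iso G (H_graph (card (verts G)) p (k + 1))"
    using extremal_unique[OF assms(1,2), of s t, where 'a = nat] unfolding F_def by blast
  define N where "N = Max {N1, N2, k}"
  have free: "free_graph_on n F (H_graph n p (k + 1))" if "N \<le> n" for n
    using H_graph_blowup_free[of p k s t n] assms that simple_graph_H_graph card_verts_H_graph[of k n p]
    by (auto simp: free_graph_on_def F_def N_def)
  have ex: "ex_num n F = h_num n p (k + 1)" if n: "N \<le> n" for n
    unfolding ex_num_def
  proof (rule Max_eqI)
    have "{card (edges G) |G :: nat sgraph. free_graph_on n F G} \<subseteq> {..n ^ 2}"
      using card_edges_le by (auto simp: free_graph_on_def)
    then show "finite {card (edges G) |G :: nat sgraph. free_graph_on n F G}"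
      using finite_subset by blast
    show "x \<le> h_num n p (k + 1)" if x: "x \<in> {card (edges G) |G :: nat sgraph. free_graph_on n F G}" for x
    proof -
      obtain G :: "nat sgraph" where G: "x = card (edges G)" "simple_graph G" "card (verts G) = n" "\<not> contains_copy G F"
        using x by (auto simp: free_graph_on_def)
      show ?thesis
      proof (cases "h_num n p (k + 1) \<le> x")
        case True
        then have "graph_iso G (H_graph n p (k + 1))" using N2[of G] G n by (simp add: N_def)
        from graph_iso_card_edges[OF G(2) this] show ?thesis by (simp add: h_num_def G(1))
      qed simp
    qed
    obtain G' :: "nat sgraph" where "simple_graph G'" "card (verts G') = card (verts (H_graph n p (k + 1)))"
      "card (edges G') = card (edges (H_graph n p (k + 1)))"
      "\<And>F :: (nat + nat set \<times> nat) sgraph. contains_copy G' F \<Longrightarrow> contains_copy (H_graph n p (k + 1)) F"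
      using ex_nat_copy[OF simple_graph_H_graph] by blast
    then have "free_graph_on n F G' \<and> card (edges G') = h_num n p (k + 1)"
      using free[OF n] by (auto simp: free_graph_on_def h_num_def)
    then show "h_num n p (k + 1) \<in> {card (edges G) |G :: nat sgraph. free_graph_on n F G}" by force
  qed
  have "extremal_graph n F (H_graph n p (k + 1)) \<and>
      (\<forall>G :: 'a sgraph. extremal_graph n F G \<longrightarrow> graph_iso G (H_graph n p (k + 1)))" if n: "N \<le> n" for n
  proof (intro conjI allI impI)
    show "extremal_graph n F (H_graph n p (k + 1))"
      using free[OF n] ex[OF n] by (simp add: extremal_graph_def h_num_def)
    fix G :: "'a sgraph" assume "extremal_graph n F G"
    then show "graph_iso G (H_graph n p (k + 1))"
      using N1[of G] n ex[OF n] by (auto simp: extremal_graph_def free_graph_on_def N_def)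
  qed
  then show ?thesis
    using ex unfolding F_def eventually_sequentially by blast
qed

end
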